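(* On arbitrary finite structures, $\mathsf{SO}\text{-}\mathsf{HORN}^r$ has the same expressive power as $\mathsf{FO(LFP)}$: every $\mathsf{SO}\text{-}\mathsf{HORN}^r$ sentence is equivalent on all finite structures to an $\mathsf{FO(LFP)}$ sentence, and vice versa.
   Context: $\mathsf{SO}\text{-}\mathsf{HORN}^r(\sigma)$ (second-order revised Horn logic) is the set of second-order sentences of the form $Q_1R_1\cdots Q_mR_m\forall\bar x(C_1\wedge\dots\wedge C_n)$ with $Q_i\in\{\forall,\exists\}$, $R_1,\dots,R_m$ relation variables, and each $C_j$ an implication $\alpha_1\wedge\dots\wedge\alpha_l\wedge\beta_1\wedge\dots\wedge\beta_q\rightarrow H$ where each $\alpha_s$ is either an atom $R_i\bar x$ or a formula $\forall\bar z R_i\bar y\bar z$; each $\beta_t$ is an atom $P\bar y$ or its negation with $P\in\sigma$; and $H$ is an atom $R_k\bar u$ or $\bot$. $\mathsf{FO(LFP)}$ is first-order logic extended by the least fixed-point operator.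
   Formalization: Equality is treated as a logical symbol: the β_t in clauses may also be x=y or ¬x=y, not only (negated) atoms Pȳ with P∈σ; without inequalities the claim fails (e.g. "some x has exactly one E-successor" would not be expressible). *)

theory Defs
  imports Main
begin

section \<open>Structures\<close>

text \<open>
  A relational vocabulary is a set \<open>\<sigma>\<close> of relation symbols together with an arity function \<open>ar\<close>.
\<close>

definition tuples :: "nat \<Rightarrow> 'a set \<Rightarrow> 'a list set" where
  "tuples n A = {as. length as = n \<and> set as \<subseteq> A}"

record ('p, 'a) struct =
  universe :: "'a set"
  interp :: "'p \<Rightarrow> 'a list set"

definition finite_structure :: "'p set \<Rightarrow> ('p \<Rightarrow> nat) \<Rightarrow> ('p, 'a) struct \<Rightarrow> bool" where
  "finite_structure \<sigma> ar M \<longleftrightarrow>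
     finite (universe M) \<and> universe M \<noteq> {} \<and> (\<forall>P\<in>\<sigma>. interp M P \<subseteq> tuples (ar P) (universe M))"


section \<open>Formulas\<close>

text \<open>
  \<open>SO-HORN\<^sup>r\<close> and \<open>FO(LFP)\<close> are defined as two fragments of one ambient logic: first-order
  logic with equality, second-order quantifiers and least fixed points.
  \<open>Lfp X xs \<phi> us\<close> is the formula \<open>[LFP\<^bsub>X,xs\<^esub> \<phi>](us)\<close>; it binds \<open>X\<close> and \<open>xs\<close> in \<open>\<phi>\<close>, but not in \<open>us\<close>.
\<close>

type_synonym var = nat

datatype rvar = RVar (rv_index: nat) (rv_arity: nat)

datatype 'p fm =
    Bot
  | Pred 'p "var list"
  | Eq var var
  | Rel rvar "var list"
  | Neg "'p fm"
  | And "'p fm" "'p fm"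
  | Or "'p fm" "'p fm"
  | Imp "'p fm" "'p fm"
  | Ex var "'p fm"
  | All var "'p fm"
  | SOEx rvar "'p fm"
  | SOAll rvar "'p fm"
  | Lfp rvar "var list" "'p fm" "var list"

primrec free_vars :: "'p fm \<Rightarrow> var set" where
  "free_vars Bot = {}"
| "free_vars (Pred P ys) = set ys"
| "free_vars (Eq x y) = {x, y}"
| "free_vars (Rel R ys) = set ys"
| "free_vars (Neg \<phi>) = free_vars \<phi>"
| "free_vars (And \<phi> \<psi>) = free_vars \<phi> \<union> free_vars \<psi>"
| "free_vars (Or \<phi> \<psi>) = free_vars \<phi> \<union> free_vars \<psi>"
| "free_vars (Imp \<phi> \<psi>) = free_vars \<phi> \<union> free_vars \<psi>"
| "free_vars (Ex x \<phi>) = free_vars \<phi> - {x}"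
| "free_vars (All x \<phi>) = free_vars \<phi> - {x}"
| "free_vars (SOEx R \<phi>) = free_vars \<phi>"
| "free_vars (SOAll R \<phi>) = free_vars \<phi>"
| "free_vars (Lfp X xs \<phi> us) = (free_vars \<phi> - set xs) \<union> set us"

primrec free_rvars :: "'p fm \<Rightarrow> rvar set" where
  "free_rvars Bot = {}"
| "free_rvars (Pred P ys) = {}"
| "free_rvars (Eq x y) = {}"
| "free_rvars (Rel R ys) = {R}"
| "free_rvars (Neg \<phi>) = free_rvars \<phi>"
| "free_rvars (And \<phi> \<psi>) = free_rvars \<phi> \<union> free_rvars \<psi>"
| "free_rvars (Or \<phi> \<psi>) = free_rvars \<phi> \<union> free_rvars \<psi>"
| "free_rvars (Imp \<phi> \<psi>) = free_rvars \<phi> \<union> free_rvars \<psi>"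
| "free_rvars (Ex x \<phi>) = free_rvars \<phi>"
| "free_rvars (All x \<phi>) = free_rvars \<phi>"
| "free_rvars (SOEx R \<phi>) = free_rvars \<phi> - {R}"
| "free_rvars (SOAll R \<phi>) = free_rvars \<phi> - {R}"
| "free_rvars (Lfp X xs \<phi> us) = free_rvars \<phi> - {X}"

text \<open>
  \<open>polarity True X \<phi>\<close> (\<open>polarity False X \<phi>\<close>): every free occurrence of \<open>X\<close> in \<open>\<phi>\<close> is positive (negative).
\<close>

primrec polarity :: "bool \<Rightarrow> rvar \<Rightarrow> 'p fm \<Rightarrow> bool" where
  "polarity b X Bot \<longleftrightarrow> True"
| "polarity b X (Pred P ys) \<longleftrightarrow> True"
| "polarity b X (Eq x y) \<longleftrightarrow> True"
| "polarity b X (Rel R ys) \<longleftrightarrow> R = X \<longrightarrow> b"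
| "polarity b X (Neg \<phi>) \<longleftrightarrow> polarity (\<not> b) X \<phi>"
| "polarity b X (And \<phi> \<psi>) \<longleftrightarrow> polarity b X \<phi> \<and> polarity b X \<psi>"
| "polarity b X (Or \<phi> \<psi>) \<longleftrightarrow> polarity b X \<phi> \<and> polarity b X \<psi>"
| "polarity b X (Imp \<phi> \<psi>) \<longleftrightarrow> polarity (\<not> b) X \<phi> \<and> polarity b X \<psi>"
| "polarity b X (Ex x \<phi>) \<longleftrightarrow> polarity b X \<phi>"
| "polarity b X (All x \<phi>) \<longleftrightarrow> polarity b X \<phi>"
| "polarity b X (SOEx R \<phi>) \<longleftrightarrow> R = X \<or> polarity b X \<phi>"
| "polarity b X (SOAll R \<phi>) \<longleftrightarrow> R = X \<or> polarity b X \<phi>"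
| "polarity b X (Lfp Y xs \<phi> us) \<longleftrightarrow> Y = X \<or> polarity b X \<phi>"

primrec wf_fm :: "'p set \<Rightarrow> ('p \<Rightarrow> nat) \<Rightarrow> 'p fm \<Rightarrow> bool" where
  "wf_fm \<sigma> ar Bot \<longleftrightarrow> True"
| "wf_fm \<sigma> ar (Pred P ys) \<longleftrightarrow> P \<in> \<sigma> \<and> length ys = ar P"
| "wf_fm \<sigma> ar (Eq x y) \<longleftrightarrow> True"
| "wf_fm \<sigma> ar (Rel R ys) \<longleftrightarrow> length ys = rv_arity R"
| "wf_fm \<sigma> ar (Neg \<phi>) \<longleftrightarrow> wf_fm \<sigma> ar \<phi>"
| "wf_fm \<sigma> ar (And \<phi> \<psi>) \<longleftrightarrow> wf_fm \<sigma> ar \<phi> \<and> wf_fm \<sigma> ar \<psi>"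
| "wf_fm \<sigma> ar (Or \<phi> \<psi>) \<longleftrightarrow> wf_fm \<sigma> ar \<phi> \<and> wf_fm \<sigma> ar \<psi>"
| "wf_fm \<sigma> ar (Imp \<phi> \<psi>) \<longleftrightarrow> wf_fm \<sigma> ar \<phi> \<and> wf_fm \<sigma> ar \<psi>"
| "wf_fm \<sigma> ar (Ex x \<phi>) \<longleftrightarrow> wf_fm \<sigma> ar \<phi>"
| "wf_fm \<sigma> ar (All x \<phi>) \<longleftrightarrow> wf_fm \<sigma> ar \<phi>"
| "wf_fm \<sigma> ar (SOEx R \<phi>) \<longleftrightarrow> wf_fm \<sigma> ar \<phi>"
| "wf_fm \<sigma> ar (SOAll R \<phi>) \<longleftrightarrow> wf_fm \<sigma> ar \<phi>"
| "wf_fm \<sigma> ar (Lfp X xs \<phi> us) \<longleftrightarrow>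
     wf_fm \<sigma> ar \<phi> \<and> polarity True X \<phi> \<and> distinct xs \<and>
     length xs = rv_arity X \<and> length us = rv_arity X"

definition sentence :: "'p set \<Rightarrow> ('p \<Rightarrow> nat) \<Rightarrow> 'p fm \<Rightarrow> bool" where
  "sentence \<sigma> ar \<phi> \<longleftrightarrow> wf_fm \<sigma> ar \<phi> \<and> free_vars \<phi> = {} \<and> free_rvars \<phi> = {}"


section \<open>Semantics\<close>

definition assign :: "(var \<Rightarrow> 'a) \<Rightarrow> var list \<Rightarrow> 'a list \<Rightarrow> var \<Rightarrow> 'a" where
  "assign v xs as = (\<lambda>x. case map_of (zip xs as) x of None \<Rightarrow> v x | Some a \<Rightarrow> a)"

text \<open>
  The fixed point is taken in the lattice of all sets of lists. As the operator only produces
  tuples over the universe of the right length, this is its least fixed point on the relations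
  over the universe.
\<close>

primrec sat :: "('p, 'a) struct \<Rightarrow> (rvar \<Rightarrow> 'a list set) \<Rightarrow> (var \<Rightarrow> 'a) \<Rightarrow> 'p fm \<Rightarrow> bool" where
  "sat M I v Bot \<longleftrightarrow> False"
| "sat M I v (Pred P ys) \<longleftrightarrow> map v ys \<in> interp M P"
| "sat M I v (Eq x y) \<longleftrightarrow> v x = v y"
| "sat M I v (Rel R ys) \<longleftrightarrow> map v ys \<in> I R"
| "sat M I v (Neg \<phi>) \<longleftrightarrow> \<not> sat M I v \<phi>"
| "sat M I v (And \<phi> \<psi>) \<longleftrightarrow> sat M I v \<phi> \<and> sat M I v \<psi>"
| "sat M I v (Or \<phi> \<psi>) \<longleftrightarrow> sat M I v \<phi> \<or> sat M I v \<psi>"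
| "sat M I v (Imp \<phi> \<psi>) \<longleftrightarrow> (sat M I v \<phi> \<longrightarrow> sat M I v \<psi>)"
| "sat M I v (Ex x \<phi>) \<longleftrightarrow> (\<exists>a\<in>universe M. sat M I (v(x := a)) \<phi>)"
| "sat M I v (All x \<phi>) \<longleftrightarrow> (\<forall>a\<in>universe M. sat M I (v(x := a)) \<phi>)"
| "sat M I v (SOEx R \<phi>) \<longleftrightarrow> (\<exists>S\<subseteq>tuples (rv_arity R) (universe M). sat M (I(R := S)) v \<phi>)"
| "sat M I v (SOAll R \<phi>) \<longleftrightarrow> (\<forall>S\<subseteq>tuples (rv_arity R) (universe M). sat M (I(R := S)) v \<phi>)"
| "sat M I v (Lfp X xs \<phi> us) \<longleftrightarrow>
     map v us \<in> lfp (\<lambda>S. {as \<in> tuples (length xs) (universe M). sat M (I(X := S)) (assign v xs as) \<phi>})"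

definition models :: "('p, 'a) struct \<Rightarrow> 'p fm \<Rightarrow> bool" where
  "models M \<phi> \<longleftrightarrow> (\<forall>I v. range v \<subseteq> universe M \<longrightarrow> sat M I v \<phi>)"


section \<open>The two logics\<close>

fun conjs :: "'p fm list \<Rightarrow> 'p fm" where
  "conjs [] = Neg Bot"
| "conjs [\<phi>] = \<phi>"
| "conjs (\<phi> # \<psi> # \<phi>s) = And \<phi> (conjs (\<psi> # \<phi>s))"

definition alls :: "var list \<Rightarrow> 'p fm \<Rightarrow> 'p fm" where
  "alls xs \<phi> = foldr All xs \<phi>"

datatype quantifier = Exists | Forall

fun so_prefix :: "(quantifier \<times> rvar) list \<Rightarrow> 'p fm \<Rightarrow> 'p fm" where
  "so_prefix [] \<phi> = \<phi>"
| "so_prefix ((Exists, R) # Qs) \<phi> = SOEx R (so_prefix Qs \<phi>)"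
| "so_prefix ((Forall, R) # Qs) \<phi> = SOAll R (so_prefix Qs \<phi>)"

text \<open>The conjuncts \<open>R ys\<close> and \<open>\<forall>zs. R ys zs\<close> of a clause body; the tuple \<open>ys\<close> may be empty.\<close>

definition horn_alpha :: "'p fm \<Rightarrow> bool" where
  "horn_alpha \<alpha> \<longleftrightarrow>
     (\<exists>R ys. \<alpha> = Rel R ys) \<or>
     (\<exists>R ys zs. \<alpha> = alls zs (Rel R (ys @ zs)) \<and> distinct zs \<and> set ys \<inter> set zs = {})"

text \<open>
  As usual in first-order logic, equality is a logical symbol that belongs to every vocabulary, so
  that equalities and inequalities count as atoms and negated atoms over the vocabulary.
\<close>

definition horn_beta :: "'p fm \<Rightarrow> bool" where
  "horn_beta \<beta> \<longleftrightarrow>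
     (\<exists>P ys. \<beta> = Pred P ys \<or> \<beta> = Neg (Pred P ys)) \<or>
     (\<exists>x y. \<beta> = Eq x y \<or> \<beta> = Neg (Eq x y))"

definition horn_head :: "'p fm \<Rightarrow> bool" where
  "horn_head H \<longleftrightarrow> H = Bot \<or> (\<exists>R us. H = Rel R us)"

definition horn_clause :: "'p fm \<Rightarrow> bool" where
  "horn_clause C \<longleftrightarrow>
     (\<exists>\<alpha>s \<beta>s H. C = Imp (conjs (\<alpha>s @ \<beta>s)) H \<and>
        (\<forall>\<alpha>\<in>set \<alpha>s. horn_alpha \<alpha>) \<and> (\<forall>\<beta>\<in>set \<beta>s. horn_beta \<beta>) \<and> horn_head H)"

definition so_horn_r :: "'p set \<Rightarrow> ('p \<Rightarrow> nat) \<Rightarrow> 'p fm set" where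
  "so_horn_r \<sigma> ar = {\<phi>. sentence \<sigma> ar \<phi> \<and>
     (\<exists>Qs xs Cs. \<phi> = so_prefix Qs (alls xs (conjs Cs)) \<and>
        distinct (map snd Qs) \<and> distinct xs \<and> (\<forall>C\<in>set Cs. horn_clause C))}"

primrec no_so_quantifiers :: "'p fm \<Rightarrow> bool" where
  "no_so_quantifiers Bot \<longleftrightarrow> True"
| "no_so_quantifiers (Pred P ys) \<longleftrightarrow> True"
| "no_so_quantifiers (Eq x y) \<longleftrightarrow> True"
| "no_so_quantifiers (Rel R ys) \<longleftrightarrow> True"
| "no_so_quantifiers (Neg \<phi>) \<longleftrightarrow> no_so_quantifiers \<phi>"
| "no_so_quantifiers (And \<phi> \<psi>) \<longleftrightarrow> no_so_quantifiers \<phi> \<and> no_so_quantifiers \<psi>"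
| "no_so_quantifiers (Or \<phi> \<psi>) \<longleftrightarrow> no_so_quantifiers \<phi> \<and> no_so_quantifiers \<psi>"
| "no_so_quantifiers (Imp \<phi> \<psi>) \<longleftrightarrow> no_so_quantifiers \<phi> \<and> no_so_quantifiers \<psi>"
| "no_so_quantifiers (Ex x \<phi>) \<longleftrightarrow> no_so_quantifiers \<phi>"
| "no_so_quantifiers (All x \<phi>) \<longleftrightarrow> no_so_quantifiers \<phi>"
| "no_so_quantifiers (SOEx R \<phi>) \<longleftrightarrow> False"
| "no_so_quantifiers (SOAll R \<phi>) \<longleftrightarrow> False"
| "no_so_quantifiers (Lfp X xs \<phi> us) \<longleftrightarrow> no_so_quantifiers \<phi>"

definition fo_lfp :: "'p set \<Rightarrow> ('p \<Rightarrow> nat) \<Rightarrow> 'p fm set" where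
  "fo_lfp \<sigma> ar = {\<phi>. sentence \<sigma> ar \<phi> \<and> no_so_quantifiers \<phi>}"


section \<open>Equivalence on finite structures\<close>

text \<open>
  Quantification over all finite structures, inside an existential quantifier over sentences,
  needs one type of universes that does not depend on a type variable. Every finite structure
  is isomorphic to one whose universe is a set of natural numbers, and the lemma
  \<open>finitely_equivalent_any_type\<close> below transfers the equivalence to universes of any type.
\<close>

definition finitely_equivalent :: "'p set \<Rightarrow> ('p \<Rightarrow> nat) \<Rightarrow> 'p fm \<Rightarrow> 'p fm \<Rightarrow> bool" where
  "finitely_equivalent \<sigma> ar \<phi> \<psi> \<longleftrightarrow>
     (\<forall>M :: ('p, nat) struct. finite_structure \<sigma> ar M \<longrightarrow> (models M \<phi> \<longleftrightarrow> models M \<psi>))"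

lemma assign_map:
  assumes "length xs = length as"
  shows "f \<circ> assign v xs as = assign (f \<circ> v) xs (map f as)"
proof
  fix x
  have "map_of (zip xs (map f as)) x = map_option f (map_of (zip xs as) x)"
    using assms by (induction xs as rule: list_induct2) auto
  then show "(f \<circ> assign v xs as) x = assign (f \<circ> v) xs (map f as) x"
    by (simp add: assign_def split: option.split)
qed

lemma range_assign:
  assumes "range v \<subseteq> A" "set as \<subseteq> A"
  shows "range (assign v xs as) \<subseteq> A"
proof -
  have "assign v xs as x \<in> A" for x
    using assms by (cases "map_of (zip xs as) x")
      (auto simp: assign_def dest!: map_of_SomeD set_zip_rightD)
  then show ?thesis by auto
qed

lemma map_tuples: "map f ` tuples n A \<subseteq> tuples n (f ` A)"
  by (auto simp: tuples_def intro!: imageI dest: subsetD)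

lemma map_image_iff:
  assumes "inj_on f A" "S \<subseteq> lists A" "set as \<subseteq> A"
  shows "map f as \<in> map f ` S \<longleftrightarrow> as \<in> S"
proof
  assume "map f as \<in> map f ` S"
  then obtain bs where bs: "bs \<in> S" "map f as = map f bs" by auto
  with assms have "inj_on f (set as \<union> set bs)" by (blast intro: inj_on_subset)
  with bs show "as \<in> S" by (metis map_inj_on)
qed simp

lemma sat_isomorphic:
  fixes M :: "('p, 'a) struct" and N :: "('p, 'b) struct"
  assumes inj: "inj_on f (universe M)" and surj: "f ` universe M = universe N"
    and pres: "\<forall>P\<in>\<sigma>. \<forall>as. set as \<subseteq> universe M \<longrightarrow> (map f as \<in> interp N P \<longleftrightarrow> as \<in> interp M P)"
  shows "wf_fm \<sigma> ar \<phi> \<Longrightarrow> range v \<subseteq> universe M \<Longrightarrow>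
    (\<And>R as. set as \<subseteq> universe M \<Longrightarrow> map f as \<in> J R \<longleftrightarrow> as \<in> I R) \<Longrightarrow>
    sat N J (f \<circ> v) \<phi> \<longleftrightarrow> sat M I v \<phi>"
proof (induction \<phi> arbitrary: v I J)
  case (Pred P ys)
  have "map (f \<circ> v) ys = map f (map v ys)" "set (map v ys) \<subseteq> universe M"
    using Pred.prems(2) by auto
  with Pred.prems(1) pres show ?case by (metis sat.simps(2) wf_fm.simps(2))
next
  case (Eq x y)
  then show ?case using inj by (auto simp: inj_on_def range_subsetD)
next
  case (Rel R ys)
  have "map (f \<circ> v) ys = map f (map v ys)" "set (map v ys) \<subseteq> universe M"
    using Rel.prems(2) by auto
  with Rel.prems(3) show ?case by (metis sat.simps(4))
next
  case (Neg \<phi>)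
  show ?case using Neg.IH[of v J I] Neg.prems by simp
next
  case (And \<phi>1 \<phi>2)
  show ?case using And.IH[of v J I] And.prems by simp
next
  case (Or \<phi>1 \<phi>2)
  show ?case using Or.IH[of v J I] Or.prems by simp
next
  case (Imp \<phi>1 \<phi>2)
  show ?case using Imp.IH[of v J I] Imp.prems by simp
next
  case (Ex x \<phi>)
  have "sat N J ((f \<circ> v)(x := f a)) \<phi> \<longleftrightarrow> sat M I (v(x := a)) \<phi>" if "a \<in> universe M" for a
  proof -
    have "(f \<circ> v)(x := f a) = f \<circ> v(x := a)" "range (v(x := a)) \<subseteq> universe M"
      using Ex.prems(2) that by (auto split: if_splits)
    moreover have "wf_fm \<sigma> ar \<phi>" using Ex.prems(1) by simp
    ultimately show ?thesis using Ex.IH Ex.prems(3) by presburger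
  qed
  then show ?case unfolding sat.simps surj[symmetric] by blast
next
  case (All x \<phi>)
  have "sat N J ((f \<circ> v)(x := f a)) \<phi> \<longleftrightarrow> sat M I (v(x := a)) \<phi>" if "a \<in> universe M" for a
  proof -
    have "(f \<circ> v)(x := f a) = f \<circ> v(x := a)" "range (v(x := a)) \<subseteq> universe M"
      using All.prems(2) that by (auto split: if_splits)
    moreover have "wf_fm \<sigma> ar \<phi>" using All.prems(1) by simp
    ultimately show ?thesis using All.IH All.prems(3) by presburger
  qed
  then show ?case unfolding sat.simps surj[symmetric] by blast
next
  case (SOEx R \<phi>)
  have step: "sat N (J(R := T)) (f \<circ> v) \<phi> \<longleftrightarrow> sat M (I(R := S)) v \<phi>"
    if "\<And>as. set as \<subseteq> universe M \<Longrightarrow> map f as \<in> T \<longleftrightarrow> as \<in> S" for S T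
    by (rule SOEx.IH) (use SOEx.prems that in auto)
  show ?case
  proof
    assume "sat N J (f \<circ> v) (SOEx R \<phi>)"
    then obtain T where T: "T \<subseteq> tuples (rv_arity R) (universe N)" "sat N (J(R := T)) (f \<circ> v) \<phi>" by auto
    let ?S = "{as \<in> tuples (rv_arity R) (universe M). map f as \<in> T}"
    have "map f as \<in> T \<longleftrightarrow> as \<in> ?S" if "set as \<subseteq> universe M" for as
      using that by (auto simp: tuples_def dest: subsetD[OF T(1)])
    from step[OF this] T(2) have "sat M (I(R := ?S)) v \<phi>" by blast
    moreover have "?S \<subseteq> tuples (rv_arity R) (universe M)" by blast
    ultimately show "sat M I v (SOEx R \<phi>)" unfolding sat.simps by blast
  next
    assume "sat M I v (SOEx R \<phi>)"
    then obtain S where S: "S \<subseteq> tuples (rv_arity R) (universe M)" "sat M (I(R := S)) v \<phi>" by auto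
    have "map f as \<in> map f ` S \<longleftrightarrow> as \<in> S" if "set as \<subseteq> universe M" for as
      using S(1) that by (intro map_image_iff[OF inj]) (auto simp: tuples_def)
    from step[OF this] S(2) have "sat N (J(R := map f ` S)) (f \<circ> v) \<phi>" by blast
    moreover have "map f ` S \<subseteq> tuples (rv_arity R) (universe N)"
      unfolding surj[symmetric] by (rule subset_trans[OF image_mono[OF S(1)] map_tuples])
    ultimately show "sat N J (f \<circ> v) (SOEx R \<phi>)" unfolding sat.simps by blast
  qed
next
  case (SOAll R \<phi>)
  have step: "sat N (J(R := T)) (f \<circ> v) \<phi> \<longleftrightarrow> sat M (I(R := S)) v \<phi>"
    if "\<And>as. set as \<subseteq> universe M \<Longrightarrow> map f as \<in> T \<longleftrightarrow> as \<in> S" for S T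
    by (rule SOAll.IH) (use SOAll.prems that in auto)
  show ?case
  proof
    assume l: "sat N J (f \<circ> v) (SOAll R \<phi>)"
    have "sat M (I(R := S)) v \<phi>" if S: "S \<subseteq> tuples (rv_arity R) (universe M)" for S
    proof -
      have eq: "map f as \<in> map f ` S \<longleftrightarrow> as \<in> S" if "set as \<subseteq> universe M" for as
        using S that by (intro map_image_iff[OF inj]) (auto simp: tuples_def)
      have "map f ` S \<subseteq> tuples (rv_arity R) (universe N)"
        unfolding surj[symmetric] by (rule subset_trans[OF image_mono[OF S] map_tuples])
      then have *: "sat N (J(R := map f ` S)) (f \<circ> v) \<phi>" using l by simp
      show ?thesis using step[OF eq] * by blast
    qed
    then show "sat M I v (SOAll R \<phi>)" by simp
  next
    assume r: "sat M I v (SOAll R \<phi>)"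
    have "sat N (J(R := T)) (f \<circ> v) \<phi>" if T: "T \<subseteq> tuples (rv_arity R) (universe N)" for T
    proof -
      let ?S = "{as \<in> tuples (rv_arity R) (universe M). map f as \<in> T}"
      have eq: "map f as \<in> T \<longleftrightarrow> as \<in> ?S" if "set as \<subseteq> universe M" for as
        using that by (auto simp: tuples_def dest: subsetD[OF T])
      have *: "sat M (I(R := ?S)) v \<phi>" using r by auto
      show ?thesis using step[OF eq] * by blast
    qed
    then show "sat N J (f \<circ> v) (SOAll R \<phi>)" by simp
  qed
next
  case (Lfp X xs \<phi> us)
  define F where
    "F S = {as \<in> tuples (length xs) (universe M). sat M (I(X := S)) (assign v xs as) \<phi>}" for S
  define G where
    "G T = {bs \<in> tuples (length xs) (universe N). sat N (J(X := T)) (assign (f \<circ> v) xs bs) \<phi>}" for T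
  have FG: "map f as \<in> G T \<longleftrightarrow> as \<in> F S"
    if ST: "\<And>as. set as \<subseteq> universe M \<Longrightarrow> map f as \<in> T \<longleftrightarrow> as \<in> S" and as: "set as \<subseteq> universe M" for S T as
  proof (cases "length as = length xs")
    case True
    have "sat N (J(X := T)) (f \<circ> assign v xs as) \<phi> \<longleftrightarrow> sat M (I(X := S)) (assign v xs as) \<phi>"
      by (rule Lfp.IH) (use Lfp.prems ST range_assign[OF Lfp.prems(2) as] in auto)
    moreover have "f ` set as \<subseteq> universe N" using as surj by blast
    ultimately show ?thesis using True as assign_map[of xs as f v]
      by (auto simp: F_def G_def tuples_def)
  qed (auto simp: F_def G_def tuples_def)
  have lfp_iff: "map f as \<in> lfp G \<longleftrightarrow> as \<in> lfp F" if as: "set as \<subseteq> universe M" for as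
  proof
    assume l: "map f as \<in> lfp G"
    show "as \<in> lfp F" unfolding lfp_def
    proof (intro InterI, clarify)
      fix S assume S: "F S \<subseteq> S"
      define T where "T = map f ` (S \<inter> lists (universe M))"
      have T: "map f cs \<in> T \<longleftrightarrow> cs \<in> S" if "set cs \<subseteq> universe M" for cs
        using map_image_iff[OF inj, of "S \<inter> lists (universe M)" cs] that by (auto simp: T_def)
      have "G T \<subseteq> T"
      proof
        fix bs assume bs: "bs \<in> G T"
        then have "bs \<in> lists (f ` universe M)" by (auto simp: G_def tuples_def surj)
        then obtain cs where cs: "set cs \<subseteq> universe M" "bs = map f cs" by (auto simp: lists_image)
        with bs FG[OF T] S T show "bs \<in> T" by blast
      qed
      with l have "map f as \<in> T" by (auto simp: lfp_def)
      with T as show "as \<in> S" by blast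
    qed
  next
    assume r: "as \<in> lfp F"
    show "map f as \<in> lfp G" unfolding lfp_def
    proof (intro InterI, clarify)
      fix T assume T: "G T \<subseteq> T"
      define S where "S = {as \<in> lists (universe M). map f as \<in> T}"
      have S: "map f cs \<in> T \<longleftrightarrow> cs \<in> S" if "set cs \<subseteq> universe M" for cs
        using that by (auto simp: S_def)
      have "F S \<subseteq> S"
      proof
        fix cs assume cs: "cs \<in> F S"
        then have "set cs \<subseteq> universe M" by (auto simp: F_def tuples_def)
        with cs FG[OF S] T S show "cs \<in> S" by blast
      qed
      with r have "as \<in> S" by (auto simp: lfp_def)
      with S as show "map f as \<in> T" by blast
    qed
  qed
  have "set (map v us) \<subseteq> universe M" using Lfp.prems(2) by auto
  from lfp_iff[OF this] show ?case
    unfolding sat.simps F_def[abs_def] G_def[abs_def] map_map .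
qed simp

lemma models_isomorphic:
  fixes M :: "('p, 'a) struct" and N :: "('p, 'b) struct"
  assumes inj: "inj_on f (universe M)" and surj: "f ` universe M = universe N"
    and pres: "\<forall>P\<in>\<sigma>. \<forall>as. set as \<subseteq> universe M \<longrightarrow> (map f as \<in> interp N P \<longleftrightarrow> as \<in> interp M P)"
    and wf: "wf_fm \<sigma> ar \<phi>"
  shows "models N \<phi> \<longleftrightarrow> models M \<phi>"
proof
  assume N: "models N \<phi>"
  show "models M \<phi>" unfolding models_def
  proof (intro allI impI)
    fix I and v :: "var \<Rightarrow> 'a" assume v: "range v \<subseteq> universe M"
    define J where "J = (\<lambda>R :: rvar. map f ` (I R \<inter> lists (universe M)))"
    have "map f as \<in> J R \<longleftrightarrow> as \<in> I R" if "set as \<subseteq> universe M" for R as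
      using map_image_iff[OF inj, of "I R \<inter> lists (universe M)" as] that by (auto simp: J_def)
    moreover have "range (f \<circ> v) \<subseteq> universe N" using v surj by fastforce
    then have "sat N J (f \<circ> v) \<phi>" using N by (simp add: models_def)
    ultimately show "sat M I v \<phi>" using sat_isomorphic[OF inj surj pres wf v] by blast
  qed
next
  assume M: "models M \<phi>"
  show "models N \<phi>" unfolding models_def
  proof (intro allI impI)
    fix J :: "rvar \<Rightarrow> 'b list set" and w :: "var \<Rightarrow> 'b" assume w: "range w \<subseteq> universe N"
    define I where "I = (\<lambda>R :: rvar. {as. map f as \<in> J R})"
    define v where "v = inv_into (universe M) f \<circ> w"
    have v: "range v \<subseteq> universe M" using w surj by (auto simp: v_def intro!: inv_into_into)
    have "w x \<in> f ` universe M" for x using w surj by auto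
    then have "f \<circ> v = w" by (auto simp: v_def f_inv_into_f)
    moreover have "sat M I v \<phi>" using M v by (auto simp: models_def)
    moreover have "map f as \<in> J R \<longleftrightarrow> as \<in> I R" for R as by (simp add: I_def)
    ultimately show "sat N J w \<phi>" using sat_isomorphic[OF inj surj pres wf v, of J I] by simp
  qed
qed

lemma finitely_equivalent_any_type:
  fixes M :: "('p, 'a) struct"
  assumes "sentence \<sigma> ar \<phi>" "sentence \<sigma> ar \<psi>" "finitely_equivalent \<sigma> ar \<phi> \<psi>"
    and M: "finite_structure \<sigma> ar M"
  shows "models M \<phi> \<longleftrightarrow> models M \<psi>"
proof -
  from M have "finite (universe M)" by (simp add: finite_structure_def)
  from finite_imp_inj_to_nat_seg[OF this]
  obtain f :: "'a \<Rightarrow> nat" where inj: "inj_on f (universe M)" by blast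
  define N where "N = \<lparr>universe = f ` universe M, interp = \<lambda>P. map f ` (interp M P \<inter> lists (universe M))\<rparr>"
  have "map f ` tuples n (universe M) \<subseteq> tuples n (f ` universe M)" for n
    by (rule map_tuples)
  with M have "finite_structure \<sigma> ar N"
    unfolding finite_structure_def N_def struct.simps by blast
  moreover have surj: "f ` universe M = universe N" by (simp add: N_def)
  have pres: "\<forall>P\<in>\<sigma>. \<forall>as. set as \<subseteq> universe M \<longrightarrow> (map f as \<in> interp N P \<longleftrightarrow> as \<in> interp M P)"
  proof (intro ballI allI impI)
    fix P as assume "set as \<subseteq> universe M"
    then show "map f as \<in> interp N P \<longleftrightarrow> as \<in> interp M P"
      using map_image_iff[OF inj, of "interp M P \<inter> lists (universe M)" as] by (auto simp: N_def)
  qed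
  ultimately show ?thesis
    using assms(1-3) models_isomorphic[OF inj surj pres]
    unfolding finitely_equivalent_def sentence_def by blast
qed

end

theory Submission
  imports Defs
begin

text \<open>
  Both logics are compared with programs: finite sets of rules with universally quantified premises,
  evaluated by the least relations closed under the rules. A program becomes a Horn sentence by
  quantifying its relations existentially, and an \<open>FO(LFP)\<close> sentence by coding all relations in one.

  A Horn sentence yields a program since its models are closed under intersections, so that a
  universally quantified relation may be assumed to be full or to lack exactly one tuple; such a
  choice is a tuple and can be passed as an argument.

  For an \<open>FO(LFP)\<close> sentence the program derives the truth value of each subformula. The negation of
  a fixed point is the problem. In the course of the iteration, every stage is represented by a tuple
  which is new at that stage. If a stage and its complement are already derived, then so are the
  truth and the falsity of the body of the operator over it, and hence the next stage and its
  complement. Over a finite structure the iteration ends with a stage that is closed, which the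
  program recognizes by a universally quantified premise, and the complement of this stage is the
  complement of the fixed point.
\<close>

section \<open>Semantics of quantifier blocks\<close>

text \<open>Premises of rules are positive: a program can use that something is derived, but never
  that it is not. So falsity has to be derived like truth, and for a least fixed point this means
  noticing that the iteration has ended. Without an order on the universe stages cannot be counted;
  naming them by tuples avoids this, and only the empty stage needs a flag, as it has no new tuple.
  The universal premises correspond to the conjuncts \<open>\<forall>z R y z\<close> of Horn
  clauses; they turn the absence of further tuples into a positive condition. Both translations of a
  program express that a goal of arity 0 is not derivable: a clause with head \<open>Bot\<close>
  excludes it, respectively the fixed point is negated. Coding all relations in one needs two
  distinct elements. One-element structures are therefore treated apart: there a second-order
  quantifier has two values only and can be expanded. In a Horn sentence an existential relation may
  depend on the universal ones before it, so the choices are carried along as arguments of every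
  later relation.\<close>

lemma sat_alls:
  "sat M I v (alls xs \<phi>) \<longleftrightarrow>
     (\<forall>w. (\<forall>x. x \<notin> set xs \<longrightarrow> w x = v x) \<and> (\<forall>x\<in>set xs. w x \<in> universe M) \<longrightarrow> sat M I w \<phi>)"
proof (induction xs arbitrary: v)
  case Nil
  have "w = v" if "\<forall>x. w x = v x" for w using that by blast
  then show ?case by (auto simp: alls_def)
next
  case (Cons y ys)
  have "sat M I v (alls (y # ys) \<phi>) \<longleftrightarrow> (\<forall>a\<in>universe M. sat M I (v(y := a)) (alls ys \<phi>))"
    by (simp add: alls_def)
  also have "\<dots> \<longleftrightarrow> (\<forall>w. (\<forall>x. x \<notin> set (y # ys) \<longrightarrow> w x = v x) \<and>
      (\<forall>x\<in>set (y # ys). w x \<in> universe M) \<longrightarrow> sat M I w \<phi>)" (is "?l \<longleftrightarrow> ?r")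
  proof
    assume l: ?l
    show ?r
    proof (intro allI impI)
      fix w assume w: "(\<forall>x. x \<notin> set (y # ys) \<longrightarrow> w x = v x) \<and> (\<forall>x\<in>set (y # ys). w x \<in> universe M)"
      then have "sat M I (v(y := w y)) (alls ys \<phi>)" using l by simp
      then show "sat M I w \<phi>" unfolding Cons.IH using w by auto
    qed
  next
    assume r: ?r
    show ?l
    proof
      fix a assume a: "a \<in> universe M"
      show "sat M I (v(y := a)) (alls ys \<phi>)" unfolding Cons.IH
      proof (intro allI impI)
        fix w assume w: "(\<forall>x. x \<notin> set ys \<longrightarrow> w x = (v(y := a)) x) \<and> (\<forall>x\<in>set ys. w x \<in> universe M)"
        then have "w y \<in> universe M" using a by (cases "y \<in> set ys") auto
        with w r show "sat M I w \<phi>" by auto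
      qed
    qed
  qed
  finally show ?case .
qed

lemma assign_notin: "x \<notin> set xs \<Longrightarrow> assign v xs as x = v x"
  by (auto simp: assign_def split: option.split dest!: map_of_SomeD set_zip_leftD)

lemma assign_nth: "distinct xs \<Longrightarrow> length as = length xs \<Longrightarrow> i < length xs \<Longrightarrow> assign v xs as (xs ! i) = as ! i"
  by (simp add: assign_def map_of_zip_nth)

lemma map_assign: "distinct xs \<Longrightarrow> length as = length xs \<Longrightarrow> map (assign v xs as) xs = as"
  by (simp add: list_eq_iff_nth_eq assign_nth)

lemma map_assign_notin: "set ys \<inter> set xs = {} \<Longrightarrow> map (assign v xs as) ys = map v ys"
  by (auto intro!: assign_notin)

lemma sat_alls_Rel:
  assumes "distinct zs" "set ys \<inter> set zs = {}"
  shows "sat M I v (alls zs (Rel R (ys @ zs))) \<longleftrightarrow>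
    (\<forall>cs\<in>tuples (length zs) (universe M). map v ys @ cs \<in> I R)" (is "?l \<longleftrightarrow> ?r")
proof
  assume l: ?l
  show ?r
  proof
    fix cs assume cs: "cs \<in> tuples (length zs) (universe M)"
    let ?w = "assign v zs cs"
    have m: "map ?w zs = cs" using cs assms by (intro map_assign) (auto simp: tuples_def)
    have "set (map ?w zs) \<subseteq> universe M" using cs unfolding m by (simp add: tuples_def)
    then have "\<forall>x\<in>set zs. ?w x \<in> universe M" by auto
    then have "sat M I ?w (Rel R (ys @ zs))" using l unfolding sat_alls by (simp add: assign_notin)
    then have "map ?w ys @ map ?w zs \<in> I R" by simp
    then show "map v ys @ cs \<in> I R" unfolding map_assign_notin[OF assms(2)] m .
  qed
next
  assume r: ?r
  show ?l unfolding sat_alls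
  proof (intro allI impI)
    fix w assume w: "(\<forall>x. x \<notin> set zs \<longrightarrow> w x = v x) \<and> (\<forall>x\<in>set zs. w x \<in> universe M)"
    then have "map w zs \<in> tuples (length zs) (universe M)" by (auto simp: tuples_def)
    moreover have "map w ys = map v ys" using w assms(2) by auto
    ultimately show "sat M I w (Rel R (ys @ zs))" using r by (metis map_append sat.simps(4))
  qed
qed

lemma sat_conjs: "sat M I v (conjs \<phi>s) \<longleftrightarrow> (\<forall>\<phi>\<in>set \<phi>s. sat M I v \<phi>)"
  by (induction \<phi>s rule: conjs.induct) auto

lemma wf_conjs: "wf_fm \<sigma> ar (conjs \<phi>s) \<longleftrightarrow> (\<forall>\<phi>\<in>set \<phi>s. wf_fm \<sigma> ar \<phi>)"
  by (induction \<phi>s rule: conjs.induct) auto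

lemma free_vars_conjs: "free_vars (conjs \<phi>s) = (\<Union>\<phi>\<in>set \<phi>s. free_vars \<phi>)"
  by (induction \<phi>s rule: conjs.induct) auto

lemma free_rvars_conjs: "free_rvars (conjs \<phi>s) = (\<Union>\<phi>\<in>set \<phi>s. free_rvars \<phi>)"
  by (induction \<phi>s rule: conjs.induct) auto

lemma no_so_conjs: "no_so_quantifiers (conjs \<phi>s) \<longleftrightarrow> (\<forall>\<phi>\<in>set \<phi>s. no_so_quantifiers \<phi>)"
  by (induction \<phi>s rule: conjs.induct) auto

lemma polarity_conjs: "polarity b X (conjs \<phi>s) \<longleftrightarrow> (\<forall>\<phi>\<in>set \<phi>s. polarity b X \<phi>)"
  by (induction \<phi>s rule: conjs.induct) auto

lemma alls_simps:
  "wf_fm \<sigma> ar (alls xs \<phi>) \<longleftrightarrow> wf_fm \<sigma> ar \<phi>"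
  "free_vars (alls xs \<phi>) = free_vars \<phi> - set xs"
  "free_rvars (alls xs \<phi>) = free_rvars \<phi>"
  "no_so_quantifiers (alls xs \<phi>) \<longleftrightarrow> no_so_quantifiers \<phi>"
  "polarity b X (alls xs \<phi>) \<longleftrightarrow> polarity b X \<phi>"
  by (induction xs) (auto simp: alls_def)

lemma so_prefix_simps:
  "wf_fm \<sigma> ar (so_prefix Qs \<phi>) \<longleftrightarrow> wf_fm \<sigma> ar \<phi>"
  "free_vars (so_prefix Qs \<phi>) = free_vars \<phi>"
  "free_rvars (so_prefix Qs \<phi>) = free_rvars \<phi> - snd ` set Qs"
  by (induction Qs \<phi> rule: so_prefix.induct) auto

text \<open>Literals over the vocabulary contain no relation variable, so \<open>I\<close> and
  \<open>J\<close> may differ arbitrarily.\<close>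

lemma sat_horn_beta:
  "horn_beta \<beta> \<Longrightarrow> (\<And>x. x \<in> free_vars \<beta> \<Longrightarrow> v x = w x) \<Longrightarrow> sat M I v \<beta> \<longleftrightarrow> sat M J w \<beta>"
  unfolding horn_beta_def by (auto cong: map_cong)

lemma horn_beta_simps:
  "horn_beta \<beta> \<Longrightarrow> free_rvars \<beta> = {}"
  "horn_beta \<beta> \<Longrightarrow> no_so_quantifiers \<beta>"
  "horn_beta \<beta> \<Longrightarrow> polarity b X \<beta>"
  unfolding horn_beta_def by auto

section \<open>Rule programs\<close>

text \<open>
  The premise \<open>(n, ys, k)\<close> of a rule stands for \<open>\<forall>z\<^sub>1\<dots>z\<^sub>k. n ys z\<^sub>1\<dots>z\<^sub>k\<close>.
\<close>

type_synonym ('n, 'p) rule = "('n \<times> var list \<times> nat) list \<times> 'p fm list \<times> 'n \<times> var list"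

text \<open>The premises stay positive under the quantifier over \<open>cs\<close>, so there are
  least relations closed under the rules. The empty interpretation in the test of
  \<open>\<beta>s\<close> is a dummy: in a well-formed rule these are literals without relation
  variables.\<close>

inductive derivable :: "('p, 'a) struct \<Rightarrow> ('n, 'p) rule set \<Rightarrow> 'n \<Rightarrow> 'a list \<Rightarrow> bool"
  for M :: "('p, 'a) struct" and Rs :: "('n, 'p) rule set" where
  derivableI: "(\<alpha>s, \<beta>s, n, us) \<in> Rs \<Longrightarrow> range V \<subseteq> universe M \<Longrightarrow>
    (\<forall>\<alpha>\<in>set \<alpha>s. \<forall>cs\<in>tuples (snd (snd \<alpha>)) (universe M). derivable M Rs (fst \<alpha>) (map V (fst (snd \<alpha>)) @ cs)) \<Longrightarrow>
    (\<forall>\<beta>\<in>set \<beta>s. sat M (\<lambda>_. {}) V \<beta>) \<Longrightarrow> derivable M Rs n (map V us)"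

definition wf_rule :: "'p set \<Rightarrow> ('p \<Rightarrow> nat) \<Rightarrow> ('n \<Rightarrow> nat) \<Rightarrow> ('n, 'p) rule \<Rightarrow> bool" where
  "wf_rule \<sigma> ar far = (\<lambda>(\<alpha>s, \<beta>s, n, us).
     (\<forall>(m, ys, k)\<in>set \<alpha>s. length ys + k = far m) \<and>
     (\<forall>\<beta>\<in>set \<beta>s. horn_beta \<beta> \<and> wf_fm \<sigma> ar \<beta>) \<and> length us = far n)"

definition rule_vars :: "('n, 'p) rule \<Rightarrow> var set" where
  "rule_vars = (\<lambda>(\<alpha>s, \<beta>s, n, us). (\<Union>(m, ys, k)\<in>set \<alpha>s. set ys) \<union> (\<Union>\<beta>\<in>set \<beta>s. free_vars \<beta>) \<union> set us)"

definition rule_names :: "('n, 'p) rule \<Rightarrow> 'n set" where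
  "rule_names = (\<lambda>(\<alpha>s, \<beta>s, n, us). insert n (fst ` set \<alpha>s))"

lemma finite_free_vars: "finite (free_vars \<phi>)"
  by (induction \<phi>) auto

lemma finite_rule_vars: "finite (rule_vars r)"
  by (auto simp: rule_vars_def finite_free_vars split: prod.splits)

lemma finite_rule_names: "finite (rule_names r)"
  by (auto simp: rule_names_def split: prod.splits)

lemma wf_rule_bounded:
  assumes "wf_rule \<sigma> ar far (\<alpha>s, \<beta>s, n, us)" "rule_vars (\<alpha>s, \<beta>s, n, us) \<subseteq> {..<K}"
    "rule_names (\<alpha>s, \<beta>s, n, us) \<subseteq> ns"
  shows "\<forall>(m, ys, k)\<in>set \<alpha>s. set ys \<subseteq> {..<K} \<and> length ys + k = far m \<and> m \<in> ns"
    "\<forall>\<beta>\<in>set \<beta>s. horn_beta \<beta> \<and> wf_fm \<sigma> ar \<beta> \<and> free_vars \<beta> \<subseteq> {..<K}"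
    "set us \<subseteq> {..<K}" "length us = far n" "n \<in> ns"
proof -
  have "set ys \<subseteq> {..<K}" "length ys + k = far m" "m \<in> ns" if "(m, ys, k) \<in> set \<alpha>s" for m ys k
    using bspec[OF conjunct1[OF assms(1)[unfolded wf_rule_def prod.case]] that] assms(2,3) that
    by (auto simp: rule_vars_def rule_names_def)
  then show "\<forall>(m, ys, k)\<in>set \<alpha>s. set ys \<subseteq> {..<K} \<and> length ys + k = far m \<and> m \<in> ns" by blast
qed (use assms in \<open>auto simp: wf_rule_def rule_vars_def rule_names_def\<close>)

text \<open>The variables from \<open>K\<close> on are fresh for all rules at once; they serve as
  the quantified variables of premises and as the variables of the fixed point that simulates a
  program.\<close>

lemma rules_bounded:
  assumes "finite Rs"
  obtains K where "\<And>r. r \<in> Rs \<Longrightarrow> rule_vars r \<subseteq> {..<K}"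
proof -
  have "finite (\<Union>r\<in>Rs. rule_vars r)" using assms finite_rule_vars by blast
  then obtain K where "\<forall>x\<in>(\<Union>r\<in>Rs. rule_vars r). x < K" unfolding finite_nat_set_iff_bounded by blast
  then have "(\<Union>r\<in>Rs. rule_vars r) \<subseteq> {..<K}" by blast
  with that show ?thesis by blast
qed

lemma derivable_tuples:
  assumes "\<And>r. r \<in> Rs \<Longrightarrow> wf_rule \<sigma> ar far r" "derivable M Rs n L"
  shows "L \<in> tuples (far n) (universe M)"
  using assms(2)
proof cases
  case (derivableI \<alpha>s \<beta>s us V)
  with assms(1)[OF derivableI(2)] show ?thesis by (auto simp: tuples_def wf_rule_def)
qed

lemma derivableI':
  assumes "(\<alpha>s, \<beta>s, n, us) \<in> Rs" "wf_rule \<sigma> ar far (\<alpha>s, \<beta>s, n, us)" "range V \<subseteq> universe M"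
    and "\<And>m ys k cs. (m, ys, k) \<in> set \<alpha>s \<Longrightarrow> cs \<in> tuples k (universe M) \<Longrightarrow> derivable M Rs m (map V ys @ cs)"
    and "\<And>\<beta>. \<beta> \<in> set \<beta>s \<Longrightarrow> sat M I V \<beta>"
  shows "derivable M Rs n (map V us)"
proof (rule derivableI[OF assms(1,3)])
  show "\<forall>\<beta>\<in>set \<beta>s. sat M (\<lambda>_. {}) V \<beta>"
    using assms(2,5) sat_horn_beta[of _ V V M I "\<lambda>_. {}"] by (auto simp: wf_rule_def)
qed (use assms(4) in auto)

subsection \<open>From programs to Horn sentences\<close>

lemma sat_so_prefix_Exists:
  "sat M I v (so_prefix (map (Pair Exists) Rs) \<phi>) \<longleftrightarrow>
    (\<exists>J. (\<forall>R\<in>set Rs. J R \<subseteq> tuples (rv_arity R) (universe M)) \<and> (\<forall>R. R \<notin> set Rs \<longrightarrow> J R = I R) \<and> sat M J v \<phi>)"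
proof (induction Rs arbitrary: I)
  case Nil
  have "J = I" if "\<forall>R. J R = I R" for J using that by blast
  then show ?case by auto
next
  case (Cons R Rs)
  have "sat M I v (so_prefix (map (Pair Exists) (R # Rs)) \<phi>) \<longleftrightarrow>
    (\<exists>S\<subseteq>tuples (rv_arity R) (universe M). \<exists>J. (\<forall>R\<in>set Rs. J R \<subseteq> tuples (rv_arity R) (universe M)) \<and>
        (\<forall>R'. R' \<notin> set Rs \<longrightarrow> J R' = (I(R := S)) R') \<and> sat M J v \<phi>)" (is "_ \<longleftrightarrow> (\<exists>S\<subseteq>_. \<exists>J. ?P S J)")
    by (simp only: list.map so_prefix.simps sat.simps Cons.IH)
  also have "\<dots> \<longleftrightarrow> (\<exists>J. (\<forall>R\<in>set (R # Rs). J R \<subseteq> tuples (rv_arity R) (universe M)) \<and>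
      (\<forall>R'. R' \<notin> set (R # Rs) \<longrightarrow> J R' = I R') \<and> sat M J v \<phi>)" (is "?l \<longleftrightarrow> (\<exists>J. ?Q J)")
  proof
    assume ?l
    then obtain S J where SJ: "S\<subseteq>tuples (rv_arity R) (universe M)" "?P S J" by blast
    then have "J R \<subseteq> tuples (rv_arity R) (universe M)" by (cases "R \<in> set Rs") auto
    with SJ have "?Q J" by simp
    then show "\<exists>J. ?Q J" by blast
  next
    assume "\<exists>J. ?Q J"
    then obtain J where J: "?Q J" by blast
    then have "?P (J R) J" by auto
    moreover have "J R \<subseteq> tuples (rv_arity R) (universe M)" using J by simp
    ultimately show ?l by blast
  qed
  finally show ?case .
qed

text \<open>Relations that satisfy the clauses contain all derivable tuples, and the derivable
  relations themselves satisfy every clause that comes from a rule. Hence the one further clause,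
  which excludes the goal, is satisfiable together with them exactly when the goal is not
  derivable.\<close>

lemma program_to_horn:
  fixes Rs :: "('n, 'p) rule set"
  assumes fin: "finite Rs" and wf': "\<forall>r\<in>Rs. wf_rule \<sigma> ar far r" and g: "far g = 0"
  obtains \<phi> where "\<phi> \<in> so_horn_r \<sigma> ar"
    "\<forall>M :: ('p, 'a) struct. universe M \<noteq> {} \<longrightarrow> (models M \<phi> \<longleftrightarrow> \<not> derivable M Rs g [])"
proof -
  have wf: "wf_rule \<sigma> ar far r" if "r \<in> Rs" for r using wf' that by blast
  obtain K where K: "\<And>r. r \<in> Rs \<Longrightarrow> rule_vars r \<subseteq> {..<K}" using rules_bounded[OF fin] by blast
  define ns where "ns = insert g (\<Union>r\<in>Rs. rule_names r)"
  have "finite ns" using fin finite_rule_names by (auto simp: ns_def)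
  then obtain f :: "'n \<Rightarrow> nat" where f: "inj_on f ns" using finite_imp_inj_to_nat_seg by blast
  obtain nl where nl: "set nl = ns" "distinct nl" using \<open>finite ns\<close> finite_distinct_list by blast
  obtain rl where rl: "set rl = Rs" using fin finite_list by blast
  define rv where "rv n = RVar (f n) (far n)" for n
  have inj: "inj_on rv ns" using f by (auto simp: inj_on_def rv_def)
  define al :: "'n \<times> var list \<times> nat \<Rightarrow> 'p fm" where
    "al = (\<lambda>(m, ys, k). alls [K..<K+k] (Rel (rv m) (ys @ [K..<K+k])))"
  define cl :: "('n, 'p) rule \<Rightarrow> 'p fm" where
    "cl = (\<lambda>(\<alpha>s, \<beta>s, n, us). Imp (conjs (map al \<alpha>s @ \<beta>s)) (Rel (rv n) us))"
  define goal :: "'p fm" where "goal = Imp (conjs ([al (g, [], 0)] @ [])) Bot"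
  define body where "body = alls [0..<K] (conjs (goal # map cl rl))"
  define \<phi> where "\<phi> = so_prefix (map (Pair Exists) (map rv nl)) body"
  have al: "horn_alpha (al (m, ys, k))" "wf_fm \<sigma> ar (al (m, ys, k))" "free_vars (al (m, ys, k)) \<subseteq> {..<K}"
      "sat M I v (al (m, ys, k)) \<longleftrightarrow> (\<forall>cs\<in>tuples k (universe M). map v ys @ cs \<in> I (rv m))"
    if "set ys \<subseteq> {..<K}" "length ys + k = far m" for m ys k v I and M :: "('p, 'a) struct"
  proof -
    have d: "distinct [K..<K+k]" "set ys \<inter> set [K..<K+k] = {}" using that(1) by auto
    show "horn_alpha (al (m, ys, k))" unfolding horn_alpha_def al_def prod.case using d by blast
    show "wf_fm \<sigma> ar (al (m, ys, k))" using that by (simp add: al_def alls_simps rv_def)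
    show "free_vars (al (m, ys, k)) \<subseteq> {..<K}" using that by (auto simp: al_def alls_simps)
    show "sat M I v (al (m, ys, k)) \<longleftrightarrow> (\<forall>cs\<in>tuples k (universe M). map v ys @ cs \<in> I (rv m))"
      using sat_alls_Rel[OF d] by (simp add: al_def)
  qed
  have "rule_names r \<subseteq> ns" if "r \<in> Rs" for r using that by (auto simp: ns_def)
  note rule = wf_rule_bounded[OF wf K this]
  have cl: "horn_clause (cl r)" "wf_fm \<sigma> ar (cl r)" "free_vars (cl r) \<subseteq> {..<K}" "free_rvars (cl r) \<subseteq> rv ` ns"
    if "r \<in> Rs" for r
  proof -
    obtain \<alpha>s \<beta>s n us where r: "r = (\<alpha>s, \<beta>s, n, us)" by (cases r)
    note ru = rule[OF that[unfolded r] that[unfolded r] that[unfolded r]]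
    have "\<forall>\<alpha>\<in>set (map al \<alpha>s). horn_alpha \<alpha>" using ru(1) al(1) by auto
    then show "horn_clause (cl r)" using ru(2) unfolding horn_clause_def cl_def r horn_head_def by fast
    show "wf_fm \<sigma> ar (cl r)" using ru al(2) by (auto simp: cl_def r wf_conjs rv_def)
    have "free_vars (al \<alpha>) \<subseteq> {..<K}" if "\<alpha> \<in> set \<alpha>s" for \<alpha> using ru(1) al(3) that by (cases \<alpha>) fast
    then show "free_vars (cl r) \<subseteq> {..<K}" using ru(2,3) by (auto simp: cl_def r free_vars_conjs)
    show "free_rvars (cl r) \<subseteq> rv ` ns" using ru
      by (auto simp: cl_def r free_rvars_conjs al_def alls_simps horn_beta_simps)
  qed
  have gn: "g \<in> ns" by (simp add: ns_def)
  have "horn_clause goal"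
    unfolding horn_clause_def goal_def horn_head_def
    by (intro exI[of _ "[al (g, [], 0)]"] exI[of _ "[]"] exI[of _ Bot]) (use al(1)[of "[]" 0 g] g in simp)
  moreover have "wf_fm \<sigma> ar goal" "free_vars goal = {}" "free_rvars goal \<subseteq> rv ` ns"
    using g gn by (auto simp: goal_def al_def alls_def rv_def)
  ultimately have Cs: "\<forall>C\<in>set (goal # map cl rl). horn_clause C \<and> wf_fm \<sigma> ar C \<and>
      free_vars C \<subseteq> {..<K} \<and> free_rvars C \<subseteq> rv ` ns"
    using cl unfolding rl[symmetric] by simp
  then have "free_vars (conjs (goal # map cl rl)) \<subseteq> {..<K}" "free_rvars (conjs (goal # map cl rl)) \<subseteq> rv ` ns"
    "wf_fm \<sigma> ar (conjs (goal # map cl rl))"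
    unfolding free_vars_conjs free_rvars_conjs wf_conjs by blast+
  then have "sentence \<sigma> ar \<phi>"
    unfolding sentence_def \<phi>_def body_def so_prefix_simps alls_simps using nl(1) by (auto simp: image_image)
  moreover have "distinct (map snd (map (Pair Exists) (map rv nl)))"
    using nl inj by (simp add: distinct_map inj_on_def o_def)
  ultimately have "\<phi> \<in> so_horn_r \<sigma> ar"
    unfolding so_horn_r_def \<phi>_def body_def using Cs distinct_upt by blast
  moreover have "models M \<phi> \<longleftrightarrow> \<not> derivable M Rs g []" if ne: "universe M \<noteq> {}" for M :: "('p, 'a) struct"
  proof
    assume m: "models M \<phi>"
    obtain a where a: "a \<in> universe M" using ne by blast
    have "sat M (\<lambda>_. {}) (\<lambda>_. a) \<phi>" using m a by (auto simp: models_def)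
    then obtain J where J: "sat M J (\<lambda>_. a) body" unfolding \<phi>_def sat_so_prefix_Exists by blast
    have "L \<in> J (rv n)" if "derivable M Rs n L" for n L
      using that
    proof induction
      case (derivableI \<alpha>s \<beta>s n us V)
      \<comment> \<open>The block \<open>[0..<K]\<close> leaves the variables from \<open>K\<close>
        on at the start valuation, which is constantly \<open>a\<close>; \<open>V\<close> is adapted
        to this without changing the variables of a rule.\<close>
      define W where "W = (\<lambda>x. if x < K then V x else a)"
      have W: "map W ys = map V ys" if "set ys \<subseteq> {..<K}" for ys using that by (auto simp: W_def)
      note ru = rule[OF derivableI(1) derivableI(1) derivableI(1)]
      have "sat M J W (conjs (goal # map cl rl))"
        using J[unfolded body_def sat_alls, rule_format, of W] derivableI(2) by (auto simp: W_def)
      then have "sat M J W (cl (\<alpha>s, \<beta>s, n, us))" using derivableI(1) rl unfolding sat_conjs by auto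
      moreover have "sat M J W (al \<alpha>)" if "\<alpha> \<in> set \<alpha>s" for \<alpha>
      proof -
        obtain m ys k where \<alpha>: "\<alpha> = (m, ys, k)" by (cases \<alpha>)
        from that ru(1) have y: "set ys \<subseteq> {..<K}" "length ys + k = far m" by (auto simp: \<alpha>)
        show ?thesis unfolding \<alpha> al(4)[OF y] W[OF y(1)] using derivableI.IH that by (auto simp: \<alpha>)
      qed
      moreover have "sat M J W \<beta>" if "\<beta> \<in> set \<beta>s" for \<beta>
      proof -
        have "horn_beta \<beta>" "W x = V x" if "x \<in> free_vars \<beta>" for x
          using \<open>\<beta> \<in> set \<beta>s\<close> ru(2) that by (auto simp: W_def)
        then show ?thesis using sat_horn_beta[of \<beta> W V M J "\<lambda>_. {}"] that ru(2) derivableI.hyps by blast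
      qed
      ultimately have "map W us \<in> J (rv n)" by (auto simp: cl_def sat_conjs)
      then show ?case using W ru(3) by simp
    qed
    moreover have "sat M J (\<lambda>x. a) goal"
      using J a unfolding body_def sat_alls by (auto simp: sat_conjs)
    then have "[] \<notin> J (rv g)" by (simp add: goal_def al_def alls_def)
    ultimately show "\<not> derivable M Rs g []" by blast
  next
    assume nd: "\<not> derivable M Rs g []"
    show "models M \<phi>" unfolding models_def
    proof (intro allI impI)
      fix I and v :: "var \<Rightarrow> 'a" assume v: "range v \<subseteq> universe M"
      \<comment> \<open>The witnesses are the derivable relations; on all other relation variables
        \<open>J\<close> has to agree with \<open>I\<close>.\<close>
      define J where "J = (\<lambda>R. if R \<in> rv ` ns then {L. derivable M Rs (inv_into ns rv R) L} else I R)"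
      have J: "J (rv n) = {L. derivable M Rs n L}" if "n \<in> ns" for n
        using that inj by (simp add: J_def)
      have "sat M J v body" unfolding body_def sat_alls sat_conjs
      proof (intro allI impI ballI)
        fix w \<psi> assume w: "(\<forall>x. x \<notin> set [0..<K] \<longrightarrow> w x = v x) \<and> (\<forall>x\<in>set [0..<K]. w x \<in> universe M)"
          and \<psi>: "\<psi> \<in> set (goal # map cl rl)"
        have rw: "range w \<subseteq> universe M"
        proof clarify
          fix x show "w x \<in> universe M" using w v by (cases "x < K") auto
        qed
        from \<psi> consider "\<psi> = goal" | \<alpha>s \<beta>s n us where "(\<alpha>s, \<beta>s, n, us) \<in> Rs" "\<psi> = cl (\<alpha>s, \<beta>s, n, us)"
          using rl by auto
        then show "sat M J w \<psi>"
        proof cases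
          case 1
          then show ?thesis using nd J[OF gn] by (simp add: goal_def al_def alls_def)
        next
          case 2
          note ru = rule[OF 2(1) 2(1) 2(1)]
          show ?thesis unfolding 2(2) cl_def prod.case sat.simps sat_conjs J[OF ru(5)]
          proof (intro impI CollectI)
            assume b: "\<forall>\<phi>\<in>set (map al \<alpha>s @ \<beta>s). sat M J w \<phi>"
            show "derivable M Rs n (map w us)"
            proof (rule derivableI'[OF 2(1) wf[OF 2(1)] rw])
              fix m ys k cs assume m: "(m, ys, k) \<in> set \<alpha>s" "cs \<in> tuples k (universe M)"
              with ru(1) have y: "set ys \<subseteq> {..<K}" "length ys + k = far m" "m \<in> ns" by auto
              from b m(1) have "sat M J w (al (m, ys, k))" by auto
              then show "derivable M Rs m (map w ys @ cs)" unfolding al(4)[OF y(1,2)] using J[OF y(3)] m(2) by auto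
            qed (use b in auto)
          qed
        qed
      qed
      moreover have "J R \<subseteq> tuples (rv_arity R) (universe M)" if "R \<in> rv ` ns" for R
        using that J derivable_tuples[OF wf, of Rs M] by (auto simp: rv_def)
      moreover have "J R = I R" if "R \<notin> rv ` ns" for R using that by (simp add: J_def)
      ultimately show "sat M I v \<phi>"
        unfolding \<phi>_def sat_so_prefix_Exists using nl(1) by (intro exI[of _ J]) auto
    qed
  qed
  ultimately show thesis by (intro that[of \<phi>]) simp_all
qed

section \<open>Stages of a fixed point\<close>

text \<open>The step at which \<open>w\<close> enters the iteration from the empty set. It is
  unspecified if \<open>w\<close> never enters and positive if it does, which is why preceding
  iterates have index \<open>i\<close> for a level \<open>Suc i\<close>.\<close>

definition level :: "('x set \<Rightarrow> 'x set) \<Rightarrow> 'x \<Rightarrow> nat" where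
  "level F w = (LEAST i. w \<in> (F ^^ i) {})"

definition stage :: "('x set \<Rightarrow> 'x set) \<Rightarrow> 'x \<Rightarrow> 'x set" where
  "stage F w = (F ^^ level F w) {}"

lemma iter_mono: fixes F :: "'x set \<Rightarrow> 'x set" shows "mono F \<Longrightarrow> i \<le> j \<Longrightarrow> (F ^^ i) {} \<subseteq> (F ^^ j) {}"
  using funpow_decreasing[of i j F] by simp

lemma iter_lfp: "mono F \<Longrightarrow> (F ^^ i) {} \<subseteq> lfp (F :: 'x set \<Rightarrow> 'x set)"
  using Kleene_iter_lpfp[of F "lfp F" i] lfp_unfold[of F] by auto

text \<open>Iterates increase, so an element absent from iterate \<open>i\<close> is absent from all
  earlier ones. The two conditions on \<open>w\<close> are what a program checks in order to know
  that \<open>w\<close> names the stage after iterate \<open>i\<close>.\<close>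

lemma level_new:
  assumes "mono F" "w \<notin> (F ^^ i) {}" "w \<in> F ((F ^^ i) {})"
  shows "level F w = Suc i" "stage F w = F ((F ^^ i) {})" "w \<in> lfp F"
proof -
  have "w \<notin> (F ^^ j) {}" if "j < Suc i" for j using that iter_mono[OF assms(1), of j i] assms(2) by auto
  then show "level F w = Suc i" unfolding level_def using assms(3)
    by (intro Least_equality) (auto simp: not_less[symmetric])
  then show "stage F w = F ((F ^^ i) {})" by (simp add: stage_def)
  show "w \<in> lfp F" using iter_lfp[OF assms(1), of "Suc i"] assms(3) by auto
qed

text \<open>By finiteness of \<open>U\<close> two iterates coincide; since iterates increase, the
  earlier of the two equals its successor.\<close>

lemma lfp_iter:
  assumes "mono F" "finite U" "\<And>S. F S \<subseteq> U"
  shows "\<exists>k. lfp F = (F ^^ k) {}"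
proof -
  have U: "(F ^^ i) {} \<subseteq> U" for i using assms(3) by (cases i) auto
  then have "finite (range (\<lambda>i. (F ^^ i) {}))" using assms(2) by (auto intro: finite_subset[of _ "Pow U"])
  then have "\<not> inj (\<lambda>i. (F ^^ i) {})" using finite_imageD[of "\<lambda>i. (F ^^ i) {}" UNIV] by auto
  then obtain i j where "i \<noteq> j" "(F ^^ i) {} = (F ^^ j) {}" by (auto simp: inj_def)
  then obtain i j where "i < j" "(F ^^ i) {} = (F ^^ j) {}" by (cases i j rule: linorder_cases) auto
  with iter_mono[OF assms(1), of i "Suc i"] iter_mono[OF assms(1), of "Suc i" j]
  have "(F ^^ Suc i) bot = (F ^^ i) bot" by auto
  from lfp_Kleene_iter[OF assms(1) this] show ?thesis by auto
qed

lemma closed_iter: "mono F \<Longrightarrow> F ((F ^^ i) {}) \<subseteq> (F ^^ i) {} \<Longrightarrow> (F ^^ i) {} = lfp F"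
  using iter_lfp[of F i] lfp_lowerbound[of F "(F ^^ i) {}"] by auto

lemma level_step:
  assumes "mono F" "\<not> F ((F ^^ j) {}) \<subseteq> (F ^^ j) {}"
  shows "\<exists>s\<in>lfp F. level F s = Suc j"
  using assms level_new[OF assms(1)] by blast

text \<open>The basis of inductions on levels: the iterate just before \<open>w\<close> enters is
  either empty or again named by an element of the fixed point.\<close>

lemma lfp_new:
  assumes "mono F" "finite U" "\<And>S. F S \<subseteq> U" "w \<in> lfp F"
  obtains i where "level F w = Suc i" "w \<notin> (F ^^ i) {}" "w \<in> F ((F ^^ i) {})"
    "i = 0 \<or> (\<exists>s\<in>lfp F. level F s = i)"
proof -
  obtain k where "w \<in> (F ^^ k) {}" using lfp_iter[OF assms(1-3)] assms(4) by auto
  then have l: "w \<in> (F ^^ level F w) {}" unfolding level_def by (rule LeastI)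
  then obtain i where i: "level F w = Suc i" by (cases "level F w") auto
  then have n: "w \<notin> (F ^^ i) {}" unfolding level_def by (metis lessI not_less_Least)
  have "\<exists>s\<in>lfp F. level F s = i" if j: "i = Suc j" for j
  proof -
    \<comment> \<open>If iterate \<open>j\<close> were closed, it would be the fixed point and
      contain \<open>w\<close>, which is still missing from the larger iterate
      \<open>i\<close>.\<close>
    have "\<not> F ((F ^^ j) {}) \<subseteq> (F ^^ j) {}"
    proof
      assume "F ((F ^^ j) {}) \<subseteq> (F ^^ j) {}"
      then have "(F ^^ j) {} = lfp F" using closed_iter[OF assms(1)] by blast
      with iter_mono[OF assms(1), of j i] j n assms(4) show False by auto
    qed
    then show ?thesis using level_step[OF assms(1)] j by blast
  qed
  then have "i = 0 \<or> (\<exists>s\<in>lfp F. level F s = i)" by (cases i) auto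
  with that i l n show ?thesis by simp
qed

text \<open>The least index of a closed iterate is taken. Unless it is 0, the iterate before it is
  not closed, so some element enters at this index and names it.\<close>

lemma lfp_closed_stage:
  assumes "mono F" "finite U" "\<And>S. F S \<subseteq> U"
  obtains i where "F ((F ^^ i) {}) \<subseteq> (F ^^ i) {}" "i = 0 \<or> (\<exists>s\<in>lfp F. level F s = i)"
proof -
  let ?P = "\<lambda>i. F ((F ^^ i) {}) \<subseteq> (F ^^ i) {}"
  obtain k where "lfp F = (F ^^ k) {}" using lfp_iter[OF assms] by blast
  then have "?P k" using lfp_unfold[OF assms(1)] by auto
  then have P: "?P (LEAST i. ?P i)" by (rule LeastI)
  have "\<exists>s\<in>lfp F. level F s = (LEAST i. ?P i)" if "(LEAST i. ?P i) = Suc j" for j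
    using level_step[OF assms(1), of j] not_less_Least[of j ?P] that by auto
  then have "(LEAST i. ?P i) = 0 \<or> (\<exists>s\<in>lfp F. level F s = (LEAST i. ?P i))"
    by (cases "LEAST i. ?P i") auto
  with that P show ?thesis by blast
qed

section \<open>Monotonicity of the operator of a fixed point formula\<close>

definition lfp_op :: "('p, 'a) struct \<Rightarrow> (rvar \<Rightarrow> 'a list set) \<Rightarrow> (var \<Rightarrow> 'a) \<Rightarrow> rvar \<Rightarrow> var list \<Rightarrow> 'p fm \<Rightarrow>
    'a list set \<Rightarrow> 'a list set" where
  "lfp_op M I v X xs \<phi> S = {as \<in> tuples (length xs) (universe M). sat M (I(X := S)) (assign v xs as) \<phi>}"

lemma sat_Lfp: "sat M I v (Lfp X xs \<phi> us) \<longleftrightarrow> map v us \<in> lfp (lfp_op M I v X xs \<phi>)"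
  by (simp add: lfp_op_def[abs_def])

text \<open>The case of binders in the monotonicity proof: either the inner binder overwrites the
  value of \<open>X\<close>, or the two updates commute.\<close>

lemma sat_upd_mono:
  assumes "Y = X \<or> polarity b X \<phi>"
    and "\<And>I v. polarity b X \<phi> \<Longrightarrow> sat M (I(X := S)) v \<phi> \<Longrightarrow> sat M (I(X := T)) v \<phi>"
    and "sat M (I(X := S, Y := Z)) v \<phi>"
  shows "sat M (I(X := T, Y := Z)) v \<phi>"
proof (cases "Y = X")
  case True
  then show ?thesis using assms(3) by simp
next
  case False
  then have "I(X := P, Y := Z) = I(Y := Z, X := P)" for P by (rule fun_upd_twist[symmetric])
  then show ?thesis using assms False by metis
qed

text \<open>Negation and implication exchange the polarities, so both are treated in one induction;
  the conditional swaps \<open>S\<close> and \<open>T\<close> for negative occurrences.\<close>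

lemma polarity_sat:
  "polarity b X \<phi> \<Longrightarrow> S \<subseteq> T \<Longrightarrow>
    sat M (I(X := if b then S else T)) v \<phi> \<Longrightarrow> sat M (I(X := if b then T else S)) v \<phi>"
proof (induction \<phi> arbitrary: b I v)
  case (Rel R ys)
  then show ?case by (cases b) (auto split: if_splits)
next
  case (Neg \<phi>)
  then show ?case using Neg.IH[of "\<not> b" I v] by (cases b) auto
next
  case (Imp \<phi>1 \<phi>2)
  then show ?case using Imp.IH(1)[of "\<not> b" I v] Imp.IH(2)[of b I v] by (cases b) auto
next
  case (And \<phi>1 \<phi>2)
  then show ?case using And.IH(1)[of b I v] And.IH(2)[of b I v] by simp
next
  case (Or \<phi>1 \<phi>2)
  then show ?case using Or.IH(1)[of b I v] Or.IH(2)[of b I v] unfolding sat.simps polarity.simps by blast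
next
  case (Ex x \<phi>)
  then show ?case using Ex.IH[of b I] unfolding sat.simps polarity.simps by blast
next
  case (All x \<phi>)
  then show ?case using All.IH[of b I] by simp
next
  case (SOEx R \<phi>)
  have "R = X \<or> polarity b X \<phi>" using SOEx.prems(1) by simp
  from sat_upd_mono[OF this SOEx.IH[OF _ SOEx.prems(2)]] SOEx.prems(3) show ?case
    unfolding sat.simps by blast
next
  case (SOAll R \<phi>)
  have "R = X \<or> polarity b X \<phi>" using SOAll.prems(1) by simp
  from sat_upd_mono[OF this SOAll.IH[OF _ SOAll.prems(2)]] SOAll.prems(3) show ?case
    unfolding sat.simps by blast
next
  case (Lfp Y xs \<phi> us)
  let ?I = "I(X := if b then S else T)" and ?I' = "I(X := if b then T else S)"
  have "Y = X \<or> polarity b X \<phi>" using Lfp.prems(1) by simp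
  from sat_upd_mono[OF this Lfp.IH[OF _ Lfp.prems(2)]]
  have "lfp_op M ?I v Y xs \<phi> W \<subseteq> lfp_op M ?I' v Y xs \<phi> W" for W
    unfolding lfp_op_def by blast
  then have "lfp (lfp_op M ?I v Y xs \<phi>) \<subseteq> lfp (lfp_op M ?I' v Y xs \<phi>)" by (rule lfp_mono)
  then show ?case using Lfp.prems(3) unfolding sat_Lfp by blast
qed auto

lemma mono_lfp_op: "polarity True X \<phi> \<Longrightarrow> mono (lfp_op M I v X xs \<phi>)"
  using polarity_sat[of True X \<phi> _ _ M I] by (auto intro!: monoI simp: lfp_op_def)

lemma finite_tuples: "finite A \<Longrightarrow> finite (tuples n A)"
  unfolding tuples_def using finite_lists_length_eq[of A n] by (simp add: conj_commute)

lemma assign_assign: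
  assumes "length as = length xs" "length bs = length xs"
  shows "assign (assign v xs as) xs bs = assign v xs bs"
proof
  fix x
  have "map_of (zip xs bs) x = None \<Longrightarrow> map_of (zip xs as) x = None"
    using assms by (simp add: map_of_zip_is_None)
  then show "assign (assign v xs as) xs bs x = assign v xs bs x"
    by (auto simp: assign_def split: option.split)
qed

text \<open>The operator overwrites \<open>xs\<close>, so it sees an assignment only through its
  parameters. One assignment can therefore carry the parameters together with the tuple that names a
  stage.\<close>

lemma lfp_op_assign:
  "length as = length xs \<Longrightarrow> lfp_op M I (assign v xs as) X xs \<phi> = lfp_op M I v X xs \<phi>"
  by (rule ext) (auto simp: lfp_op_def tuples_def assign_assign)

lemma assign_self: "distinct xs \<Longrightarrow> assign v xs (map v xs) = v"
proof
  fix x assume "distinct xs"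
  then show "assign v xs (map v xs) x = v x"
    by (cases "x \<in> set xs") (auto simp: assign_notin in_set_conv_nth assign_nth)
qed

section \<open>From least fixed points to programs\<close>

text \<open>Bound variables are included, since a subformula is evaluated under assignments that
  also give values to the variables bound around it.\<close>

primrec all_vars :: "'p fm \<Rightarrow> var set" where
  "all_vars Bot = {}"
| "all_vars (Pred P ys) = set ys"
| "all_vars (Eq x y) = {x, y}"
| "all_vars (Rel R ys) = set ys"
| "all_vars (Neg \<phi>) = all_vars \<phi>"
| "all_vars (And \<phi> \<psi>) = all_vars \<phi> \<union> all_vars \<psi>"
| "all_vars (Or \<phi> \<psi>) = all_vars \<phi> \<union> all_vars \<psi>"
| "all_vars (Imp \<phi> \<psi>) = all_vars \<phi> \<union> all_vars \<psi>"
| "all_vars (Ex x \<phi>) = insert x (all_vars \<phi>)"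
| "all_vars (All x \<phi>) = insert x (all_vars \<phi>)"
| "all_vars (SOEx R \<phi>) = all_vars \<phi>"
| "all_vars (SOAll R \<phi>) = all_vars \<phi>"
| "all_vars (Lfp X xs \<phi> us) = all_vars \<phi> \<union> set xs \<union> set us"

lemma finite_all_vars: "finite (all_vars \<phi>)"
  by (induction \<phi>) auto

text \<open>
  A context lists the fixed point operators around a subformula, innermost first. The value of the
  fixed point variable of \<open>(X, xs, \<phi>, fl)\<close> is the empty relation if \<open>fl\<close> is false, and otherwise
  the stage at which some tuple enters the fixed point. This tuple and the parameters of the
  operator are together given by one assignment \<open>e\<close>: the tuple is \<open>map e xs\<close>.

  All variables of the sentence are below \<open>N\<close>, so that an assignment is a tuple of length \<open>N\<close>. The
  relation \<open>Truth b \<phi> c\<close> consists of the assignments under which \<open>\<phi>\<close> has truth value \<open>b\<close>;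
  \<open>Stage b c\<close> says whether a tuple belongs to the stage given by the innermost entry of \<open>c\<close>, and
  moreover that this entry does describe a stage. \<open>Closed c\<close> consists of the tuples, with \<open>e\<close>, which
  belong to this stage or do not enter at the next one. \<open>Truth_Upd\<close> moves the variable \<open>x\<close> behind
  the other arguments, where it can be quantified universally.
\<close>

type_synonym 'p ctx = "(rvar \<times> var list \<times> 'p fm \<times> bool) list"

datatype 'p name =
    Goal
  | Truth bool "'p fm" "'p ctx"
  | Truth_Upd bool "'p fm" "'p ctx" var
  | Stage bool "'p ctx"
  | Closed "'p ctx"

text \<open>One block of \<open>N\<close> arguments for the current assignment, followed by one for
  each entry of the context.\<close>

abbreviation width :: "nat \<Rightarrow> 'c list \<Rightarrow> nat" where
  "width N c \<equiv> N * Suc (length c)"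

text \<open>The updated assignment as a list of arguments: position \<open>x\<close> holds the
  variable \<open>f x\<close>, or the member of \<open>us\<close> that corresponds to
  \<open>x\<close> if \<open>x\<close> is in \<open>xs\<close>.\<close>

definition subst :: "nat \<Rightarrow> (var \<Rightarrow> var) \<Rightarrow> var list \<Rightarrow> var list \<Rightarrow> var list" where
  "subst N f xs us = map (assign f xs us) [0..<N]"

text \<open>The assignment of entry \<open>i\<close> with \<open>xs\<close> set to the values of
  \<open>ys\<close>, followed by the blocks of entry \<open>i\<close> and of the entries outside it.
  Block 0 is the current assignment, so that entry \<open>i\<close> starts at
  \<open>N * Suc i\<close>.\<close>

abbreviation stage_args :: "nat \<Rightarrow> nat \<Rightarrow> var list \<Rightarrow> var list \<Rightarrow> 'p ctx \<Rightarrow> var list" where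
  "stage_args N i xs ys c \<equiv> subst N ((+) (N * Suc i)) xs ys @ [N * Suc i..<width N c]"

text \<open>The least index \<open>i\<close> is the innermost binding of \<open>R\<close>. If its
  stage is empty, falsity needs no premise; otherwise the matter is passed on to
  \<open>Stage\<close> for that entry.\<close>

definition rel_rules :: "nat \<Rightarrow> rvar \<Rightarrow> var list \<Rightarrow> 'p ctx \<Rightarrow> ('p name, 'p) rule set" where
  "rel_rules N R ys c =
    (let n = width N c in
     \<Union>i\<in>{i. i < length c \<and> fst (c ! i) = R \<and> (\<forall>j<i. fst (c ! j) \<noteq> R)}.
       case c ! i of (X, xs, \<phi>, fl) \<Rightarrow>
         if fl then
           (\<lambda>b. ([(Stage b (drop i c), subst N ((+) (N * Suc i)) xs ys @ [N * Suc i..<n], 0)], [],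
             Truth b (Rel R ys) c, [0..<n])) ` UNIV
         else {([], [], Truth False (Rel R ys) c, [0..<n])})"

text \<open>\<open>U\<close>, \<open>Z\<close> and \<open>S\<close> are the assignment
  \<open>[0..<N]\<close> with \<open>xs\<close> set to the values of \<open>us\<close> and to two
  fresh tuples \<open>z\<close> and \<open>s\<close>; \<open>E\<close> consists of the blocks of the
  context. The groups of rules say: \<open>us\<close> belongs to the stage that it names itself;
  \<open>us\<close> is outside a closed stage, which is named by \<open>z\<close> or empty; a tuple
  respects closure because it fails the body, or because it is in the stage already. In the last
  group the tuple that \<open>[0..<N]\<close> gives to \<open>xs\<close> is not in the stage of
  \<open>s\<close>, or that stage is replaced by the empty one, but it satisfies the body over it.
  So it names the next stage, and the value of the body at \<open>z\<close> tells whether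
  \<open>z\<close> belongs to that stage.\<close>

definition lfp_rules :: "nat \<Rightarrow> rvar \<Rightarrow> var list \<Rightarrow> 'p fm \<Rightarrow> var list \<Rightarrow> 'p ctx \<Rightarrow> ('p name, 'p) rule set" where
  "lfp_rules N X xs \<phi> us c =
    (let n = width N c; k = length xs; cf = (\<lambda>fl. (X, xs, \<phi>, fl) # c);
         U = subst N id xs us; Z = subst N id xs [n..<n+k]; S = subst N id xs [n+k..<n+k+k];
         E = [N..<n] in
     {([(Stage True (cf True), U @ U @ E, 0)], [], Truth True (Lfp X xs \<phi> us) c, [0..<n])} \<union>
     (\<lambda>fl. ((if fl then [(Stage False (cf True), U @ Z @ E, 0)] else []) @ [(Closed (cf fl), Z @ E, k)], [],
        Truth False (Lfp X xs \<phi> us) c, [0..<n])) ` UNIV \<union>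
     (\<lambda>fl. ([(Truth False \<phi> (cf fl), Z @ [0..<n], 0)], [], Closed (cf fl), [0..<n+k])) ` UNIV \<union>
     {([(Stage True (cf True), Z @ [0..<n], 0)], [], Closed (cf True), [0..<n+k])} \<union>
     (\<lambda>(fl, b). ((if fl then [(Stage False (cf True), [0..<N] @ S @ E, 0)] else []) @
          [(Truth True \<phi> (cf fl), [0..<N] @ S @ E, 0), (Truth b \<phi> (cf fl), Z @ S @ E, 0)], [],
        Stage b (cf True), Z @ [0..<n])) ` UNIV)"

text \<open>A single element can establish the value \<open>b\<close>, whereas
  \<open>\<not> b\<close> needs all elements; so \<open>b = True\<close> serves \<open>Ex\<close>
  and \<open>b = False\<close> serves \<open>All\<close>. The fresh variable \<open>n\<close> holds
  the value of \<open>x\<close>.\<close>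

definition quant_rules :: "nat \<Rightarrow> bool \<Rightarrow> 'p fm \<Rightarrow> var \<Rightarrow> 'p fm \<Rightarrow> 'p ctx \<Rightarrow> ('p name, 'p) rule set" where
  "quant_rules N b \<psi> x \<phi> c =
    (let n = width N c in
     {([(Truth b \<phi> c, subst N id [x] [n] @ [N..<n], 0)], [], Truth b \<psi> c, [0..<n]),
      ([(Truth_Upd (\<not> b) \<phi> c x, [0..<n], 1)], [], Truth (\<not> b) \<psi> c, [0..<n]),
      ([(Truth (\<not> b) \<phi> c, subst N id [x] [n] @ [N..<n], 0)], [], Truth_Upd (\<not> b) \<phi> c x, [0..<Suc n])})"

text \<open>Each list in \<open>bss\<close> is one sufficient condition for the value
  \<open>b\<close>; together they form a disjunctive normal form.\<close>

definition prop_rules :: "nat \<Rightarrow> (bool \<times> 'p fm) list list \<Rightarrow> bool \<Rightarrow> 'p fm \<Rightarrow> 'p ctx \<Rightarrow> ('p name, 'p) rule set" where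
  "prop_rules N bss b \<psi> c = (let n = width N c in
    (\<lambda>bs. (map (\<lambda>(b, \<phi>). (Truth b \<phi> c, [0..<n], 0)) bs, [], Truth b \<psi> c, [0..<n])) ` set bss)"

primrec prog :: "nat \<Rightarrow> 'p fm \<Rightarrow> 'p ctx \<Rightarrow> ('p name, 'p) rule set" where
  "prog N Bot c = {([], [], Truth False Bot c, [0..<width N c])}"
| "prog N (Pred P ys) c =
    {([], [Pred P ys], Truth True (Pred P ys) c, [0..<width N c]),
     ([], [Neg (Pred P ys)], Truth False (Pred P ys) c, [0..<width N c])}"
| "prog N (Eq x y) c =
    {([], [Eq x y], Truth True (Eq x y) c, [0..<width N c]),
     ([], [Neg (Eq x y)], Truth False (Eq x y) c, [0..<width N c])}"
| "prog N (Rel R ys) c = rel_rules N R ys c"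
| "prog N (Neg \<phi>) c =
    prop_rules N [[(False, \<phi>)]] True (Neg \<phi>) c \<union> prop_rules N [[(True, \<phi>)]] False (Neg \<phi>) c \<union> prog N \<phi> c"
| "prog N (And \<phi> \<psi>) c =
    prop_rules N [[(True, \<phi>), (True, \<psi>)]] True (And \<phi> \<psi>) c \<union>
    prop_rules N [[(False, \<phi>)], [(False, \<psi>)]] False (And \<phi> \<psi>) c \<union> prog N \<phi> c \<union> prog N \<psi> c"
| "prog N (Or \<phi> \<psi>) c =
    prop_rules N [[(True, \<phi>)], [(True, \<psi>)]] True (Or \<phi> \<psi>) c \<union>
    prop_rules N [[(False, \<phi>), (False, \<psi>)]] False (Or \<phi> \<psi>) c \<union> prog N \<phi> c \<union> prog N \<psi> c"
| "prog N (Imp \<phi> \<psi>) c =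
    prop_rules N [[(False, \<phi>)], [(True, \<psi>)]] True (Imp \<phi> \<psi>) c \<union>
    prop_rules N [[(True, \<phi>), (False, \<psi>)]] False (Imp \<phi> \<psi>) c \<union> prog N \<phi> c \<union> prog N \<psi> c"
| "prog N (Ex x \<phi>) c = quant_rules N True (Ex x \<phi>) x \<phi> c \<union> prog N \<phi> c"
| "prog N (All x \<phi>) c = quant_rules N False (All x \<phi>) x \<phi> c \<union> prog N \<phi> c"
| "prog N (SOEx R \<phi>) c = {}"
| "prog N (SOAll R \<phi>) c = {}"
| "prog N (Lfp X xs \<phi> us) c = lfp_rules N X xs \<phi> us c \<union>
    prog N \<phi> ((X, xs, \<phi>, False) # c) \<union> prog N \<phi> ((X, xs, \<phi>, True) # c)"

text \<open>The arguments of \<open>Closed\<close> start with the block of the innermost entry, with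
  no current assignment before it, and end with the tuple under test.\<close>

primrec name_arity :: "nat \<Rightarrow> 'p name \<Rightarrow> nat" where
  "name_arity N Goal = 0"
| "name_arity N (Truth b \<phi> c) = width N c"
| "name_arity N (Truth_Upd b \<phi> c x) = Suc (width N c)"
| "name_arity N (Stage b c) = width N c"
| "name_arity N (Closed c) = N * length c + (case c of [] \<Rightarrow> 0 | (X, xs, _) # _ \<Rightarrow> length xs)"

section \<open>Finiteness and well-formedness of the program\<close>

lemma finite_prog: "finite (prog N \<phi> c)"
  by (induction \<phi> arbitrary: c)
    (auto simp: rel_rules_def lfp_rules_def quant_rules_def prop_rules_def Let_def split: prod.splits)

lemma length_subst [simp]: "length (subst N f xs us) = N"
  by (simp add: subst_def)

lemma rel_rulesE:
  assumes "r \<in> rel_rules N R ys c"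
  obtains i X xs \<phi> fl b where "i < length c" "c ! i = (R, xs, \<phi>, fl)" "\<forall>j<i. fst (c ! j) \<noteq> R" "\<not> fl \<Longrightarrow> \<not> b"
    "r = (if fl then [(Stage b (drop i c), stage_args N i xs ys c, 0)] else [],
        [], Truth b (Rel R ys) c, [0..<width N c])"
proof -
  obtain i where i: "i < length c" "fst (c ! i) = R" "\<forall>j<i. fst (c ! j) \<noteq> R"
    "r \<in> (case c ! i of (X, xs, \<phi>, fl) \<Rightarrow>
         if fl then
           (\<lambda>b. ([(Stage b (drop i c), stage_args N i xs ys c, 0)], [],
             Truth b (Rel R ys) c, [0..<width N c])) ` UNIV
         else {([], [], Truth False (Rel R ys) c, [0..<width N c])})"
    using assms unfolding rel_rules_def Let_def by (elim UN_E CollectE conjE)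
  obtain Y xs \<phi> fl where "c ! i = (Y, xs, \<phi>, fl)" by (rule prod_cases4)
  with i(2) have e: "c ! i = (R, xs, \<phi>, fl)" by simp
  show ?thesis
  proof (cases fl)
    case True
    with i(4) e obtain b where "r = ([(Stage b (drop i c), stage_args N i xs ys c, 0)],
        [], Truth b (Rel R ys) c, [0..<width N c])" by auto
    then show ?thesis using that[OF i(1) e i(3), of b] True by simp
  next
    case False
    then show ?thesis using that[OF i(1) e i(3), of False] i(4) e by simp
  qed
qed

lemma rel_rulesI:
  assumes "i < length c" "c ! i = (R, xs, \<phi>, fl)" "\<forall>j<i. fst (c ! j) \<noteq> R" "\<not> fl \<Longrightarrow> \<not> b"
  shows "(if fl then [(Stage b (drop i c), stage_args N i xs ys c, 0)] else [],
        [], Truth b (Rel R ys) c, [0..<width N c]) \<in> rel_rules N R ys c"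
proof -
  have "i \<in> {i. i < length c \<and> fst (c ! i) = R \<and> (\<forall>j<i. fst (c ! j) \<noteq> R)}" using assms(1-3) by simp
  then show ?thesis unfolding rel_rules_def Let_def
    by (rule UN_I) (cases fl; use assms(2,4) in simp)
qed

lemma wf_rel_rules:
  assumes "r \<in> rel_rules N R ys c"
  shows "wf_rule \<sigma> ar (name_arity N) r"
  using assms
proof (rule rel_rulesE)
  fix i xs \<phi> fl b assume "i < length c"
  then have "N + (width N c - N * Suc i) = N * Suc (length c - i)"
    by (simp flip: diff_mult_distrib2)
  moreover assume "r = (if fl then [(Stage b (drop i c), stage_args N i xs ys c, 0)] else [],
        [], Truth b (Rel R ys) c, [0..<width N c])"
  ultimately show ?thesis by (auto simp: wf_rule_def simp del: mult_Suc_right)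
qed

lemma wf_lfp_rules:
  assumes "r \<in> lfp_rules N X xs \<phi> us c"
  shows "wf_rule \<sigma> ar (name_arity N) r"
  using assms unfolding lfp_rules_def Let_def
  by (elim UnE imageE; (clarsimp split: prod.splits)?) (auto simp: wf_rule_def)

lemma wf_quant_rules: "r \<in> quant_rules N b \<psi> x \<phi> c \<Longrightarrow> wf_rule \<sigma> ar (name_arity N) r"
  by (auto simp: quant_rules_def wf_rule_def Let_def)

lemma wf_prop_rules: "r \<in> prop_rules N bss b \<psi> c \<Longrightarrow> wf_rule \<sigma> ar (name_arity N) r"
  by (auto simp: prop_rules_def wf_rule_def Let_def)

lemma wf_prog: "wf_fm \<sigma> ar \<phi> \<Longrightarrow> r \<in> prog N \<phi> c \<Longrightarrow> wf_rule \<sigma> ar (name_arity N) r"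
proof (induction \<phi> arbitrary: c)
  case (Pred P ys)
  then show ?case by (auto simp: wf_rule_def horn_beta_def)
next
  case (Eq x y)
  then show ?case by (auto simp: wf_rule_def horn_beta_def)
qed (unfold prog.simps wf_fm.simps; (elim UnE conjE)?;
    (simp add: wf_rule_def; fail | blast intro: wf_rel_rules wf_lfp_rules wf_quant_rules wf_prop_rules))+

lemma tuples_0 [simp]: "tuples 0 A = {[]}"
  by (auto simp: tuples_def)

lemma assign_single: "assign v [x] [a] = v(x := a)"
  by (auto simp: assign_def)

text \<open>A program sees only the values of variables below \<open>N\<close>. \<open>v0\<close>
  supplies the others, so that a \<open>normal\<close> assignment is determined by its vector.
  \<open>I0\<close> interprets the relation variables that the context does not bind.\<close>

locale lfp_evaluation =
  fixes M :: "('p, 'a) struct" and I0 :: "rvar \<Rightarrow> 'a list set" and v0 :: "var \<Rightarrow> 'a" and N :: nat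
  assumes fin: "finite (universe M)" and v0: "range v0 \<subseteq> universe M"
begin

definition normal :: "(var \<Rightarrow> 'a) \<Rightarrow> bool" where
  "normal v \<longleftrightarrow> range v \<subseteq> universe M \<and> (\<forall>i\<ge>N. v i = v0 i)"

definition vec :: "(var \<Rightarrow> 'a) \<Rightarrow> 'a list" where
  "vec v = map v [0..<N]"

definition flat :: "(var \<Rightarrow> 'a) list \<Rightarrow> 'a list" where
  "flat es = concat (map vec es)"

abbreviation opr :: "(rvar \<Rightarrow> 'a list set) \<Rightarrow> (var \<Rightarrow> 'a) \<Rightarrow> rvar \<Rightarrow> var list \<Rightarrow> 'p fm \<Rightarrow> 'a list set \<Rightarrow> 'a list set" where
  "opr \<equiv> lfp_op M"

primrec J :: "'p ctx \<Rightarrow> (var \<Rightarrow> 'a) list \<Rightarrow> rvar \<Rightarrow> 'a list set" where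
  "J [] es = I0"
| "J (d # c) es = (case d of (X, xs, \<phi>, fl) \<Rightarrow>
     (J c (tl es))(X := if fl then stage (opr (J c (tl es)) (hd es) X xs \<phi>) (map (hd es) xs) else {}))"

text \<open>A flagged entry has to name an actual stage; for a tuple that never enters the
  iteration, \<open>level\<close> and hence \<open>stage\<close> would be meaningless.\<close>

primrec valid :: "'p ctx \<Rightarrow> (var \<Rightarrow> 'a) list \<Rightarrow> bool" where
  "valid [] es \<longleftrightarrow> True"
| "valid (d # c) es \<longleftrightarrow> (case d of (X, xs, \<phi>, fl) \<Rightarrow>
     valid c (tl es) \<and> (fl \<longrightarrow> map (hd es) xs \<in> lfp (opr (J c (tl es)) (hd es) X xs \<phi>)))"

definition wf_ctx :: "'p ctx \<Rightarrow> bool" where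
  "wf_ctx c \<longleftrightarrow> (\<forall>(X, xs, \<phi>, fl)\<in>set c. distinct xs \<and> length xs = rv_arity X \<and> set xs \<subseteq> {..<N})"

definition env :: "'p ctx \<Rightarrow> (var \<Rightarrow> 'a) list \<Rightarrow> bool" where
  "env c es \<longleftrightarrow> length es = length c \<and> (\<forall>e\<in>set es. normal e)"

lemma env_Cons: "env (d # c) (e # es) \<longleftrightarrow> normal e \<and> env c es"
  by (auto simp: env_def)

lemma env_ConsE:
  assumes "env (d # c) es" obtains e es' where "es = e # es'" "normal e" "env c es'"
  using assms by (cases es) (auto simp: env_def)

lemma env_drop: "env c es \<Longrightarrow> env (drop i c) (drop i es)"
  by (auto simp: env_def dest: in_set_dropD)

lemma length_vec [simp]: "length (vec v) = N"
  by (simp add: vec_def)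

lemma length_flat [simp]: "length (flat es) = N * length es"
  by (induction es) (auto simp: flat_def)

lemma flat_Cons [simp]: "flat (e # es) = vec e @ flat es"
  by (simp add: flat_def)

lemma vec_nth: "i < N \<Longrightarrow> vec v ! i = v i"
  by (simp add: vec_def)

lemma normal_upd: "normal v \<Longrightarrow> x < N \<Longrightarrow> a \<in> universe M \<Longrightarrow> normal (v(x := a))"
  by (auto simp: normal_def)

lemma normal_assign:
  assumes "normal v" "set xs \<subseteq> {..<N}" "set as \<subseteq> universe M"
  shows "normal (assign v xs as)"
proof -
  have "assign v xs as i = v i" if "i \<ge> N" for i
    using assms(2) that by (intro assign_notin) auto
  then show ?thesis using assms(1,3) range_assign[of v "universe M" as xs] by (auto simp: normal_def)
qed

lemma set_vec: "normal v \<Longrightarrow> set (vec v) \<subseteq> universe M"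
  by (auto simp: vec_def normal_def)

lemma set_flat: "env c es \<Longrightarrow> set (flat es) \<subseteq> universe M"
  using set_vec by (fastforce simp: env_def flat_def)

text \<open>The variables of a rule spell out the current assignment and the context in this order;
  the fresh variables of the rules come after them.\<close>

definition fits :: "(var \<Rightarrow> 'a) \<Rightarrow> (var \<Rightarrow> 'a) \<Rightarrow> (var \<Rightarrow> 'a) list \<Rightarrow> bool" where
  "fits V v es \<longleftrightarrow> map V [0..<width N es] = vec v @ flat es"

lemma map_upt_append: "i \<le> j \<Longrightarrow> map V [0..<j] = map V [0..<i] @ map V [i..<j]"
  using upt_add_eq_append[of 0 i "j - i"] by simp

lemma fits_D:
  assumes "fits V v es"
  shows "map V [0..<N] = vec v" "map V [N..<width N es] = flat es" "x < N \<Longrightarrow> V x = v x"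
    "set xs \<subseteq> {..<N} \<Longrightarrow> map V xs = map v xs"
proof -
  have "map V [0..<N] @ map V [N..<width N es] = vec v @ flat es"
    using assms unfolding fits_def by (subst map_upt_append[symmetric]) auto
  then show *: "map V [0..<N] = vec v" "map V [N..<width N es] = flat es"
    by (simp_all add: append_eq_append_conv)
  then have "\<forall>x<N. V x = v x" by (auto simp: vec_def)
  then show "x < N \<Longrightarrow> V x = v x" "set xs \<subseteq> {..<N} \<Longrightarrow> map V xs = map v xs" by auto
qed

lemma fits_drop:
  assumes "fits V v es" "i < length es"
  shows "map V [N * Suc i..<width N es] = flat (drop i es)"
    "x < N \<Longrightarrow> V (N * Suc i + x) = (es ! i) x"
proof -
  have "map V [N * Suc i..<width N es] = flat (drop i es) \<and>
      (i < length es \<longrightarrow> (\<forall>x<N. V (N * Suc i + x) = (es ! i) x))" if "i \<le> length es" for i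
    using that
  proof (induction i)
    case 0
    have *: "map V [N..<width N es] = flat es" using fits_D[OF assms(1)] by simp
    have "V (N + x) = (es ! 0) x" if "x < N" "0 < length es" for x
    proof -
      have "map V [N..<width N es] ! x = V (N + x)" using that by (cases es) auto
      moreover have "flat es ! x = (es ! 0) x" using that by (cases es) (auto simp: nth_append vec_nth)
      ultimately show ?thesis using * by simp
    qed
    with * show ?case by simp
  next
    case (Suc i)
    then have IH: "map V [N * Suc i..<width N es] = flat (drop i es)" by simp
    have d: "drop i es = es ! i # drop (Suc i) es" using Suc.prems by (simp add: Cons_nth_drop_Suc)
    have "N * Suc (Suc i) \<le> width N es" using Suc.prems by (intro mult_le_mono2) simp
    then have "[N * Suc i..<width N es] = [N * Suc i..<N * Suc (Suc i)] @ [N * Suc (Suc i)..<width N es]"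
      using upt_add_eq_append[of "N * Suc i" "N * Suc (Suc i)" "width N es - N * Suc (Suc i)"] by simp
    then have "map V [N * Suc i..<N * Suc (Suc i)] @ map V [N * Suc (Suc i)..<width N es] = vec (es ! i) @ flat (drop (Suc i) es)"
      using IH unfolding d by simp
    then have *: "map V [N * Suc (Suc i)..<width N es] = flat (drop (Suc i) es)"
      by (simp add: append_eq_append_conv)
    have "V (N * Suc (Suc i) + x) = (es ! Suc i) x" if x: "x < N" and "Suc i < length es" for x
    proof -
      have "N * Suc (Suc i) + N \<le> width N es"
        using mult_le_mono2[of "Suc (Suc (Suc i))" "Suc (length es)" N] that by simp
      then have "map V [N * Suc (Suc i)..<width N es] ! x = V (N * Suc (Suc i) + x)" using x by simp
      moreover have "drop (Suc i) es = es ! Suc i # drop (Suc (Suc i)) es" using that by (simp add: Cons_nth_drop_Suc)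
      then have "flat (drop (Suc i) es) ! x = (es ! Suc i) x" using x by (simp add: nth_append vec_nth)
      ultimately show ?thesis using * by simp
    qed
    with * show ?case by blast
  qed
  from this[of i] assms(2) show "map V [N * Suc i..<width N es] = flat (drop i es)"
    "x < N \<Longrightarrow> V (N * Suc i + x) = (es ! i) x" by auto
qed

lemma map_subst:
  assumes "\<And>x. x < N \<Longrightarrow> V (f x) = e x" "length us = length xs"
  shows "map V (subst N f xs us) = vec (assign e xs (map V us))"
proof -
  have "V (assign f xs us x) = assign e xs (map V us) x" if "x < N" for x
  proof -
    have "V (assign f xs us x) = assign (V \<circ> f) xs (map V us) x"
      using assign_map[of xs us V f] assms(2) by (metis comp_apply)
    also have "\<dots> = assign e xs (map V us) x"
      using assms(1) that by (auto simp: assign_def split: option.split)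
    finally show ?thesis .
  qed
  then show ?thesis by (simp add: subst_def vec_def)
qed

lemma fits_subst:
  "fits V v es \<Longrightarrow> length us = length xs \<Longrightarrow> map V (subst N id xs us) = vec (assign v xs (map V us))"
  by (intro map_subst) (auto simp: fits_D)

text \<open>Assignment, context and the two fresh tuples occupy disjoint intervals of variables, so
  an instance of a rule can be prescribed freely.\<close>

lemma exists_fits:
  assumes "normal v" "env c es" "set zs \<subseteq> universe M" "set ss \<subseteq> universe M" "n = width N c"
  obtains V where "range V \<subseteq> universe M" "fits V v es" "map V [n..<n + length zs] = zs"
    "map V [n + length zs..<n + length zs + length ss] = ss"
proof -
  define LL where "LL = (vec v @ flat es) @ zs @ ss"
  define V where "V = (\<lambda>i. if i < length LL then LL ! i else v0 0)"
  have n: "n = length (vec v @ flat es)" using assms(2,5) by (simp add: env_def)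
  have "set LL \<subseteq> universe M" using assms(1-4) set_vec set_flat by (simp add: LL_def)
  moreover have "v0 0 \<in> universe M" using v0 by auto
  ultimately have "range V \<subseteq> universe M" by (auto simp: V_def intro: nth_mem)
  moreover have "map V [0..<n] = vec v @ flat es"
    unfolding n by (rule nth_equalityI) (auto simp: V_def LL_def nth_append)
  then have "fits V v es" using assms(2,5) by (simp add: fits_def env_def)
  moreover have "map V [n..<n + length zs] = zs"
    unfolding n by (rule nth_equalityI) (auto simp: V_def LL_def nth_append)
  moreover have "map V [n + length zs..<n + length zs + length ss] = ss"
    unfolding n by (rule nth_equalityI) (auto simp: V_def LL_def nth_append)
  ultimately show ?thesis using that by blast
qed

lemma J_lookup:
  "env c es \<Longrightarrow> i < length c \<Longrightarrow> fst (c ! i) = R \<Longrightarrow> \<forall>j<i. fst (c ! j) \<noteq> R \<Longrightarrow>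
    J c es R = J (drop i c) (drop i es) R"
proof (induction i arbitrary: c es)
  case (Suc i)
  then obtain d c' where c: "c = d # c'" by (cases c) auto
  then obtain e es' where es: "es = e # es'" "env c' es'" using Suc.prems env_ConsE by metis
  have "fst d \<noteq> R" using Suc.prems(4) unfolding c by (metis nth_Cons_0 zero_less_Suc)
  moreover have "\<forall>j<i. fst (c' ! j) \<noteq> R" using Suc.prems(4) unfolding c by (metis Suc_less_eq nth_Cons_Suc)
  ultimately show ?case using Suc.IH[OF es(2)] Suc.prems(2,3) by (auto simp: c es split: prod.splits)
qed simp

lemma valid_drop: "env c es \<Longrightarrow> valid c es \<Longrightarrow> valid (drop i c) (drop i es)"
proof (induction c arbitrary: i es)
  case (Cons d c)
  then show ?case by (cases i; elim env_ConsE) (auto split: prod.splits)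
qed simp

subsection \<open>Soundness\<close>

text \<open>The invariant for soundness. It speaks of all assignments that a tuple may encode in a
  valid context. For \<open>Stage\<close> only the outer entries are assumed valid: that the
  innermost one names a stage is part of what a derivation establishes. \<open>G\<close> is the
  meaning given to \<open>Goal\<close>.\<close>

primrec holds :: "bool \<Rightarrow> 'p name \<Rightarrow> 'a list \<Rightarrow> bool" where
  "holds G Goal L \<longleftrightarrow> G"
| "holds G (Truth b \<phi> c) L \<longleftrightarrow> (\<forall>v es. normal v \<and> env c es \<and> L = vec v @ flat es \<and> valid c es \<longrightarrow>
     sat M (J c es) v \<phi> = b)"
| "holds G (Truth_Upd b \<phi> c x) L \<longleftrightarrow> (\<forall>v es a. normal v \<and> env c es \<and> a \<in> universe M \<and>
     L = (vec v @ flat es) @ [a] \<and> valid c es \<longrightarrow> sat M (J c es) (v(x := a)) \<phi> = b)"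
| "holds G (Stage b c) L \<longleftrightarrow> (\<forall>u es. normal u \<and> env c es \<and> L = vec u @ flat es \<and> valid (tl c) (tl es) \<longrightarrow>
     valid c es \<and> (case c of [] \<Rightarrow> True | (X, xs, _) # _ \<Rightarrow> (map u xs \<in> J c es X) = b))"
| "holds G (Closed c) L \<longleftrightarrow> (case c of [] \<Rightarrow> True | (X, xs, \<phi>, fl) # c' \<Rightarrow>
     (\<forall>e es z. normal e \<and> env c' es \<and> z \<in> tuples (length xs) (universe M) \<and> L = (vec e @ flat es) @ z \<and>
        valid c (e # es) \<longrightarrow> z \<in> J c (e # es) X \<or> \<not> sat M (J c (e # es)) (assign e xs z) \<phi>))"

abbreviation premises_hold :: "bool \<Rightarrow> (var \<Rightarrow> 'a) \<Rightarrow> ('p name \<times> var list \<times> nat) list \<Rightarrow> bool" where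
  "premises_hold G V \<alpha>s \<equiv> \<forall>(m, ys, k)\<in>set \<alpha>s. \<forall>cs\<in>tuples k (universe M). holds G m (map V ys @ cs)"

definition sound :: "bool \<Rightarrow> ('p name, 'p) rule \<Rightarrow> bool" where
  "sound G = (\<lambda>(\<alpha>s, \<beta>s, n, us). \<forall>V. range V \<subseteq> universe M \<longrightarrow>
     (premises_hold G V \<alpha>s) \<longrightarrow>
     (\<forall>\<beta>\<in>set \<beta>s. sat M (\<lambda>_. {}) V \<beta>) \<longrightarrow> holds G n (map V us))"

lemma derivable_holds:
  assumes "\<And>r. r \<in> Rs \<Longrightarrow> sound G r" "derivable M Rs n L"
  shows "holds G n L"
  using assms(2)
proof induction
  case (derivableI \<alpha>s \<beta>s n us V)
  then show ?case using assms(1)[OF derivableI(1)] unfolding sound_def by fastforce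
qed

lemma fitsI: "env c es \<Longrightarrow> map V [0..<width N c] = vec v @ flat es \<Longrightarrow> fits V v es"
  by (simp add: fits_def env_def)

lemma sound_prop_rules:
  assumes "\<And>I v. (\<exists>bs\<in>set bss. \<forall>(b', \<phi>)\<in>set bs. sat M I v \<phi> = b') \<Longrightarrow> sat M I v \<psi> = b"
    and "r \<in> prop_rules N bss b \<psi> c"
  shows "sound G r"
proof -
  obtain bs where bs: "bs \<in> set bss"
    and r: "r = (map (\<lambda>(b, \<phi>). (Truth b \<phi> c, [0..<width N c], 0)) bs, [], Truth b \<psi> c, [0..<width N c])"
    using assms(2) by (auto simp: prop_rules_def Let_def)
  show ?thesis unfolding sound_def r prod.case
  proof (intro allI impI)
    fix V :: "var \<Rightarrow> 'a"
    assume a: "premises_hold G V (map (\<lambda>(b, \<phi>). (Truth b \<phi> c, [0..<width N c], 0)) bs)"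
    show "holds G (Truth b \<psi> c) (map V [0..<width N c])" unfolding holds.simps
    proof (intro allI impI; elim conjE)
      fix v es assume h: "normal v" "env c es" "map V [0..<width N c] = vec v @ flat es" "valid c es"
      have "sat M (J c es) v \<phi> = b'" if "(b', \<phi>) \<in> set bs" for b' \<phi>
      proof -
        have "holds G (Truth b' \<phi> c) (map V [0..<width N c])" using a that by force
        then show ?thesis using h by simp
      qed
      then show "sat M (J c es) v \<psi> = b" using bs by (intro assms(1)) auto
    qed
  qed
qed

lemma sound_quant_rules:
  assumes \<psi>: "\<And>I v. (sat M I v \<psi> = b) \<longleftrightarrow> (\<exists>a\<in>universe M. sat M I (v(x := a)) \<phi> = b)"
    and x: "x < N" and r: "r \<in> quant_rules N b \<psi> x \<phi> c"
  shows "sound G r"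
proof -
  define n where "n = width N c"
  have sub: "map V (subst N id [x] [n] @ [N..<n]) = vec (v(x := V n)) @ flat es"
    if "env c es" "map V [0..<n] = vec v @ flat es" for V v es
    using fits_subst[OF fitsI[OF that[unfolded n_def]], of "[n]" "[x]"] fits_D(2)[OF fitsI[OF that[unfolded n_def]]] that(1)
    by (simp add: assign_single n_def env_def)
  consider "r = ([(Truth b \<phi> c, subst N id [x] [n] @ [N..<n], 0)], [], Truth b \<psi> c, [0..<n])"
    | "r = ([(Truth_Upd (\<not> b) \<phi> c x, [0..<n], 1)], [], Truth (\<not> b) \<psi> c, [0..<n])"
    | "r = ([(Truth (\<not> b) \<phi> c, subst N id [x] [n] @ [N..<n], 0)], [], Truth_Upd (\<not> b) \<phi> c x, [0..<Suc n])"
    using r unfolding quant_rules_def Let_def n_def by blast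
  then show ?thesis
  proof cases
    case 1
    show ?thesis unfolding sound_def 1 prod.case
    proof (intro allI impI)
      fix V :: "var \<Rightarrow> 'a" assume V: "range V \<subseteq> universe M"
        and a: "premises_hold G V [(Truth b \<phi> c, subst N id [x] [n] @ [N..<n], 0)]"
      show "holds G (Truth b \<psi> c) (map V [0..<n])" unfolding holds.simps
      proof (intro allI impI; elim conjE)
        fix v es assume h: "normal v" "env c es" "map V [0..<n] = vec v @ flat es" "valid c es"
        have Vn: "V n \<in> universe M" using V by auto
        have "holds G (Truth b \<phi> c) (map V (subst N id [x] [n] @ [N..<n]))" using a by simp
        then have "sat M (J c es) (v(x := V n)) \<phi> = b"
          unfolding holds.simps sub[OF h(2,3)] using normal_upd[OF h(1) x Vn] h(2,4) by blast
        then show "sat M (J c es) v \<psi> = b" unfolding \<psi> using Vn by blast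
      qed
    qed
  next
    case 2
    show ?thesis unfolding sound_def 2 prod.case
    proof (intro allI impI)
      fix V :: "var \<Rightarrow> 'a" assume V: "range V \<subseteq> universe M"
        and a: "premises_hold G V [(Truth_Upd (\<not> b) \<phi> c x, [0..<n], 1)]"
      show "holds G (Truth (\<not> b) \<psi> c) (map V [0..<n])" unfolding holds.simps
      proof (intro allI impI; elim conjE)
        fix v es assume h: "normal v" "env c es" "map V [0..<n] = vec v @ flat es" "valid c es"
        have "sat M (J c es) (v(x := d)) \<phi> = (\<not> b)" if "d \<in> universe M" for d
        proof -
          have "[d] \<in> tuples 1 (universe M)" using that by (simp add: tuples_def)
          then have "holds G (Truth_Upd (\<not> b) \<phi> c x) (map V [0..<n] @ [d])" using a by simp
          then show ?thesis unfolding holds.simps h(3) using h that by blast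
        qed
        then show "sat M (J c es) v \<psi> = (\<not> b)" using \<psi>[of "J c es" v] by blast
      qed
    qed
  next
    case 3
    show ?thesis unfolding sound_def 3 prod.case
    proof (intro allI impI)
      fix V :: "var \<Rightarrow> 'a" assume V: "range V \<subseteq> universe M"
        and a: "premises_hold G V [(Truth (\<not> b) \<phi> c, subst N id [x] [n] @ [N..<n], 0)]"
      show "holds G (Truth_Upd (\<not> b) \<phi> c x) (map V [0..<Suc n])" unfolding holds.simps
      proof (intro allI impI; elim conjE)
        fix v es d assume h: "normal v" "env c es" "d \<in> universe M" "map V [0..<Suc n] = (vec v @ flat es) @ [d]" "valid c es"
        then have m: "map V [0..<n] = vec v @ flat es" "V n = d" by auto
        have "holds G (Truth (\<not> b) \<phi> c) (map V (subst N id [x] [n] @ [N..<n]))" using a by simp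
        then show "sat M (J c es) (v(x := d)) \<phi> = (\<not> b)"
          unfolding holds.simps sub[OF h(2) m(1)] using normal_upd[OF h(1) x] m(2) h(2,3,5) by blast
      qed
    qed
  qed
qed

lemma sound_rel_rules:
  assumes "r \<in> rel_rules N R ys c" "length ys = rv_arity R" "set ys \<subseteq> {..<N}" "wf_ctx c"
  shows "sound G r"
  using assms(1)
proof (rule rel_rulesE)
  fix i xs \<phi> fl b
  assume i: "i < length c" "c ! i = (R, xs, \<phi>, fl)" "\<forall>j<i. fst (c ! j) \<noteq> R" "\<not> fl \<Longrightarrow> \<not> b"
    and r: "r = (if fl then [(Stage b (drop i c), stage_args N i xs ys c, 0)] else [],
        [], Truth b (Rel R ys) c, [0..<width N c])"
  have d: "drop i c = (R, xs, \<phi>, fl) # drop (Suc i) c" using i(1,2) by (simp add: Cons_nth_drop_Suc flip: i(2))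
  have xs: "distinct xs" "length xs = length ys" "set xs \<subseteq> {..<N}"
    using assms(2,4) i(1,2) nth_mem[OF i(1)] by (fastforce simp: wf_ctx_def)+
  show ?thesis unfolding sound_def r prod.case
  proof (intro allI impI)
    fix V :: "var \<Rightarrow> 'a" assume V: "range V \<subseteq> universe M"
      and a: "premises_hold G V (if fl then [(Stage b (drop i c), stage_args N i xs ys c, 0)] else [])"
    show "holds G (Truth b (Rel R ys) c) (map V [0..<width N c])" unfolding holds.simps
    proof (intro allI impI; elim conjE)
      fix v es assume h: "normal v" "env c es" "map V [0..<width N c] = vec v @ flat es" "valid c es"
      have f: "fits V v es" using fitsI[OF h(2,3)] .
      have l: "length es = length c" using h(2) by (simp add: env_def)
      have J: "J c es R = J (drop i c) (drop i es) R" using J_lookup[OF h(2) i(1)] i by simp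
      show "sat M (J c es) v (Rel R ys) = b"
      proof (cases fl)
        case False
        then show ?thesis using i(4) J d by simp
      next
        case True
        let ?e = "assign (es ! i) xs (map V ys)"
        have m: "map V (stage_args N i xs ys c) = vec ?e @ flat (drop i es)"
          using map_subst[of V "(+) (N * Suc i)" "es ! i" ys xs] fits_drop[OF f, of i] i(1) l xs(2) by simp
        have "holds G (Stage b (drop i c)) (vec ?e @ flat (drop i es))"
          using a True unfolding m[symmetric] by (simp del: holds.simps map_append)
        moreover have "normal ?e" using h(2) i(1) l V xs(3) by (intro normal_assign) (auto simp: env_def)
        moreover have "valid (tl (drop i c)) (tl (drop i es))"
          using valid_drop[OF h(2,4), of "Suc i"] by (simp add: drop_Suc tl_drop)
        ultimately have "(map ?e xs \<in> J (drop i c) (drop i es) R) = b"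
          using env_drop[OF h(2), of i] unfolding holds.simps by (auto simp: d)
        moreover have "map ?e xs = map v ys"
          using xs fits_D(4)[OF f assms(3)] by (simp add: map_assign)
        ultimately show ?thesis using J by simp
      qed
    qed
  qed
qed

end

section \<open>Soundness of the rules for fixed points and of the whole program\<close>

context lfp_evaluation
begin

lemma J_Cons: "J ((X, xs, \<phi>, fl) # c) (e # es) =
    (J c es)(X := (opr (J c es) e X xs \<phi> ^^ (if fl then level (opr (J c es) e X xs \<phi>) (map e xs) else 0)) {})"
  by (simp add: stage_def)

lemma valid_Cons: "valid ((X, xs, \<phi>, fl) # c) (e # es) \<longleftrightarrow>
    valid c es \<and> (fl \<longrightarrow> map e xs \<in> lfp (opr (J c es) e X xs \<phi>))"
  by simp

lemma in_opr: "as \<in> opr I v X xs \<phi> S \<longleftrightarrow> as \<in> tuples (length xs) (universe M) \<and> sat M (I(X := S)) (assign v xs as) \<phi>"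
  by (simp add: lfp_op_def)

lemma vec_eq: "vec u = vec v \<Longrightarrow> set xs \<subseteq> {..<N} \<Longrightarrow> map u xs = map v xs"
  by (auto simp: vec_def)

lemma premise:
  assumes "premises_hold G V \<alpha>s" "(m, ys, 0) \<in> set \<alpha>s"
  shows "holds G m (map V ys)"
  using assms by fastforce

lemma map_tuple: "range V \<subseteq> universe M \<Longrightarrow> length xs = k \<Longrightarrow> map V xs \<in> tuples k (universe M)"
  by (auto simp: tuples_def)

lemma holds_StageD:
  assumes "holds G (Stage b ((X, xs, \<phi>, fl) # c)) (vec u @ flat (e # es))"
    and "normal u" "normal e" "env c es" "valid c es"
  shows "valid ((X, xs, \<phi>, fl) # c) (e # es)" "(map u xs \<in> J ((X, xs, \<phi>, fl) # c) (e # es) X) = b"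
proof -
  have "valid ((X, xs, \<phi>, fl) # c) (e # es) \<and> (map u xs \<in> J ((X, xs, \<phi>, fl) # c) (e # es) X) = b"
    using assms(1)[unfolded holds.simps, rule_format, of u "e # es"] assms(2-5)
    by (simp add: env_Cons del: J.simps valid.simps)
  then show "valid ((X, xs, \<phi>, fl) # c) (e # es)" "(map u xs \<in> J ((X, xs, \<phi>, fl) # c) (e # es) X) = b"
    by blast+
qed

text \<open>The rule for \<open>Stage\<close> certifies its entry by a tuple that enters right after
  a known iterate; the rule for falsity exhibits a prefixed point that misses the tuple in
  question.\<close>

lemma sound_lfp_rules:
  assumes r: "r \<in> lfp_rules N X xs \<phi> us c"
    and pol: "polarity True X \<phi>" and d: "distinct xs" and len: "length us = length xs"
    and xs: "set xs \<subseteq> {..<N}" and us: "set us \<subseteq> {..<N}"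
  shows "sound G r"
proof -
  define n where "n = width N c"
  define k where "k = length xs"
  define cf where "cf fl = (X, xs, \<phi>, fl) # c" for fl
  define U where "U = subst N id xs us"
  define Z where "Z = subst N id xs [n..<n+k]"
  define S where "S = subst N id xs [n+k..<n+k+k]"
  define E where "E = [N..<n]"
  note defs = n_def k_def U_def Z_def S_def E_def
  define F where "F es v = opr (J c es) v X xs \<phi>" for es v
  have mono: "mono (F es v)" for es v unfolding F_def using mono_lfp_op[OF pol] .
  have F_assign: "F es (assign v xs as) = F es v" if "length as = k" for es v as
    using that by (simp add: F_def lfp_op_assign k_def)
  have Jcf: "J (cf fl) (e # es) = (J c es)(X := (F es e ^^ (if fl then level (F es e) (map e xs) else 0)) {})" for fl e es
    unfolding cf_def F_def J_Cons ..
  have vcf: "valid (cf fl) (e # es) \<longleftrightarrow> valid c es \<and> (fl \<longrightarrow> map e xs \<in> lfp (F es e))" for fl e es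
    by (simp add: cf_def F_def)
  have ecf: "env (cf fl) (e # es) \<longleftrightarrow> normal e \<and> env c es" for fl e es
    by (simp add: cf_def env_Cons)
  have m: "map V U = vec (assign v xs (map V us))" "map V Z = vec (assign v xs (map V [n..<n+k]))"
      "map V S = vec (assign v xs (map V [n+k..<n+k+k]))" "map V E = flat es" "map V [0..<N] = vec v"
      "map V us = map v us"
    if "env c es" "map V [0..<n] = vec v @ flat es" for V v es
  proof -
    have f: "fits V v es" using fitsI that by (simp add: n_def)
    show "map V U = vec (assign v xs (map V us))" "map V Z = vec (assign v xs (map V [n..<n+k]))"
      "map V S = vec (assign v xs (map V [n+k..<n+k+k]))"
      unfolding U_def Z_def S_def by (rule fits_subst[OF f], simp add: len k_def)+
    show "map V E = flat es" using fits_D(2)[OF f] that(1) by (simp add: E_def n_def env_def)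
    show "map V [0..<N] = vec v" "map V us = map v us" using fits_D(1)[OF f] fits_D(4)[OF f us] by auto
  qed
  have nrm: "normal (assign v xs as)" if "normal v" "as \<in> tuples k (universe M)" for v as
    using that by (intro normal_assign[OF _ xs]) (auto simp: tuples_def)
  have ma: "map (assign v xs as) xs = as" if "as \<in> tuples k (universe M)" for v as
    using that d by (intro map_assign) (auto simp: tuples_def k_def)
  \<comment> \<open>Both rules for \<open>Closed\<close> decode their arguments in the same way;
    only the claim about a single tuple \<open>z\<close> differs.\<close>
  have sound_closed: "sound G (\<alpha>s, [], Closed (cf fl), [0..<n+k])"
    if step: "\<And>V e es z. premises_hold G V \<alpha>s \<Longrightarrow> normal e \<Longrightarrow> env c es \<Longrightarrow> z \<in> tuples k (universe M) \<Longrightarrow>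
      valid (cf fl) (e # es) \<Longrightarrow> map V (Z @ [0..<n]) = vec (assign e xs z) @ flat (e # es) \<Longrightarrow>
      z \<in> J (cf fl) (e # es) X \<or> \<not> sat M (J (cf fl) (e # es)) (assign e xs z) \<phi>" for \<alpha>s fl
    unfolding sound_def prod.case
  proof (intro allI impI)
    fix V :: "var \<Rightarrow> 'a" assume a: "premises_hold G V \<alpha>s"
    show "holds G (Closed (cf fl)) (map V [0..<n+k])"
      unfolding cf_def holds.simps list.case prod.case
    proof (intro allI impI; elim conjE)
      fix e es z assume h: "normal e" "env c es" "z \<in> tuples (length xs) (universe M)"
          "map V [0..<n + k] = (vec e @ flat es) @ z" "valid ((X, xs, \<phi>, fl) # c) (e # es)"
      have "map V [0..<n] @ map V [n..<n+k] = (vec e @ flat es) @ z"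
        using h(4) map_upt_append[of n "n + k" V] by simp
      moreover have "length (map V [0..<n]) = length (vec e @ flat es)" using h(2) by (simp add: n_def env_def)
      ultimately have h4: "map V [0..<n] = vec e @ flat es" "map V [n..<n+k] = z"
        using append_eq_append_conv by blast+
      have "map V (Z @ [0..<n]) = vec (assign e xs z) @ flat (e # es)"
        unfolding map_append m(2)[OF h(2) h4(1)] h4 flat_Cons ..
      from step[OF a h(1,2) h(3)[folded k_def] h(5)[folded cf_def] this]
      show "z \<in> J ((X, xs, \<phi>, fl) # c) (e # es) X \<or> \<not> sat M (J ((X, xs, \<phi>, fl) # c) (e # es)) (assign e xs z) \<phi>"
        unfolding cf_def .
    qed
  qed
  consider
      (true) "r = ([(Stage True (cf True), U @ U @ E, 0)], [], Truth True (Lfp X xs \<phi> us) c, [0..<n])"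
    | (false) fl where "r = ((if fl then [(Stage False (cf True), U @ Z @ E, 0)] else []) @ [(Closed (cf fl), Z @ E, k)], [],
        Truth False (Lfp X xs \<phi> us) c, [0..<n])"
    | (closed1) fl where "r = ([(Truth False \<phi> (cf fl), Z @ [0..<n], 0)], [], Closed (cf fl), [0..<n+k])"
    | (closed2) "r = ([(Stage True (cf True), Z @ [0..<n], 0)], [], Closed (cf True), [0..<n+k])"
    | (stage) fl b where "r = ((if fl then [(Stage False (cf True), [0..<N] @ S @ E, 0)] else []) @
          [(Truth True \<phi> (cf fl), [0..<N] @ S @ E, 0), (Truth b \<phi> (cf fl), Z @ S @ E, 0)], [],
        Stage b (cf True), Z @ [0..<n])"
  proof -
    note r' = r[unfolded lfp_rules_def Let_def, folded n_def k_def, folded U_def Z_def S_def E_def cf_def]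
    show thesis using r'
      by (elim UnE) (use true in blast, use false in blast, use closed1 in blast, use closed2 in blast,
          use stage in \<open>clarsimp split: prod.splits\<close>)
  qed
  then show ?thesis
  proof cases
    case true
    show ?thesis unfolding sound_def true prod.case
    proof (intro allI impI)
      fix V :: "var \<Rightarrow> 'a" assume V: "range V \<subseteq> universe M"
      assume "premises_hold G V [(Stage True (cf True), U @ U @ E, 0)]"
      note p = premise[OF this]
      show "holds G (Truth True (Lfp X xs \<phi> us) c) (map V [0..<n])" unfolding holds.simps
      proof (intro allI impI; elim conjE)
        fix v es assume h: "normal v" "env c es" "map V [0..<n] = vec v @ flat es" "valid c es"
        let ?u = "assign v xs (map V us)"
        have t: "map V us \<in> tuples k (universe M)" using map_tuple[OF V, of us k] len by (simp add: k_def)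
        have "holds G (Stage True (cf True)) (vec ?u @ flat (?u # es))"
          using p[of "Stage True (cf True)" "U @ U @ E", unfolded map_append m(1-5)[OF h(2,3)]] by (simp del: holds.simps)
        \<comment> \<open>The tuple also names the stage, and a valid name lies in the fixed
          point.\<close>
        then have "valid (cf True) (?u # es)"
          using holds_StageD(1) nrm[OF h(1) t] h(2,4) unfolding cf_def by blast
        then have "map V us \<in> lfp (F es v)" using vcf[of True ?u es] t by (simp add: ma F_assign tuples_def)
        then show "sat M (J c es) v (Lfp X xs \<phi> us) = True" unfolding sat_Lfp F_def m(6)[OF h(2,3)] by simp
      qed
    qed
  next
    case false
    show ?thesis unfolding sound_def false prod.case
    proof (intro allI impI)
      fix V :: "var \<Rightarrow> 'a" assume V: "range V \<subseteq> universe M"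
      assume a: "\<forall>(m, ys, k)\<in>set ((if fl then [(Stage False (cf True), U @ Z @ E, 0)] else []) @ [(Closed (cf fl), Z @ E, k)]).
          \<forall>cs\<in>tuples k (universe M). holds G m (map V ys @ cs)"
      note p = premise[OF a]
      show "holds G (Truth False (Lfp X xs \<phi> us) c) (map V [0..<n])" unfolding holds.simps
      proof (intro allI impI; elim conjE)
        fix v es assume h: "normal v" "env c es" "map V [0..<n] = vec v @ flat es" "valid c es"
        let ?u = "assign v xs (map V us)"
        let ?w = "map V [n..<n+k]"
        let ?e = "assign v xs ?w"
        have t: "map V us \<in> tuples k (universe M)" "?w \<in> tuples k (universe M)"
          using map_tuple[OF V, of us k] map_tuple[OF V, of "[n..<n+k]" k] len by (simp_all add: k_def)
        have Fe: "F es ?e = F es v" using t(2) by (simp add: F_assign tuples_def)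
        have "fl \<Longrightarrow> holds G (Stage False (cf True)) (vec ?u @ flat (?e # es))"
          using p[of "Stage False (cf True)" "U @ Z @ E", unfolded map_append m(1-5)[OF h(2,3)]] by (simp del: holds.simps)
        then have fl: "fl \<Longrightarrow> valid (cf True) (?e # es) \<and> map ?u xs \<notin> J (cf True) (?e # es) X"
          using holds_StageD nrm[OF h(1)] t h(2,4) unfolding cf_def by metis
        then have val: "valid (cf fl) (?e # es)" using vcf h(4) by (cases fl) auto
        define Y where "Y = (F es v ^^ (if fl then level (F es v) ?w else 0)) {}"
        have Je: "J (cf fl) (?e # es) = (J c es)(X := Y)"
          unfolding Jcf Fe ma[OF t(2)] Y_def ..
        have "map V us \<notin> Y"
        proof (cases fl)
          case True then show ?thesis using fl Je ma[OF t(1)] by simp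
        qed (simp add: Y_def)
        \<comment> \<open>The universal premise provides \<open>Closed\<close> for every
          \<open>z\<close>, which makes \<open>Y\<close> a prefixed point; it thus contains the
          fixed point but not the tuple of \<open>us\<close>.\<close>
        moreover have "F es v Y \<subseteq> Y"
        proof
          fix z assume z: "z \<in> F es v Y"
          then have z': "z \<in> tuples k (universe M)" "sat M ((J c es)(X := Y)) (assign v xs z) \<phi>"
            by (auto simp: F_def in_opr k_def)
          have "holds G (Closed (cf fl)) ((vec ?e @ flat es) @ z)"
          proof -
            have "holds G (Closed (cf fl)) (map V (Z @ E) @ z)"
              using bspec[OF a, of "(Closed (cf fl), Z @ E, k)"] z'(1) by (simp del: holds.simps map_append)
            then show ?thesis unfolding map_append m(2,4)[OF h(2,3)] .
          qed
          then have "z \<in> J (cf fl) (?e # es) X \<or> \<not> sat M (J (cf fl) (?e # es)) (assign ?e xs z) \<phi>"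
            using nrm[OF h(1) t(2)] h(2) z'(1) val unfolding k_def holds.simps cf_def by auto
          then show "z \<in> Y" using z' t(2) unfolding Je by (auto simp: assign_assign tuples_def k_def)
        qed
        then have "lfp (F es v) \<subseteq> Y" by (rule lfp_lowerbound)
        ultimately have "map V us \<notin> lfp (F es v)" by blast
        then show "sat M (J c es) v (Lfp X xs \<phi> us) = False" unfolding sat_Lfp F_def m(6)[OF h(2,3)] by simp
      qed
    qed
  next
    case closed1
    show ?thesis unfolding closed1
    proof (rule sound_closed)
      fix V e es z
      assume "premises_hold G V [(Truth False \<phi> (cf fl), Z @ [0..<n], 0)]"
        and h: "normal e" "env c es" "z \<in> tuples k (universe M)" "valid (cf fl) (e # es)"
          "map V (Z @ [0..<n]) = vec (assign e xs z) @ flat (e # es)"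
      from premise[OF this(1), of "Truth False \<phi> (cf fl)" "Z @ [0..<n]", unfolded h(5)]
      show "z \<in> J (cf fl) (e # es) X \<or> \<not> sat M (J (cf fl) (e # es)) (assign e xs z) \<phi>"
        using nrm[OF h(1,3)] h ecf[of fl e es] unfolding holds.simps by auto
    qed
  next
    case closed2
    show ?thesis unfolding closed2
    proof (rule sound_closed)
      fix V e es z
      assume "premises_hold G V [(Stage True (cf True), Z @ [0..<n], 0)]"
        and h: "normal e" "env c es" "z \<in> tuples k (universe M)" "valid (cf True) (e # es)"
          "map V (Z @ [0..<n]) = vec (assign e xs z) @ flat (e # es)"
      from premise[OF this(1), of "Stage True (cf True)" "Z @ [0..<n]", unfolded h(5)]
      have "holds G (Stage True (cf True)) (vec (assign e xs z) @ flat (e # es))" by (simp del: holds.simps)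
      then have "map (assign e xs z) xs \<in> J (cf True) (e # es) X"
        using holds_StageD nrm[OF h(1,3)] h(1,2,4) unfolding cf_def valid_Cons by metis
      then show "z \<in> J (cf True) (e # es) X \<or> \<not> sat M (J (cf True) (e # es)) (assign e xs z) \<phi>"
        using ma h(3) by simp
    qed
  next
    case stage
    show ?thesis unfolding sound_def stage prod.case
    proof (intro allI impI)
      fix V :: "var \<Rightarrow> 'a" assume V: "range V \<subseteq> universe M"
      assume "\<forall>(m, ys, k)\<in>set ((if fl then [(Stage False (cf True), [0..<N] @ S @ E, 0)] else []) @
          [(Truth True \<phi> (cf fl), [0..<N] @ S @ E, 0), (Truth b \<phi> (cf fl), Z @ S @ E, 0)]).
          \<forall>cs\<in>tuples k (universe M). holds G m (map V ys @ cs)"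
      note p = premise[OF this]
      show "holds G (Stage b (cf True)) (map V (Z @ [0..<n]))" unfolding holds.simps
      proof (intro allI impI; elim conjE)
        fix u ees assume h: "normal u" "env (cf True) ees" "map V (Z @ [0..<n]) = vec u @ flat ees"
            "valid (tl (cf True)) (tl ees)"
        then obtain e es where ees: "ees = e # es" "normal e" "env c es"
          unfolding cf_def by (elim env_ConsE) auto
        have v: "valid c es" using h(4) by (simp add: cf_def ees)
        have h3: "map V Z = vec u" "map V [0..<n] = vec e @ flat es"
          using h(3) by (simp_all add: ees append_eq_append_conv Z_def)
        let ?z = "map V [n..<n+k]"
        let ?s = "map V [n+k..<n+k+k]"
        let ?e = "assign e xs ?s"
        have t: "?z \<in> tuples k (universe M)" "?s \<in> tuples k (universe M)" "map e xs \<in> tuples k (universe M)"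
          using map_tuple[OF V, of "[n..<n+k]" k] map_tuple[OF V, of "[n+k..<n+k+k]" k] map_tuple[of e xs] ees(2)
          by (simp_all add: k_def normal_def)
        have Fe: "F es ?e = F es e" using t(2) by (simp add: F_assign tuples_def)
        have "vec u = vec (assign e xs ?z)" using h3(1) m(2)[OF ees(3) h3(2)] by simp
        then have u: "map u xs = ?z" using vec_eq[OF _ xs] ma[OF t(1)] by metis
        have "fl \<Longrightarrow> holds G (Stage False (cf True)) (vec e @ flat (?e # es))"
          using p[of "Stage False (cf True)" "[0..<N] @ S @ E", unfolded map_append m(1-5)[OF ees(3) h3(2)]] by (simp del: holds.simps)
        then have fl: "fl \<Longrightarrow> valid (cf True) (?e # es) \<and> map e xs \<notin> J (cf True) (?e # es) X"
          using holds_StageD nrm[OF ees(2) t(2)] ees(2,3) v unfolding cf_def by metis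
        then have val: "valid (cf fl) (?e # es)" using vcf v by (cases fl) auto
        define i where "i = (if fl then level (F es e) ?s else 0)"
        define Y where "Y = (F es e ^^ i) {}"
        have Je: "J (cf fl) (?e # es) = (J c es)(X := Y)"
          unfolding Jcf Fe ma[OF t(2)] Y_def i_def ..
        have new: "map e xs \<notin> (F es e ^^ i) {}"
        proof (cases fl)
          case True then show ?thesis using fl Je by (simp add: Y_def)
        qed (simp add: i_def)
        have ev: "env (cf fl) (?e # es)" using ecf nrm[OF ees(2) t(2)] ees(3) by blast
        have "holds G (Truth True \<phi> (cf fl)) (vec e @ flat (?e # es))"
          using p[of "Truth True \<phi> (cf fl)" "[0..<N] @ S @ E", unfolded map_append m(1-5)[OF ees(3) h3(2)]] by (simp del: holds.simps)
        then have "sat M ((J c es)(X := Y)) e \<phi>"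
          using val ev ees(2) unfolding holds.simps Je[symmetric] by blast
        then have "map e xs \<in> F es e ((F es e ^^ i) {})"
          unfolding F_def in_opr assign_self[OF d] using t(3) by (simp add: Y_def F_def k_def)
        \<comment> \<open>\<open>map e xs\<close> enters directly after iterate \<open>i\<close>, so
          the stage it names is \<open>F es e Y\<close>, and membership there is decided by the body
          over \<open>Y\<close>.\<close>
        note lv = level_new[OF mono new this]
        have "holds G (Truth b \<phi> (cf fl)) (vec (assign e xs ?z) @ flat (?e # es))"
          using p[of "Truth b \<phi> (cf fl)" "Z @ S @ E", unfolded map_append m(1-5)[OF ees(3) h3(2)]] by (simp del: holds.simps)
        then have "sat M ((J c es)(X := Y)) (assign e xs ?z) \<phi> = b"
          using val ev nrm[OF ees(2) t(1)] unfolding holds.simps Je[symmetric] by blast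
        then have "(?z \<in> F es e Y) = b" using t(1) unfolding F_def in_opr by (simp add: k_def)
        moreover have "J (cf True) (e # es) X = F es e Y" unfolding Jcf using lv(1) by (simp add: Y_def)
        ultimately show "valid (cf True) ees \<and> (case cf True of [] \<Rightarrow> True | (X, xs, _) # _ \<Rightarrow> (map u xs \<in> J (cf True) ees X) = b)"
          using vcf v lv(3) u by (simp add: ees cf_def del: J.simps valid.simps)
      qed
    qed
  qed
qed

lemma sound_prog:
  assumes "wf_fm \<sigma> ar \<phi>" "all_vars \<phi> \<subseteq> {..<N}" "wf_ctx c" "r \<in> prog N \<phi> c"
  shows "sound G r"
  using assms
proof (induction \<phi> arbitrary: c)
  case (Rel R ys)
  then show ?case using sound_rel_rules[of r R ys c] by simp
next
  case (Pred P ys)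
  have *: "map V ys = map v ys" if "env c es" "map V [0..<width N c] = vec v @ flat es" for V v es
    using fits_D(4)[OF fitsI[OF that]] Pred.prems by simp
  show ?case using Pred.prems(4) unfolding prog.simps
    by (elim insertE emptyE; unfold sound_def; simp del: mult_Suc_right upt_Suc)
      (use * in metis)+
next
  case (Eq x y)
  have *: "V x = v x" "V y = v y" if "env c es" "map V [0..<width N c] = vec v @ flat es" for V v es
    using fits_D(3)[OF fitsI[OF that]] Eq.prems by simp_all
  show ?case using Eq.prems(4) unfolding prog.simps
    by (elim insertE emptyE; unfold sound_def; simp del: mult_Suc_right upt_Suc)
      (use * in metis)+
next
  case (Ex x \<phi>)
  then show ?case by (auto elim!: sound_quant_rules[rotated 2])
next
  case (All x \<phi>)
  then show ?case by (auto elim!: sound_quant_rules[rotated 2])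
next
  case (Lfp X xs \<phi> us)
  have "wf_ctx ((X, xs, \<phi>, fl) # c)" for fl using Lfp.prems by (auto simp: wf_ctx_def)
  with Lfp show ?case using sound_lfp_rules[of r X xs \<phi> us c] by auto
next
  case Bot
  then show ?case by (simp add: sound_def)
qed (auto elim!: sound_prop_rules[rotated])

end

subsection \<open>Completeness\<close>

text \<open>\<open>Rs\<close> stays fixed while an induction descends; the lemmas assume that it
  contains the rules of the subformula at hand.\<close>

locale lfp_completeness = lfp_evaluation M I0 v0 N
  for M :: "('p, 'a) struct" and I0 v0 N +
  fixes Rs :: "('p name, 'p) rule set" and \<sigma> :: "'p set" and ar :: "'p \<Rightarrow> nat"
  assumes wf: "r \<in> Rs \<Longrightarrow> wf_rule \<sigma> ar (name_arity N) r"
begin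

abbreviation der :: "'p name \<Rightarrow> 'a list \<Rightarrow> bool" where "der \<equiv> derivable M Rs"

text \<open>Besides being valid, each flagged entry has its stage fully decided by derivations: for
  every tuple, either membership or non-membership is derived. Only over such a context can the
  truth value of every subformula be derived.\<close>

primrec good :: "'p ctx \<Rightarrow> (var \<Rightarrow> 'a) list \<Rightarrow> bool" where
  "good [] es \<longleftrightarrow> True"
| "good (d # c) es \<longleftrightarrow> (case d of (X, xs, \<phi>, fl) \<Rightarrow> good c (tl es) \<and>
    (fl \<longrightarrow> map (hd es) xs \<in> lfp (opr (J c (tl es)) (hd es) X xs \<phi>) \<and>
      (\<forall>u\<in>tuples (length xs) (universe M).
        der (Stage (u \<in> stage (opr (J c (tl es)) (hd es) X xs \<phi>) (map (hd es) xs)) ((X, xs, \<phi>, True) # c))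
          (vec (assign (hd es) xs u) @ vec (hd es) @ flat (tl es)))))"

lemma good_drop: "env c es \<Longrightarrow> good c es \<Longrightarrow> good (drop i c) (drop i es)"
proof (induction c arbitrary: i es)
  case (Cons d c)
  then show ?case by (cases i; elim env_ConsE) (auto split: prod.splits)
qed simp

lemma derI:
  assumes "(\<alpha>s, \<beta>s, n, us) \<in> Rs" "range V \<subseteq> universe M" "map V us = L"
    and "\<And>m ys k cs. (m, ys, k) \<in> set \<alpha>s \<Longrightarrow> cs \<in> tuples k (universe M) \<Longrightarrow> der m (map V ys @ cs)"
    and "\<And>\<beta>. \<beta> \<in> set \<beta>s \<Longrightarrow> sat M I0 V \<beta>"
  shows "der n L"
  using derivableI'[OF assms(1) wf[OF assms(1)] assms(2,4,5)] assms(3) by simp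

lemma exists_fits0:
  assumes "normal v" "env c es"
  obtains V where "range V \<subseteq> universe M" "fits V v es" "map V [0..<width N c] = vec v @ flat es"
proof -
  obtain V where "range V \<subseteq> universe M" "fits V v es"
    using exists_fits[OF assms, of "[]" "[]"] by auto
  with that show ?thesis using assms(2) by (auto simp: fits_def env_def)
qed

lemma exists_fits1:
  assumes "normal v" "env c es"
  obtains V where "range V \<subseteq> universe M" "map V [0..<width N c] = vec v @ flat es"
  using exists_fits0[OF assms] .

lemma complete_literal:
  assumes "{([], [\<psi>], Truth True \<psi> c, [0..<width N c]), ([], [Neg \<psi>], Truth False \<psi> c, [0..<width N c])} \<subseteq> Rs"
    and \<psi>: "horn_beta \<psi>" "free_vars \<psi> \<subseteq> {..<N}" and v: "normal v" "env c es"
  shows "der (Truth (sat M I v \<psi>) \<psi> c) (vec v @ flat es)"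
proof -
  obtain V where V: "range V \<subseteq> universe M" "fits V v es" "map V [0..<width N c] = vec v @ flat es"
    using exists_fits0[OF v] .
  have V\<psi>: "sat M I0 V \<psi> \<longleftrightarrow> sat M I v \<psi>"
    by (rule sat_horn_beta[OF \<psi>(1)]) (use \<psi>(2) fits_D(3)[OF V(2)] in auto)
  have "([], [if sat M I v \<psi> then \<psi> else Neg \<psi>], Truth (sat M I v \<psi>) \<psi> c, [0..<width N c]) \<in> Rs"
    using assms(1) by (cases "sat M I v \<psi>") auto
  then show ?thesis by (rule derI[OF _ V(1,3)]) (use V\<psi> in auto)
qed

lemma complete_prop_rules:
  assumes sub: "prop_rules N bss True \<psi> c \<subseteq> Rs" "prop_rules N bss' False \<psi> c \<subseteq> Rs"
    and v: "normal v" "env c es"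
    and IH: "\<And>bs b \<phi>. bs \<in> set (bss @ bss') \<Longrightarrow> (b, \<phi>) \<in> set bs \<Longrightarrow>
      der (Truth (sat M I v \<phi>) \<phi> c) (vec v @ flat es)"
    and ex: "\<exists>bs\<in>set (if sat M I v \<psi> then bss else bss'). \<forall>(b, \<phi>)\<in>set bs. sat M I v \<phi> = b"
  shows "der (Truth (sat M I v \<psi>) \<psi> c) (vec v @ flat es)"
proof -
  obtain bs where bs: "bs \<in> set (if sat M I v \<psi> then bss else bss')" "\<forall>(b, \<phi>)\<in>set bs. sat M I v \<phi> = b"
    using ex by blast
  obtain V where V: "range V \<subseteq> universe M" "map V [0..<width N c] = vec v @ flat es"
    using exists_fits1[OF v] .
  have "(map (\<lambda>(b, \<phi>). (Truth b \<phi> c, [0..<width N c], 0)) bs, [],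
      Truth (sat M I v \<psi>) \<psi> c, [0..<width N c]) \<in> Rs"
    using sub bs(1) unfolding prop_rules_def Let_def by (cases "sat M I v \<psi>") auto
  then show ?thesis
  proof (rule derI[OF _ V])
    fix m ys k cs
    assume "(m, ys, k) \<in> set (map (\<lambda>(b, \<phi>). (Truth b \<phi> c, [0..<width N c], 0)) bs)" "cs \<in> tuples k (universe M)"
    then obtain b \<phi> where b: "(b, \<phi>) \<in> set bs" "m = Truth b \<phi> c" "map V ys @ cs = vec v @ flat es" using V(2) by auto
    have "bs \<in> set (bss @ bss')" using bs(1) by (auto split: if_splits)
    then show "der m (map V ys @ cs)" using IH[of bs b \<phi>] bs(2) b by auto
  qed simp
qed

lemma complete_quant_rules:
  assumes sub: "quant_rules N b \<psi> x \<phi> c \<subseteq> Rs"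
    and \<psi>: "(sat M I v \<psi> = b) \<longleftrightarrow> (\<exists>a\<in>universe M. sat M I (v(x := a)) \<phi> = b)"
    and v: "normal v" "env c es" and x: "x < N"
    and IH: "\<And>a. a \<in> universe M \<Longrightarrow> der (Truth (sat M I (v(x := a)) \<phi>) \<phi> c) (vec (v(x := a)) @ flat es)"
  shows "der (Truth (sat M I v \<psi>) \<psi> c) (vec v @ flat es)"
proof -
  define n where "n = width N c"
  have r: "([(Truth b \<phi> c, subst N id [x] [n] @ [N..<n], 0)], [], Truth b \<psi> c, [0..<n]) \<in> Rs"
    "([(Truth_Upd (\<not> b) \<phi> c x, [0..<n], 1)], [], Truth (\<not> b) \<psi> c, [0..<n]) \<in> Rs"
    "([(Truth (\<not> b) \<phi> c, subst N id [x] [n] @ [N..<n], 0)], [], Truth_Upd (\<not> b) \<phi> c x, [0..<Suc n]) \<in> Rs"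
    using sub unfolding quant_rules_def Let_def n_def by blast+
  have ex: "\<exists>V. range V \<subseteq> universe M \<and> map V [0..<n] = vec v @ flat es \<and> V n = a \<and>
      map V (subst N id [x] [n] @ [N..<n]) = vec (v(x := a)) @ flat es" if a: "a \<in> universe M" for a
  proof -
    obtain V where V: "range V \<subseteq> universe M" "fits V v es" "map V [n..<n + length [a]] = [a]"
      using exists_fits[OF v, of "[a]" "[]" n] a n_def by auto
    then have "V n = a" by simp
    moreover have "map V [0..<n] = vec v @ flat es" "map V [N..<n] = flat es"
      using V(2) fits_D(2)[OF V(2)] v(2) by (auto simp: fits_def env_def n_def)
    ultimately show ?thesis using V(1) fits_subst[OF V(2), of "[n]" "[x]"]
      by (intro exI[of _ V]) (simp add: assign_single)
  qed
  show ?thesis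
  proof (cases "sat M I v \<psi> = b")
    case True
    then obtain a where a: "a \<in> universe M" "sat M I (v(x := a)) \<phi> = b" using \<psi> by blast
    obtain V where V: "range V \<subseteq> universe M" "map V [0..<n] = vec v @ flat es"
        "map V (subst N id [x] [n] @ [N..<n]) = vec (v(x := a)) @ flat es" using ex[OF a(1)] by blast
    have "der (Truth b \<psi> c) (vec v @ flat es)"
      by (rule derI[OF r(1) V(1,2)]) (use IH[OF a(1)] a(2) V(3) in \<open>auto simp del: map_append\<close>)
    then show ?thesis using True by simp
  next
    case False
    then have f: "sat M I v \<psi> = (\<not> b)" by blast
    have upd: "der (Truth_Upd (\<not> b) \<phi> c x) ((vec v @ flat es) @ [a])" if a: "a \<in> universe M" for a
    proof -
      have sb: "sat M I (v(x := a)) \<phi> = (\<not> b)" using False \<psi> a by blast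
      obtain V where V: "range V \<subseteq> universe M" "map V [0..<n] = vec v @ flat es" "V n = a"
        "map V (subst N id [x] [n] @ [N..<n]) = vec (v(x := a)) @ flat es" using ex[OF a(1)] by blast
      have "map V [0..<Suc n] = (vec v @ flat es) @ [a]" using V(2,3) by simp
      then show ?thesis
        by (rule derI[OF r(3) V(1)]) (use IH[OF a] sb V(4) in \<open>auto simp del: map_append\<close>)
    qed
    obtain V where V: "range V \<subseteq> universe M" "map V [0..<n] = vec v @ flat es"
      unfolding n_def using exists_fits1[OF v] .
    have "der (Truth (\<not> b) \<psi> c) (vec v @ flat es)"
    proof (rule derI[OF r(2) V])
      fix m ys k cs assume m: "(m, ys, k) \<in> set [(Truth_Upd (\<not> b) \<phi> c x, [0..<n], 1)]" "cs \<in> tuples k (universe M)"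
      then obtain a where "cs = [a]" "a \<in> universe M" by (cases cs) (auto simp: tuples_def)
      then show "der m (map V ys @ cs)" using m(1) upd V(2) by simp
    qed simp
    then show ?thesis using f by simp
  qed
qed

lemma complete_rel_rules:
  assumes sub: "rel_rules N R ys c \<subseteq> Rs" and R: "R \<in> fst ` set c"
    and "length ys = rv_arity R" "set ys \<subseteq> {..<N}" "wf_ctx c"
    and good: "good c es" and v: "normal v" "env c es"
  shows "der (Truth (sat M (J c es) v (Rel R ys)) (Rel R ys) c) (vec v @ flat es)"
proof -
  let ?P = "\<lambda>i. i < length c \<and> fst (c ! i) = R"
  define i where "i = (LEAST i. ?P i)"
  have "\<exists>i. ?P i" using R by (metis imageE in_set_conv_nth)
  then have "?P i" unfolding i_def by (rule LeastI_ex)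
  moreover have "\<forall>j<i. fst (c ! j) \<noteq> R"
    using not_less_Least[of _ ?P, folded i_def] \<open>?P i\<close> by auto
  moreover obtain Y xs \<phi> fl where Y: "c ! i = (Y, xs, \<phi>, fl)" by (rule prod_cases4)
  ultimately have i: "i < length c" "c ! i = (R, xs, \<phi>, fl)" "\<forall>j<i. fst (c ! j) \<noteq> R" by auto
  let ?b = "sat M (J c es) v (Rel R ys)"
  have d: "drop i c = (R, xs, \<phi>, fl) # drop (Suc i) c" using i(1,2) by (simp add: Cons_nth_drop_Suc flip: i(2))
  have xs: "distinct xs" "length xs = length ys" "set xs \<subseteq> {..<N}"
    using assms(3,5) i(1,2) nth_mem[OF i(1)] by (fastforce simp: wf_ctx_def)+
  have l: "length es = length c" using v(2) by (simp add: env_def)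
  then have de: "drop i es = es ! i # drop (Suc i) es" using i(1) by (simp add: Cons_nth_drop_Suc)
  have J: "J c es R = J (drop i c) (drop i es) R" using J_lookup[OF v(2) i(1)] i by simp
  have b: "\<not> fl \<Longrightarrow> \<not> ?b" using J by (simp add: d)
  obtain V where V: "range V \<subseteq> universe M" "fits V v es" "map V [0..<width N c] = vec v @ flat es"
    using exists_fits0[OF v] by blast
  have "(if fl then [(Stage ?b (drop i c), stage_args N i xs ys c, 0)] else [],
        [], Truth ?b (Rel R ys) c, [0..<width N c]) \<in> Rs"
    using subsetD[OF sub rel_rulesI[OF i b]] .
  then show ?thesis
  proof (rule derI[OF _ V(1,3)])
    fix m zs k cs
    assume m: "(m, zs, k) \<in> set (if fl then [(Stage ?b (drop i c), stage_args N i xs ys c, 0)] else [])"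
      "cs \<in> tuples k (universe M)"
    let ?e = "assign (es ! i) xs (map V ys)"
    have mm: "map V (stage_args N i xs ys c) = vec ?e @ flat (drop i es)"
      using map_subst[of V "(+) (N * Suc i)" "es ! i" ys xs] fits_drop[OF V(2), of i] i(1) l xs(2) by simp
    from m have fl: "fl" and meq: "m = Stage ?b (drop i c)" "map V zs @ cs = vec ?e @ flat (drop i es)"
      using mm by (auto split: if_splits simp del: map_append)
    have t: "map V ys \<in> tuples (length xs) (universe M)" using V(1) xs(2) by (auto simp: tuples_def)
    have "der (Stage (map V ys \<in> J (drop i c) (drop i es) R) (drop i c)) (vec ?e @ flat (drop i es))"
      using good_drop[OF v(2) good, of i] t fl unfolding d de by simp
    then show "der m (map V zs @ cs)"
      unfolding meq by (simp add: J[symmetric] fits_D(4)[OF V(2) assms(4)] del: map_eq_conv)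
  qed simp
qed

lemma good_Cons: "good ((X, xs, \<phi>, fl) # c) (e # es) \<longleftrightarrow> good c es \<and>
    (fl \<longrightarrow> map e xs \<in> lfp (opr (J c es) e X xs \<phi>) \<and>
      (\<forall>u\<in>tuples (length xs) (universe M).
        der (Stage (u \<in> stage (opr (J c es) e X xs \<phi>) (map e xs)) ((X, xs, \<phi>, True) # c))
          (vec (assign e xs u) @ flat (e # es))))"
  by simp

text \<open>By induction on levels each tuple of the fixed point gives a \<open>good\<close> entry:
  \<open>IH\<close> decides the body over the preceding stage, and this decides the next one. The
  closed stage then refutes all tuples outside the fixed point.\<close>

lemma complete_lfp_rules:
  assumes sub: "lfp_rules N X xs \<phi> us c \<subseteq> Rs"
    and pol: "polarity True X \<phi>" and d: "distinct xs" and len: "length us = length xs"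
    and xs: "set xs \<subseteq> {..<N}" and us: "set us \<subseteq> {..<N}"
    and good: "good c es" and v: "normal v" "env c es"
    and IH: "\<And>fl e w. good ((X, xs, \<phi>, fl) # c) (e # es) \<Longrightarrow> normal e \<Longrightarrow> normal w \<Longrightarrow>
      der (Truth (sat M (J ((X, xs, \<phi>, fl) # c) (e # es)) w \<phi>) \<phi> ((X, xs, \<phi>, fl) # c)) (vec w @ flat (e # es))"
  shows "der (Truth (sat M (J c es) v (Lfp X xs \<phi> us)) (Lfp X xs \<phi> us) c) (vec v @ flat es)"
proof -
  define n where "n = width N c"
  define k where "k = length xs"
  define cf where "cf fl = (X, xs, \<phi>, fl) # c" for fl
  define U where "U = subst N id xs us"
  define Z where "Z = subst N id xs [n..<n+k]"
  define S where "S = subst N id xs [n+k..<n+k+k]"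
  define E where "E = [N..<n]"
  note sub' = sub[unfolded lfp_rules_def Let_def, folded n_def k_def, folded U_def Z_def S_def E_def cf_def]
  have r1: "([(Stage True (cf True), U @ U @ E, 0)], [], Truth True (Lfp X xs \<phi> us) c, [0..<n]) \<in> Rs"
    using sub' by blast
  have r2: "((if fl then [(Stage False (cf True), U @ Z @ E, 0)] else []) @ [(Closed (cf fl), Z @ E, k)], [],
        Truth False (Lfp X xs \<phi> us) c, [0..<n]) \<in> Rs" for fl
    using sub' by blast
  have r3: "([(Truth False \<phi> (cf fl), Z @ [0..<n], 0)], [], Closed (cf fl), [0..<n+k]) \<in> Rs" for fl
    using sub' by blast
  have r4: "([(Stage True (cf True), Z @ [0..<n], 0)], [], Closed (cf True), [0..<n+k]) \<in> Rs"
    using sub' by blast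
  have r5: "((if fl then [(Stage False (cf True), [0..<N] @ S @ E, 0)] else []) @
          [(Truth True \<phi> (cf fl), [0..<N] @ S @ E, 0), (Truth b \<phi> (cf fl), Z @ S @ E, 0)], [],
        Stage b (cf True), Z @ [0..<n]) \<in> Rs" for fl b
    by (rule subsetD[OF sub'], rule UnI2, rule image_eqI[of _ _ "(fl, b)"]) simp_all
  define F where "F = opr (J c es) v X xs \<phi>"
  have mono: "mono F" unfolding F_def using mono_lfp_op[OF pol] .
  have fin_F: "finite (tuples k (universe M))" "\<And>S. F S \<subseteq> tuples k (universe M)"
    using finite_tuples[OF fin] by (auto simp: F_def in_opr k_def)
  have lfp_tuples: "lfp F \<subseteq> tuples k (universe M)" using fin_F(2) lfp_unfold[OF mono] by blast
  let ?A = "\<lambda>w. assign v xs w"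
  have F_assign: "opr (J c es) (?A w) X xs \<phi> = F" if "w \<in> tuples k (universe M)" for w
    using that by (simp add: F_def lfp_op_assign tuples_def k_def)
  have ma: "map (?A w) xs = w" if "w \<in> tuples k (universe M)" for w
    using that d by (intro map_assign) (auto simp: tuples_def k_def)
  have aa: "assign (?A w) xs u = ?A u" if "w \<in> tuples k (universe M)" "u \<in> tuples k (universe M)" for w u
    using that by (intro assign_assign) (auto simp: tuples_def k_def)
  have nrm: "normal (?A w)" if "w \<in> tuples k (universe M)" for w
    using that v(1) by (intro normal_assign[OF _ xs]) (auto simp: tuples_def)
  have goodT: "good (cf True) (?A w # es) \<longleftrightarrow> w \<in> lfp F \<and>
      (\<forall>u\<in>tuples k (universe M). der (Stage (u \<in> stage F w) (cf True)) (vec (?A u) @ flat (?A w # es)))"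
    if "w \<in> tuples k (universe M)" for w
    unfolding cf_def good_Cons F_assign[OF that] ma[OF that] k_def[symmetric] using good aa[OF that] by simp
  have goodF: "good (cf False) (?A w # es)" for w unfolding cf_def good_Cons using good by simp
  have Jcf: "J (cf fl) (?A w # es) = (J c es)(X := (F ^^ (if fl then level F w else 0)) {})"
    if "w \<in> tuples k (universe M)" for fl w
    unfolding cf_def J_Cons F_assign[OF that] ma[OF that] ..
  have vals: "\<exists>V. range V \<subseteq> universe M \<and> map V [0..<n] = vec w @ flat es \<and> map V [0..<N] = vec w \<and>
      map V E = flat es \<and> map V [n..<n+k] = zs \<and> map V U = vec (assign w xs (map w us)) \<and>
      map V Z = vec (assign w xs zs) \<and> map V S = vec (assign w xs ss)"
    if w: "normal w" "zs \<in> tuples k (universe M)" "ss \<in> tuples k (universe M)" for w zs ss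
  proof -
    have l: "length zs = k" "length ss = k" "set zs \<subseteq> universe M" "set ss \<subseteq> universe M"
      using w by (auto simp: tuples_def)
    obtain V where V: "range V \<subseteq> universe M" "fits V w es" "map V [n..<n + length zs] = zs"
      "map V [n + length zs..<n + length zs + length ss] = ss"
      using exists_fits[OF w(1) v(2) l(3,4) n_def] .
    then show ?thesis
      using fits_subst[OF V(2), of us xs] fits_subst[OF V(2), of "[n..<n+k]" xs]
        fits_subst[OF V(2), of "[n+k..<n+k+k]" xs] fits_D[OF V(2)] fits_D(4)[OF V(2) us] l v(2) len
      unfolding U_def Z_def S_def E_def fits_def
      by (intro exI[of _ V]) (simp add: k_def n_def env_def)
  qed
  have stages: "w \<in> lfp F \<Longrightarrow> good (cf True) (?A w # es)" for w
  proof (induction "level F w" arbitrary: w rule: less_induct)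
    case less
    have w: "w \<in> tuples k (universe M)" using less.prems lfp_tuples by blast
    obtain i where i: "level F w = Suc i" "w \<notin> (F ^^ i) {}" "w \<in> F ((F ^^ i) {})"
        "i = 0 \<or> (\<exists>s\<in>lfp F. level F s = i)"
      using lfp_new[OF mono fin_F less.prems] by metis
    \<comment> \<open>The preceding iterate, uniformly described by a flag and a tuple
      \<open>s\<close>. For the empty iterate \<open>s\<close> is a mere placeholder, here
      \<open>w\<close>.\<close>
    have "\<exists>fl s. s \<in> tuples k (universe M) \<and> good (cf fl) (?A s # es) \<and> i = (if fl then level F s else 0)"
      using i(4)
    proof
      assume "i = 0"
      then show ?thesis using goodF[of w] w by (intro exI[of _ False] exI[of _ w]) simp
    next
      assume "\<exists>s\<in>lfp F. level F s = i"
      then obtain s where s: "s \<in> lfp F" "level F s = i" by blast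
      then have "good (cf True) (?A s # es)" using less.hyps i(1) by auto
      then show ?thesis using s lfp_tuples by (intro exI[of _ True] exI[of _ s]) auto
    qed
    then obtain fl s where s: "s \<in> tuples k (universe M)" "good (cf fl) (?A s # es)" "i = (if fl then level F s else 0)"
      by blast
    let ?Y = "(F ^^ i) {}"
    have Js: "J (cf fl) (?A s # es) = (J c es)(X := ?Y)" unfolding Jcf[OF s(1)] s(3) ..
    have tr: "der (Truth (u \<in> F ?Y) \<phi> (cf fl)) (vec (?A u) @ flat (?A s # es))"
      if u: "u \<in> tuples k (universe M)" for u
    proof -
      have "sat M ((J c es)(X := ?Y)) (?A u) \<phi> \<longleftrightarrow> u \<in> F ?Y" unfolding F_def in_opr using u by (simp add: k_def)
      then show ?thesis using IH[OF s(2)[unfolded cf_def] nrm[OF s(1)] nrm[OF u]] Js unfolding cf_def by simp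
    qed
    have st: "stage F w = F ?Y" using level_new(2)[OF mono i(2,3)] .
    have "der (Stage (u \<in> stage F w) (cf True)) (vec (?A u) @ flat (?A w # es))"
      if u: "u \<in> tuples k (universe M)" for u
    proof -
      obtain V where V: "range V \<subseteq> universe M" "map V [0..<n] = vec (?A w) @ flat es" "map V [0..<N] = vec (?A w)"
        "map V E = flat es" "map V Z = vec (?A u)" "map V S = vec (?A s)"
        using vals[OF nrm[OF w] u s(1)] unfolding aa[OF w u] aa[OF w s(1)] by blast
      show ?thesis
      proof (rule derI[OF r5[of fl]])
        fix m ys j cs
        assume m: "(m, ys, j) \<in> set ((if fl then [(Stage False (cf True), [0..<N] @ S @ E, 0)] else []) @
          [(Truth True \<phi> (cf fl), [0..<N] @ S @ E, 0), (Truth (u \<in> stage F w) \<phi> (cf fl), Z @ S @ E, 0)])"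
          "cs \<in> tuples j (universe M)"
        then have "cs = []" by (auto split: if_splits)
        from m(1) consider "fl" "(m, ys) = (Stage False (cf True), [0..<N] @ S @ E)"
          | "(m, ys) = (Truth True \<phi> (cf fl), [0..<N] @ S @ E)"
          | "(m, ys) = (Truth (u \<in> stage F w) \<phi> (cf fl), Z @ S @ E)"
          by (auto split: if_splits)
        then show "der m (map V ys @ cs)"
        proof cases
          case 1
          then have "w \<notin> stage F s" using i(2) s(3) by (simp add: stage_def)
          then have "der (Stage False (cf True)) (vec (?A w) @ flat (?A s # es))"
            using s(2) goodT[OF s(1)] 1(1) w by (metis (full_types))
          then show ?thesis using 1(2) V \<open>cs = []\<close> by simp
        next
          case 2
          have "der (Truth True \<phi> (cf fl)) (vec (?A w) @ flat (?A s # es))" using tr[OF w] i(3) by simp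
          then show ?thesis using 2 V \<open>cs = []\<close> by simp
        next
          case 3
          then show ?thesis using tr[OF u] st V \<open>cs = []\<close> by simp
        qed
      qed (use V in simp_all)
    qed
    then show ?case using goodT[OF w] less.prems by blast
  qed
  let ?u = "map v us"
  have u: "?u \<in> tuples k (universe M)" using v(1) len by (auto simp: tuples_def k_def normal_def)
  have sat: "sat M (J c es) v (Lfp X xs \<phi> us) \<longleftrightarrow> ?u \<in> lfp F" unfolding sat_Lfp F_def ..
  show ?thesis
  proof (cases "?u \<in> lfp F")
    case True
    then obtain i where i: "level F ?u = Suc i" "?u \<in> F ((F ^^ i) {})" using lfp_new[OF mono fin_F True] by metis
    then have "?u \<in> stage F ?u" by (simp add: stage_def)
    then have dr: "der (Stage True (cf True)) (vec (?A ?u) @ flat (?A ?u # es))"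
      using stages[OF True] goodT[OF u] u by (metis (full_types))
    obtain V where V: "range V \<subseteq> universe M" "map V [0..<n] = vec v @ flat es" "map V E = flat es" "map V U = vec (?A ?u)"
      using vals[OF v(1) u u] by blast
    have "der (Truth True (Lfp X xs \<phi> us) c) (vec v @ flat es)"
      by (rule derI[OF r1 V(1,2)]) (use dr V in auto)
    then show ?thesis using sat True by simp
  next
    case False
    obtain i where i: "F ((F ^^ i) {}) \<subseteq> (F ^^ i) {}" "i = 0 \<or> (\<exists>s\<in>lfp F. level F s = i)"
      using lfp_closed_stage[OF mono fin_F] by metis
    have "\<exists>fl s. s \<in> tuples k (universe M) \<and> good (cf fl) (?A s # es) \<and> i = (if fl then level F s else 0)"
      using i(2)
    proof
      assume "i = 0"
      then show ?thesis using goodF[of ?u] u by (intro exI[of _ False] exI[of _ ?u]) simp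
    next
      assume "\<exists>s\<in>lfp F. level F s = i"
      then obtain s where s: "s \<in> lfp F" "level F s = i" by blast
      then show ?thesis using stages[OF s(1)] lfp_tuples by (intro exI[of _ True] exI[of _ s]) auto
    qed
    then obtain fl s where s: "s \<in> tuples k (universe M)" "good (cf fl) (?A s # es)" "i = (if fl then level F s else 0)"
      by blast
    let ?Y = "(F ^^ i) {}"
    have Js: "J (cf fl) (?A s # es) = (J c es)(X := ?Y)" unfolding Jcf[OF s(1)] s(3) ..
    have Y: "?Y = lfp F" using closed_iter[OF mono i(1)] .
    have closed: "der (Closed (cf fl)) ((vec (?A s) @ flat es) @ z)" if z: "z \<in> tuples k (universe M)" for z
    proof -
      obtain V where V: "range V \<subseteq> universe M" "map V [0..<n] = vec (?A s) @ flat es" "map V [n..<n+k] = z"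
          "map V Z = vec (?A z)"
        using vals[OF nrm[OF s(1)] z z] unfolding aa[OF s(1) z] by blast
      have h: "map V [0..<n+k] = (vec (?A s) @ flat es) @ z"
        using map_upt_append[of n "n + k" V] V by simp
      show ?thesis
      \<comment> \<open>Members of the iterate are handled by the rule with premise
        \<open>Stage\<close>, all other tuples by falsity of the body, since nothing enters after a
        closed iterate.\<close>
      proof (cases "z \<in> ?Y \<and> fl")
        case True
        then have "z \<in> stage F s" using s(3) True by (simp add: stage_def)
        then have "der (Stage True (cf True)) (vec (?A z) @ flat (?A s # es))"
          using s(2) goodT[OF s(1)] True z by (metis (full_types))
        then have "der (Closed (cf True)) ((vec (?A s) @ flat es) @ z)"
          by (intro derI[OF r4 V(1) h]) (use V in auto)
        then show ?thesis using True by simp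
      next
        case False
        then have "z \<notin> ?Y" using s(3) by (cases fl) auto
        then have "z \<notin> F ?Y" using i(1) by blast
        then have "\<not> sat M ((J c es)(X := ?Y)) (?A z) \<phi>" unfolding F_def in_opr using z by (simp add: k_def)
        then have "der (Truth False \<phi> (cf fl)) (vec (?A z) @ flat (?A s # es))"
          using IH[OF s(2)[unfolded cf_def] nrm[OF s(1)] nrm[OF z]] Js unfolding cf_def by simp
        then show ?thesis
          by (intro derI[OF r3 V(1) h]) (use V in auto)
      qed
    qed
    obtain V where V: "range V \<subseteq> universe M" "map V [0..<n] = vec v @ flat es" "map V E = flat es" "map V U = vec (?A ?u)"
        "map V Z = vec (?A s)"
      using vals[OF v(1) s(1) s(1)] by blast
    have "der (Truth False (Lfp X xs \<phi> us) c) (vec v @ flat es)"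
    proof (rule derI[OF r2[of fl] V(1,2)])
      fix m ys j cs
      assume m: "(m, ys, j) \<in> set ((if fl then [(Stage False (cf True), U @ Z @ E, 0)] else []) @ [(Closed (cf fl), Z @ E, k)])"
        "cs \<in> tuples j (universe M)"
      then consider "fl" "(m, ys, j) = (Stage False (cf True), U @ Z @ E, 0)" | "(m, ys, j) = (Closed (cf fl), Z @ E, k)"
        by (auto split: if_splits)
      then show "der m (map V ys @ cs)"
      proof cases
        case 1
        have "?u \<notin> stage F s" using False Y s(3) 1(1) by (simp add: stage_def)
        then have "der (Stage False (cf True)) (vec (?A ?u) @ flat (?A s # es))"
          using s(2) goodT[OF s(1)] 1(1) u by (metis (full_types))
        then show ?thesis using 1(2) V m(2) by simp
      next
        case 2
        then show ?thesis using closed m(2) V by simp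
      qed
    qed simp
    then show ?thesis using sat False by simp
  qed
qed

text \<open>The context is arbitrary because the body of a fixed point lives in a longer one. It
  binds all free relation variables, so that every atom has an entry to refer to.\<close>

lemma complete_prog:
  assumes "prog N \<phi> c \<subseteq> Rs" "wf_fm \<sigma> ar \<phi>" "all_vars \<phi> \<subseteq> {..<N}" "no_so_quantifiers \<phi>" "wf_ctx c"
    "free_rvars \<phi> \<subseteq> fst ` set c" "good c es" "normal v" "env c es"
  shows "der (Truth (sat M (J c es) v \<phi>) \<phi> c) (vec v @ flat es)"
  using assms
proof (induction \<phi> arbitrary: c es v)
  case Bot
  obtain V where V: "range V \<subseteq> universe M" "map V [0..<width N c] = vec v @ flat es"
    using exists_fits1[OF Bot.prems(8,9)] .
  show ?case by (rule derI[OF _ V]) (use Bot.prems in auto)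
next
  case (Pred P ys)
  then show ?case by (intro complete_literal) (auto simp: horn_beta_def)
next
  case (Eq x y)
  then show ?case by (intro complete_literal) (auto simp: horn_beta_def)
next
  case (Rel R ys)
  then show ?case using complete_rel_rules[of R ys c es v] by simp
next
  case (Neg \<phi>)
  show ?case
    by (rule complete_prop_rules[of "[[(False, \<phi>)]]" _ _ "[[(True, \<phi>)]]"]) (use Neg in auto)
next
  case (And \<phi> \<psi>)
  show ?case
    by (rule complete_prop_rules[of "[[(True, \<phi>), (True, \<psi>)]]" _ _ "[[(False, \<phi>)], [(False, \<psi>)]]"]) (use And in auto)
next
  case (Or \<phi> \<psi>)
  show ?case
    by (rule complete_prop_rules[of "[[(True, \<phi>)], [(True, \<psi>)]]" _ _ "[[(False, \<phi>), (False, \<psi>)]]"]) (use Or in auto)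
next
  case (Imp \<phi> \<psi>)
  show ?case
    by (rule complete_prop_rules[of "[[(False, \<phi>)], [(True, \<psi>)]]" _ _ "[[(True, \<phi>), (False, \<psi>)]]"]) (use Imp in auto)
next
  case (Ex x \<phi>)
  show ?case
  proof (rule complete_quant_rules)
    show "quant_rules N True (Ex x \<phi>) x \<phi> c \<subseteq> Rs" using Ex.prems by simp
    fix a assume "a \<in> universe M"
    then show "der (Truth (sat M (J c es) (v(x := a)) \<phi>) \<phi> c) (vec (v(x := a)) @ flat es)"
      using Ex.prems by (intro Ex.IH normal_upd) auto
  qed (use Ex.prems in auto)
next
  case (All x \<phi>)
  show ?case
  proof (rule complete_quant_rules)
    show "quant_rules N False (All x \<phi>) x \<phi> c \<subseteq> Rs" using All.prems by simp
    fix a assume "a \<in> universe M"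
    then show "der (Truth (sat M (J c es) (v(x := a)) \<phi>) \<phi> c) (vec (v(x := a)) @ flat es)"
      using All.prems by (intro All.IH normal_upd) auto
  qed (use All.prems in auto)
next
  case (Lfp X xs \<phi> us)
  show ?case
  proof (rule complete_lfp_rules)
    fix fl e w assume a: "good ((X, xs, \<phi>, fl) # c) (e # es)" "normal e" "normal w"
    have "prog N \<phi> ((X, xs, \<phi>, fl) # c) \<subseteq> Rs" using Lfp.prems(1) by (cases fl) auto
    moreover have "wf_ctx ((X, xs, \<phi>, fl) # c)" using Lfp.prems by (auto simp: wf_ctx_def)
    ultimately show "der (Truth (sat M (J ((X, xs, \<phi>, fl) # c) (e # es)) w \<phi>) \<phi> ((X, xs, \<phi>, fl) # c)) (vec w @ flat (e # es))"
      using Lfp.prems a by (intro Lfp.IH) (auto simp: env_Cons simp del: good.simps)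
  qed (use Lfp.prems in auto)
qed auto

end

lemma lfp_to_program:
  fixes \<psi> :: "'p fm"
  assumes "\<psi> \<in> fo_lfp \<sigma> ar"
  obtains Rs :: "('p name, 'p) rule set" and far
  where "finite Rs" "\<forall>r\<in>Rs. wf_rule \<sigma> ar far r" "far Goal = 0"
    "\<forall>M :: ('p, 'a) struct. finite_structure \<sigma> ar M \<longrightarrow> (models M \<psi> \<longleftrightarrow> \<not> derivable M Rs Goal [])"
proof -
  have \<psi>: "wf_fm \<sigma> ar \<psi>" "free_rvars \<psi> = {}" "no_so_quantifiers \<psi>" using assms by (auto simp: fo_lfp_def sentence_def)
  obtain N where "\<forall>x\<in>all_vars \<psi>. x < N" using finite_all_vars[of \<psi>] unfolding finite_nat_set_iff_bounded by blast
  then have N: "all_vars \<psi> \<subseteq> {..<N}" by blast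
  \<comment> \<open>Deriving the goal means refuting the sentence; the variables of the premise do
    not occur in the head, so any assignment will do.\<close>
  define gr :: "('p name, 'p) rule" where "gr = ([(Truth False \<psi> [], [0..<N], 0)], [], Goal, [])"
  define Rs where "Rs = insert gr (prog N \<psi> [])"
  have wf: "wf_rule \<sigma> ar (name_arity N) r" if "r \<in> Rs" for r
  proof (cases "r = gr")
    case True
    then show ?thesis by (simp add: gr_def wf_rule_def)
  next
    case False
    then show ?thesis using that wf_prog[OF \<psi>(1)] unfolding Rs_def by blast
  qed
  have "models M \<psi> \<longleftrightarrow> \<not> derivable M Rs Goal []" if fs: "finite_structure \<sigma> ar M" for M :: "('p, 'a) struct"
  proof
    assume m: "models M \<psi>"
    obtain a where a: "a \<in> universe M" using fs by (auto simp: finite_structure_def)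
    interpret lfp_evaluation M "\<lambda>_. {}" "\<lambda>_. a" N
      using fs a by unfold_locales (auto simp: finite_structure_def)
    \<comment> \<open>With \<open>G = False\<close> soundness says that the goal is not derivable;
      the rule \<open>gr\<close> is sound in this sense because the sentence is true.\<close>
    have "sound False gr" unfolding sound_def gr_def prod.case
    proof (intro allI impI)
      fix V :: "var \<Rightarrow> 'a" assume V: "range V \<subseteq> universe M"
        "premises_hold False V [(Truth False \<psi> [], [0..<N], 0)]"
      let ?v = "\<lambda>i. if i < N then V i else a"
      have v: "normal ?v" using V(1) a by (auto simp: normal_def)
      have vv: "map V [0..<N] = vec ?v @ flat []" by (simp add: vec_def flat_def)
      have "holds False (Truth False \<psi> []) (map V [0..<N])" using premise[OF V(2)] by simp
      then have "sat M (\<lambda>_. {}) ?v \<psi> = False" unfolding holds.simps vv using v by (auto simp: env_def)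
      moreover have "sat M (\<lambda>_. {}) ?v \<psi>" using m v by (auto simp: models_def normal_def)
      ultimately show "holds False Goal (map V [])" by simp
    qed
    moreover have "sound False r" if "r \<in> prog N \<psi> []" for r
      using sound_prog[OF \<psi>(1) N _ that] by (simp add: wf_ctx_def)
    ultimately have "\<And>r. r \<in> Rs \<Longrightarrow> sound False r" by (auto simp: Rs_def)
    from derivable_holds[OF this, of Rs Goal "[]"] show "\<not> derivable M Rs Goal []" by auto
  next
    assume nd: "\<not> derivable M Rs Goal []"
    show "models M \<psi>" unfolding models_def
    proof (intro allI impI)
      fix I and v :: "var \<Rightarrow> 'a" assume v: "range v \<subseteq> universe M"
      \<comment> \<open>The base interpretation and the default assignment are the very
        \<open>I\<close> and \<open>v\<close> under test, so a failure there would derive the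
        goal.\<close>
      interpret lfp_completeness M I v N Rs \<sigma> ar
        using fs v wf by unfold_locales (auto simp: finite_structure_def)
      have "prog N \<psi> [] \<subseteq> Rs" by (auto simp: Rs_def)
      then have d: "derivable M Rs (Truth (sat M I v \<psi>) \<psi> []) (vec v @ flat [])"
        using complete_prog[of \<psi> "[]" "[]" v] \<psi> N v by (simp add: wf_ctx_def env_def normal_def)
      show "sat M I v \<psi>"
      proof (rule ccontr)
        assume "\<not> sat M I v \<psi>"
        with d have "derivable M Rs (Truth False \<psi> []) (map v [0..<N])" by (simp add: vec_def flat_def)
        then have "derivable M Rs Goal []"
          by (intro derI[of "[(Truth False \<psi> [], [0..<N], 0)]" "[]" Goal "[]" v]) (use v in \<open>auto simp: Rs_def gr_def\<close>)
        with nd show False by blast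
      qed
    qed
  qed
  moreover have "finite Rs" by (simp add: Rs_def finite_prog)
  ultimately show thesis using wf by (intro that[of Rs "name_arity N"]) simp_all
qed

section \<open>From programs to least fixed points\<close>

lemma sat_conjs_Eq:
  "length xs = length ys \<Longrightarrow> sat M I v (conjs (map2 Eq xs ys)) \<longleftrightarrow> map v xs = map v ys"
  by (auto simp: sat_conjs list_eq_iff_nth_eq set_zip)


text \<open>
  One relation variable simulates all relations of a program: the name is encoded by a tuple of
  copies of two distinct elements \<open>a\<close> and \<open>b\<close>, and \<open>a\<close> also pads the \<open>k\<close> arguments to length \<open>m\<close>.
\<close>

definition encode :: "'v \<Rightarrow> 'v \<Rightarrow> 'n list \<Rightarrow> nat \<Rightarrow> 'n \<Rightarrow> nat \<Rightarrow> 'v list \<Rightarrow> 'v list" where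
  "encode a b nl m n k us = map (\<lambda>n'. if n' = n then b else a) nl @ replicate (m - k) a @ us"

lemma map_encode: "map f (encode a b nl m n k us) = encode (f a) (f b) nl m n k (map f us)"
  by (simp add: encode_def)

lemma encode_append: "encode a b nl m n k us @ zs = encode a b nl m n k (us @ zs)"
  by (simp add: encode_def)

text \<open>The first part has \<open>b\<close> exactly at the occurrences of the name, so it
  determines the name, hence the arity and the amount of padding, and what remains is the
  tuple.\<close>

lemma encode_inject:
  assumes "encode a b nl m n (length us) us = encode a b nl m n' (length us') us'" "a \<noteq> b" "n \<in> set nl"
    "length us \<le> m" "length us' \<le> m" "n = n' \<Longrightarrow> length us = length us'"
  shows "n = n' \<and> us = us'"
proof -
  have e: "map (\<lambda>x. if x = n then b else a) nl = map (\<lambda>x. if x = n' then b else a) nl"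
    "replicate (m - length us) a @ us = replicate (m - length us') a @ us'"
    using assms(1) by (simp_all add: encode_def)
  from e(1) assms(2,3) have "n = n'" by (auto simp: map_eq_conv split: if_splits)
  with e(2) assms(6) show ?thesis by simp
qed

text \<open>One application of the operator is one simultaneous firing of all rules on coded tuples.
  The variables \<open>K\<close> and \<open>Suc K\<close> are parameters that hold two distinct
  elements for the coding, so the sentence is false on one-element structures.\<close>

lemma program_to_lfp:
  fixes Rs :: "('n, 'p) rule set"
  assumes fin: "finite Rs" and wf': "\<forall>r\<in>Rs. wf_rule \<sigma> ar far r" and g: "far g = 0"
  obtains \<psi> where "\<psi> \<in> fo_lfp \<sigma> ar" "\<forall>M :: ('p, 'a) struct. universe M \<noteq> {} \<longrightarrow>
    (models M \<psi> \<longleftrightarrow> (\<exists>a\<in>universe M. \<exists>b\<in>universe M. a \<noteq> b) \<and> \<not> derivable M Rs g [])"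
proof -
  have wf: "wf_rule \<sigma> ar far r" if "r \<in> Rs" for r using wf' that by blast
  obtain K where K: "\<And>r. r \<in> Rs \<Longrightarrow> rule_vars r \<subseteq> {..<K}" using rules_bounded[OF fin] by blast
  define ns where "ns = insert g (\<Union>r\<in>Rs. rule_names r)"
  have "finite ns" using fin finite_rule_names by (auto simp: ns_def)
  obtain nl where nl: "set nl = ns" using \<open>finite ns\<close> finite_list by blast
  obtain rl where rl: "set rl = Rs" using fin finite_list by blast
  \<comment> \<open>The largest arity: shorter tuples are padded to it, so that all codes have the
    same length \<open>B\<close>.\<close>
  define A where "A = Max (far ` ns)"
  have A: "far n \<le> A" if "n \<in> ns" for n using that \<open>finite ns\<close> by (simp add: A_def)
  define B where "B = length nl + A"
  \<comment> \<open>Layout of variables: those of the rules below \<open>K\<close>, the two coding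
    elements at \<open>K\<close> and \<open>Suc K\<close>, then the tuple of the fixed point, and
    from \<open>W\<close> on those quantified in premises.\<close>
  define W where "W = K + 2 + B"
  define X where "X = RVar 0 B"
  define xs where "xs = [K+2..<W]"
  define enc where "enc n us = encode K (Suc K) nl A n (far n) us" for n us
  define al :: "'n \<times> var list \<times> nat \<Rightarrow> 'p fm" where
    "al = (\<lambda>(m, ys, k). alls [W..<W+k] (Rel X (enc m ys @ [W..<W+k])))"
  \<comment> \<open>Some values of the variables of the rule make its premises true and its coded
    head equal to \<open>xs\<close>. The existential block is a negated \<open>alls\<close>;
    \<open>body\<close> expresses the disjunction over all rules in the same manner.\<close>
  define rf :: "('n, 'p) rule \<Rightarrow> 'p fm" where
    "rf = (\<lambda>(\<alpha>s, \<beta>s, n, us). Neg (alls [0..<K] (Neg (conjs (conjs (map2 Eq xs (enc n us)) # map al \<alpha>s @ \<beta>s)))))"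
  define body where "body = Neg (conjs (map (\<lambda>r. Neg (rf r)) rl))"
  define \<psi> where "\<psi> = Ex K (Ex (Suc K) (And (Neg (Eq K (Suc K))) (Neg (Lfp X xs body (enc g [])))))"
  have gn: "g \<in> ns" by (simp add: ns_def)
  have len_enc: "length (enc n us) + k = B" if "n \<in> ns" "length us + k = far n" for n us k
    using A[OF that(1)] that(2) by (simp add: enc_def encode_def B_def)
  have len_xs: "length xs = B" unfolding xs_def W_def length_upt by arith
  have set_enc: "set (enc n us) \<subseteq> {K, Suc K} \<union> set us" for n us by (auto simp: enc_def encode_def)
  have "rule_names r \<subseteq> ns" if "r \<in> Rs" for r using that by (auto simp: ns_def)
  note rule = wf_rule_bounded[OF wf K this]
  have dz: "set (enc m ys) \<inter> set [W..<W+k] = {}" if "set ys \<subseteq> {..<K}" for m ys k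
  proof -
    have "x < W" if "x \<in> set (enc m ys)" for x
      using set_enc[of m ys] that \<open>set ys \<subseteq> {..<K}\<close> by (fastforce simp: W_def)
    then show ?thesis by (fastforce dest: leD)
  qed
  have al: "wf_fm \<sigma> ar (al (m, ys, k))" "free_vars (al (m, ys, k)) \<subseteq> {..<K+2}" "free_rvars (al (m, ys, k)) \<subseteq> {X}"
      "no_so_quantifiers (al (m, ys, k))" "polarity True X (al (m, ys, k))"
    if "set ys \<subseteq> {..<K}" "length ys + k = far m" "m \<in> ns" for m ys k
  proof -
    show "wf_fm \<sigma> ar (al (m, ys, k))" using len_enc[OF that(3,2)] by (simp add: al_def alls_simps X_def)
    show "free_vars (al (m, ys, k)) \<subseteq> {..<K+2}" using set_enc[of m ys] that(1) by (fastforce simp: al_def alls_simps)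
  qed (simp_all add: al_def alls_simps)
  have rf: "wf_fm \<sigma> ar (rf r) \<and> free_vars (rf r) \<subseteq> {K, Suc K} \<union> set xs \<and> free_rvars (rf r) \<subseteq> {X} \<and>
      no_so_quantifiers (rf r) \<and> polarity True X (rf r)" if "r \<in> Rs" for r
  proof -
    obtain \<alpha>s \<beta>s n us where r: "r = (\<alpha>s, \<beta>s, n, us)" by (cases r)
    note ru = rule[OF that[unfolded r] that[unfolded r] that[unfolded r]]
    have eq: "wf_fm \<sigma> ar (conjs (map2 Eq xs (enc n us)))" "free_rvars (conjs (map2 Eq xs (enc n us))) = {}"
        "no_so_quantifiers (conjs (map2 Eq xs (enc n us)))" "polarity b X (conjs (map2 Eq xs (enc n us)))"
      for b by (auto simp: wf_conjs free_rvars_conjs no_so_conjs polarity_conjs)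
    have "free_vars (conjs (map2 Eq xs (enc n us))) \<subseteq> set xs \<union> set (enc n us)"
      by (auto simp: free_vars_conjs dest: set_zip_leftD set_zip_rightD)
    also have "\<dots> \<subseteq> {K, Suc K} \<union> set xs \<union> {..<K}" using set_enc[of n us] ru(3) by blast
    finally have eqf: "free_vars (conjs (map2 Eq xs (enc n us))) \<subseteq> {K, Suc K} \<union> set xs \<union> {..<K}" .
    have "wf_fm \<sigma> ar (al \<alpha>) \<and> free_vars (al \<alpha>) \<subseteq> {..<K+2} \<and> free_rvars (al \<alpha>) \<subseteq> {X} \<and>
        no_so_quantifiers (al \<alpha>) \<and> polarity True X (al \<alpha>)" if "\<alpha> \<in> set \<alpha>s" for \<alpha>
    proof -
      obtain m ys k where \<alpha>: "\<alpha> = (m, ys, k)" by (cases \<alpha>)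
      from that ru(1) have "set ys \<subseteq> {..<K}" "length ys + k = far m" "m \<in> ns" by (auto simp: \<alpha>)
      from al[OF this] show ?thesis unfolding \<alpha> by blast
    qed
    moreover have "wf_fm \<sigma> ar \<beta> \<and> free_vars \<beta> \<subseteq> {..<K} \<and> free_rvars \<beta> = {} \<and> no_so_quantifiers \<beta> \<and> polarity True X \<beta>"
      if "\<beta> \<in> set \<beta>s" for \<beta> using ru(2) that horn_beta_simps by blast
    ultimately have C: "wf_fm \<sigma> ar \<chi> \<and> free_vars \<chi> \<subseteq> {K, Suc K} \<union> set xs \<union> {..<K} \<and> free_rvars \<chi> \<subseteq> {X} \<and>
        no_so_quantifiers \<chi> \<and> polarity True X \<chi>" if "\<chi> \<in> set (conjs (map2 Eq xs (enc n us)) # map al \<alpha>s @ \<beta>s)" for \<chi>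
      using that eq eqf by (fastforce simp: less_Suc_eq)
    let ?Cs = "conjs (map2 Eq xs (enc n us)) # map al \<alpha>s @ \<beta>s"
    have "wf_fm \<sigma> ar (conjs ?Cs)" "no_so_quantifiers (conjs ?Cs)" "polarity True X (conjs ?Cs)"
      unfolding wf_conjs no_so_conjs polarity_conjs using C by blast+
    moreover have "free_vars (conjs ?Cs) \<subseteq> {K, Suc K} \<union> set xs \<union> {..<K}" "free_rvars (conjs ?Cs) \<subseteq> {X}"
      unfolding free_vars_conjs free_rvars_conjs by (rule UN_least, use C in blast)+
    ultimately show ?thesis unfolding r rf_def prod.case by (auto simp: alls_simps)
  qed
  have body: "wf_fm \<sigma> ar body" "free_vars body \<subseteq> {K, Suc K} \<union> set xs" "free_rvars body \<subseteq> {X}"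
      "no_so_quantifiers body" "polarity True X body"
    using rf rl unfolding body_def
    by (auto simp: wf_conjs free_vars_conjs free_rvars_conjs no_so_conjs polarity_conjs) blast+
  have "wf_fm \<sigma> ar \<psi>" using body len_xs len_enc[OF gn, of "[]" 0] g by (simp add: \<psi>_def X_def xs_def)
  moreover have "free_vars \<psi> = {}" "free_rvars \<psi> = {}" "no_so_quantifiers \<psi>"
    using body set_enc[of g "[]"] by (auto simp: \<psi>_def)
  ultimately have "\<psi> \<in> fo_lfp \<sigma> ar" by (simp add: fo_lfp_def sentence_def)
  moreover have "models M \<psi> \<longleftrightarrow> (\<exists>a\<in>universe M. \<exists>b\<in>universe M. a \<noteq> b) \<and> \<not> derivable M Rs g []"
    if ne: "universe M \<noteq> {}" for M :: "('p, 'a) struct"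
  proof -
    have main: "sat M I v (Lfp X xs body (enc g [])) \<longleftrightarrow> derivable M Rs g []"
      if v: "range v \<subseteq> universe M" "v K \<noteq> v (Suc K)" for I and v :: "var \<Rightarrow> 'a"
    proof -
      define F where "F = lfp_op M I v X xs body"
      have mono: "mono F" unfolding F_def using mono_lfp_op[OF body(5)] .
      define E where "E n L = encode (v K) (v (Suc K)) nl A n (far n) L" for n L
      \<comment> \<open>One firing of a rule on codes: below \<open>K\<close> the valuation
        \<open>w\<close> is free, from \<open>K\<close> on it carries the coding elements and
        \<open>L\<close>.\<close>
      let ?fires = "\<lambda>L S v' (\<alpha>s, \<beta>s, n, us). \<exists>w. range w \<subseteq> universe M \<and> (\<forall>x\<ge>K. w x = v' x) \<and> L = E n (map w us) \<and>
          (\<forall>(m, ys, k)\<in>set \<alpha>s. \<forall>cs\<in>tuples k (universe M). E m (map w ys @ cs) \<in> S) \<and> (\<forall>\<beta>\<in>set \<beta>s. sat M I w \<beta>)"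
      have in_F: "L \<in> F S \<longleftrightarrow> L \<in> tuples B (universe M) \<and> (\<exists>r\<in>Rs. ?fires L S (assign v xs L) r)" for L S
      proof (cases "L \<in> tuples B (universe M)")
        case True
        define v' where "v' = assign v xs L"
        have v': "range v' \<subseteq> universe M" using True range_assign[OF v(1)] by (simp add: v'_def tuples_def)
        have lL: "length L = B" using True by (simp add: tuples_def)
        have v'K: "v' K = v K" "v' (Suc K) = v (Suc K)" by (simp_all add: v'_def assign_notin xs_def)
        have v'xs: "map v' xs = L" unfolding v'_def using lL len_xs by (intro map_assign) (simp_all add: xs_def)
        have rf_iff: "sat M (I(X := S)) v' (rf (\<alpha>s, \<beta>s, n, us)) \<longleftrightarrow> (\<exists>w. range w \<subseteq> universe M \<and>
          (\<forall>x\<ge>K. w x = v' x) \<and> L = E n (map w us) \<and>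
          (\<forall>(m, ys, k)\<in>set \<alpha>s. \<forall>cs\<in>tuples k (universe M). E m (map w ys @ cs) \<in> S) \<and> (\<forall>\<beta>\<in>set \<beta>s. sat M I w \<beta>))"
          if r: "(\<alpha>s, \<beta>s, n, us) \<in> Rs" for \<alpha>s \<beta>s n us
        proof -
          note ru = rule[OF r r r]
          have w: "((\<forall>x. x \<notin> set [0..<K] \<longrightarrow> w x = v' x) \<and> (\<forall>x\<in>set [0..<K]. w x \<in> universe M)) \<longleftrightarrow>
              range w \<subseteq> universe M \<and> (\<forall>x\<ge>K. w x = v' x)" for w
          proof -
            have "w x \<in> universe M" if "\<forall>x\<ge>K. w x = v' x" "\<forall>x<K. w x \<in> universe M" for x
              using that v' by (cases "x < K") auto
            then show ?thesis by auto
          qed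
          have "sat M (I(X := S)) w (conjs (conjs (map2 Eq xs (enc n us)) # map al \<alpha>s @ \<beta>s)) \<longleftrightarrow>
            L = E n (map w us) \<and>
            (\<forall>(m, ys, k)\<in>set \<alpha>s. \<forall>cs\<in>tuples k (universe M). E m (map w ys @ cs) \<in> S) \<and> (\<forall>\<beta>\<in>set \<beta>s. sat M I w \<beta>)"
            if "\<forall>x\<ge>K. w x = v' x" for w
          proof -
            have wx: "map w xs = L" using that v'xs by (auto simp: xs_def)
            have me: "map w (enc m ys) = E m (map w ys)" for m ys
              using that v'K by (simp add: enc_def E_def map_encode)
            have "sat M (I(X := S)) w (conjs (map2 Eq xs (enc n us))) \<longleftrightarrow> L = E n (map w us)"
              using len_enc[OF ru(5), of us 0] ru(4) len_xs wx me by (subst sat_conjs_Eq) auto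
            moreover have "sat M (I(X := S)) w (al (m, ys, k)) \<longleftrightarrow> (\<forall>cs\<in>tuples k (universe M). E m (map w ys @ cs) \<in> S)"
              if "(m, ys, k) \<in> set \<alpha>s" for m ys k
            proof -
              have "set ys \<subseteq> {..<K}" using ru(1) that by auto
              from sat_alls_Rel[OF distinct_upt dz[OF this], where M = M and I = "I(X := S)" and v = w and R = X]
              have "sat M (I(X := S)) w (al (m, ys, k)) \<longleftrightarrow> (\<forall>cs\<in>tuples k (universe M). map w (enc m ys) @ cs \<in> S)"
                by (simp add: al_def)
              then show ?thesis unfolding me E_def encode_append .
            qed
            then have "(\<forall>\<alpha>\<in>set \<alpha>s. sat M (I(X := S)) w (al \<alpha>)) \<longleftrightarrow>
                (\<forall>(m, ys, k)\<in>set \<alpha>s. \<forall>cs\<in>tuples k (universe M). E m (map w ys @ cs) \<in> S)"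
              by (intro ball_cong[OF refl]) auto
            moreover have "sat M (I(X := S)) w \<beta> \<longleftrightarrow> sat M I w \<beta>" if "\<beta> \<in> set \<beta>s" for \<beta>
              using sat_horn_beta[of \<beta> w w] ru(2) that by blast
            moreover have "sat M (I(X := S)) w (conjs (\<chi> # map al \<alpha>s @ \<beta>s)) \<longleftrightarrow> sat M (I(X := S)) w \<chi> \<and>
                (\<forall>\<alpha>\<in>set \<alpha>s. sat M (I(X := S)) w (al \<alpha>)) \<and> (\<forall>\<beta>\<in>set \<beta>s. sat M (I(X := S)) w \<beta>)" for \<chi>
              unfolding sat_conjs by auto
            ultimately show ?thesis by simp
          qed
          note rule_body = this
          have "(\<And>w. Q w \<Longrightarrow> C w \<longleftrightarrow> C' w) \<Longrightarrow> (\<not> (\<forall>w. P w \<and> Q w \<longrightarrow> \<not> C w)) \<longleftrightarrow> (\<exists>w. P w \<and> Q w \<and> C' w)"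
            for P Q C C' :: "(var \<Rightarrow> 'a) \<Rightarrow> bool" by blast
          then show ?thesis unfolding rf_def prod.case sat.simps sat_alls w by this (rule rule_body)
        qed
        have "L \<in> F S \<longleftrightarrow> (\<exists>r\<in>Rs. sat M (I(X := S)) v' (rf r))"
          using True by (simp add: F_def lfp_op_def body_def sat_conjs len_xs rl v'_def)
        also have "\<dots> \<longleftrightarrow> (\<exists>r\<in>Rs. ?fires L S v' r)"
        proof (rule bex_cong[OF refl])
          fix r assume r: "r \<in> Rs"
          obtain \<alpha>s \<beta>s n us where e: "r = (\<alpha>s, \<beta>s, n, us)" by (cases r)
          show "sat M (I(X := S)) v' (rf r) \<longleftrightarrow> ?fires L S v' r"
            using rf_iff[OF r[unfolded e]] unfolding e prod.case .
        qed
        finally show ?thesis using True by (simp only: v'_def simp_thms)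
      qed (simp add: F_def lfp_op_def len_xs)
      have E_inj: "n = n' \<and> L = L'" if "E n L = E n' L'" "n \<in> ns" "n' \<in> ns" "length L = far n" "length L' = far n'" for n n' L L'
        using encode_inject[of "v K" "v (Suc K)" nl A n L n' L'] that v(2) nl A by (simp add: E_def)
      have der: "derivable M Rs n L \<Longrightarrow> n \<in> ns \<Longrightarrow> E n L \<in> lfp F" for n L
      proof (induction rule: derivable.induct)
        case (derivableI \<alpha>s \<beta>s n us V)
        note ru = rule[OF derivableI(1) derivableI(1) derivableI(1)]
        let ?L = "E n (map V us)"
        \<comment> \<open>Values of the rule variables come from the derivation, those of the coding
          variables and of \<open>xs\<close> from the operator.\<close>
        define w where "w = (\<lambda>x. if x < K then V x else assign v xs ?L x)"
        have "length ?L = B" using len_enc[OF ru(5), of us 0] ru(4) by (simp add: E_def enc_def encode_def)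
        moreover have "set ?L \<subseteq> universe M" using v(1) derivableI(2) by (auto simp: E_def encode_def)
        ultimately have L: "?L \<in> tuples B (universe M)" by (simp add: tuples_def)
        have wv: "map w ys = map V ys" if "set ys \<subseteq> {..<K}" for ys using that by (auto simp: w_def)
        have "?L \<in> F (lfp F)" unfolding in_F
        proof (intro conjI L bexI[OF _ derivableI(1)])
          have "range (assign v xs ?L) \<subseteq> universe M" using range_assign[OF v(1)] L by (simp add: tuples_def)
          then have "range w \<subseteq> universe M" using derivableI(2) by (auto simp: w_def)
          moreover have "\<forall>x\<ge>K. w x = assign v xs ?L x" by (simp add: w_def)
          moreover have "?L = E n (map w us)" unfolding wv[OF ru(3)] ..
          moreover have "\<forall>(m, ys, k)\<in>set \<alpha>s. \<forall>cs\<in>tuples k (universe M). E m (map w ys @ cs) \<in> lfp F"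
          proof clarify
            fix m ys k cs assume m: "(m, ys, k) \<in> set \<alpha>s" "cs \<in> tuples k (universe M)"
            then have y: "set ys \<subseteq> {..<K}" "m \<in> ns" using ru(1) by auto
            show "E m (map w ys @ cs) \<in> lfp F"
              unfolding wv[OF y(1)] using bspec[OF derivableI.IH m(1)] m(2) y(2) by simp
          qed
          moreover have "\<forall>\<beta>\<in>set \<beta>s. sat M I w \<beta>"
          proof
            fix \<beta> assume b: "\<beta> \<in> set \<beta>s"
            then have "horn_beta \<beta>" "\<And>x. x \<in> free_vars \<beta> \<Longrightarrow> w x = V x" using ru(2) by (auto simp: w_def)
            then show "sat M I w \<beta>" using sat_horn_beta[of \<beta> w V M I "\<lambda>_. {}"] b derivableI.hyps by blast
          qed
          ultimately show "?fires ?L (lfp F) (assign v xs ?L) (\<alpha>s, \<beta>s, n, us)"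
            unfolding prod.case by blast
        qed
        then show ?case using lfp_unfold[OF mono] by blast
      qed
      \<comment> \<open>The codes of the derivable tuples form a prefixed point; injectivity of the
        coding turns a coded premise back into a derivable one.\<close>
      let ?S = "{E n L | n L. n \<in> ns \<and> derivable M Rs n L}"
      have "F ?S \<subseteq> ?S"
      proof
        fix L assume "L \<in> F ?S"
        then obtain \<alpha>s \<beta>s n us w where r: "(\<alpha>s, \<beta>s, n, us) \<in> Rs" and w: "range w \<subseteq> universe M" "L = E n (map w us)"
          "\<forall>(m, ys, k)\<in>set \<alpha>s. \<forall>cs\<in>tuples k (universe M). E m (map w ys @ cs) \<in> ?S" "\<forall>\<beta>\<in>set \<beta>s. sat M I w \<beta>"
          unfolding in_F by blast
        note ru = rule[OF r r r]
        have "derivable M Rs n (map w us)"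
        proof (rule derivableI'[OF r wf[OF r] w(1)])
          fix m ys k cs assume m: "(m, ys, k) \<in> set \<alpha>s" "cs \<in> tuples k (universe M)"
          then have "E m (map w ys @ cs) \<in> ?S" using w(3) by blast
          then obtain n' L' where n': "E m (map w ys @ cs) = E n' L'" "n' \<in> ns" "derivable M Rs n' L'" by blast
          have "length L' = far n'" using derivable_tuples[OF wf n'(3)] by (simp add: tuples_def)
          moreover have "length (map w ys @ cs) = far m" "m \<in> ns" using ru(1) m by (auto simp: tuples_def)
          ultimately show "derivable M Rs m (map w ys @ cs)" using E_inj[OF n'(1)] n' by blast
        qed (use w(4) in auto)
        then show "L \<in> ?S" using w(2) ru(5) by blast
      qed
      then have "lfp F \<subseteq> ?S" by (rule lfp_lowerbound)
      moreover have "L = []" if "derivable M Rs g L" for L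
        using derivable_tuples[OF wf that] g by (simp add: tuples_def)
      ultimately have "E g [] \<in> lfp F \<longleftrightarrow> derivable M Rs g []"
        using der[OF _ gn, of "[]"] E_inj[of g "[]"] gn g derivable_tuples[OF wf, of Rs M]
        by (fastforce simp: tuples_def)
      moreover have "map v (enc g []) = E g []" by (simp add: enc_def E_def map_encode)
      ultimately show ?thesis unfolding sat_Lfp F_def by simp
    qed
    have "sat M I v \<psi> \<longleftrightarrow> (\<exists>a\<in>universe M. \<exists>b\<in>universe M. a \<noteq> b) \<and> \<not> derivable M Rs g []"
      if v: "range v \<subseteq> universe M" for I and v :: "var \<Rightarrow> 'a"
    proof -
      have "sat M I (v(K := a, Suc K := b)) (And (Neg (Eq K (Suc K))) (Neg (Lfp X xs body (enc g [])))) \<longleftrightarrow>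
          a \<noteq> b \<and> \<not> derivable M Rs g []" if "a \<in> universe M" "b \<in> universe M" for a b
      proof (cases "a = b")
        case False
        have "range (v(K := a, Suc K := b)) \<subseteq> universe M" using v that by auto
        then show ?thesis using main[of "v(K := a, Suc K := b)" I] False unfolding sat.simps(5,6,3) by simp
      qed simp
      then show ?thesis unfolding \<psi>_def by (auto simp del: sat.simps(13) sat.simps(6))
    qed
    moreover obtain a where "a \<in> universe M" using ne by blast
    then have "range (\<lambda>_ :: var. a) \<subseteq> universe M" by auto
    ultimately show ?thesis unfolding models_def by blast
  qed
  ultimately show thesis by (intro that[of \<psi>]) simp_all
qed

section \<open>Structures with one element\<close>

primrec no_lfp :: "'p fm \<Rightarrow> bool" where
  "no_lfp Bot \<longleftrightarrow> True"
| "no_lfp (Pred P ys) \<longleftrightarrow> True"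
| "no_lfp (Eq x y) \<longleftrightarrow> True"
| "no_lfp (Rel R ys) \<longleftrightarrow> True"
| "no_lfp (Neg \<phi>) \<longleftrightarrow> no_lfp \<phi>"
| "no_lfp (And \<phi> \<psi>) \<longleftrightarrow> no_lfp \<phi> \<and> no_lfp \<psi>"
| "no_lfp (Or \<phi> \<psi>) \<longleftrightarrow> no_lfp \<phi> \<and> no_lfp \<psi>"
| "no_lfp (Imp \<phi> \<psi>) \<longleftrightarrow> no_lfp \<phi> \<and> no_lfp \<psi>"
| "no_lfp (Ex x \<phi>) \<longleftrightarrow> no_lfp \<phi>"
| "no_lfp (All x \<phi>) \<longleftrightarrow> no_lfp \<phi>"
| "no_lfp (SOEx R \<phi>) \<longleftrightarrow> no_lfp \<phi>"
| "no_lfp (SOAll R \<phi>) \<longleftrightarrow> no_lfp \<phi>"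
| "no_lfp (Lfp X xs \<phi> us) \<longleftrightarrow> False"

text \<open>Over a one-element universe a relation is a truth value.\<close>

primrec propositional :: "(rvar \<Rightarrow> bool) \<Rightarrow> 'p fm \<Rightarrow> 'p fm" where
  "propositional \<rho> Bot = Bot"
| "propositional \<rho> (Pred P ys) = Pred P ys"
| "propositional \<rho> (Eq x y) = Eq x y"
| "propositional \<rho> (Rel R ys) = (if \<rho> R then Neg Bot else Bot)"
| "propositional \<rho> (Neg \<phi>) = Neg (propositional \<rho> \<phi>)"
| "propositional \<rho> (And \<phi> \<psi>) = And (propositional \<rho> \<phi>) (propositional \<rho> \<psi>)"
| "propositional \<rho> (Or \<phi> \<psi>) = Or (propositional \<rho> \<phi>) (propositional \<rho> \<psi>)"
| "propositional \<rho> (Imp \<phi> \<psi>) = Imp (propositional \<rho> \<phi>) (propositional \<rho> \<psi>)"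
| "propositional \<rho> (Ex x \<phi>) = Ex x (propositional \<rho> \<phi>)"
| "propositional \<rho> (All x \<phi>) = All x (propositional \<rho> \<phi>)"
| "propositional \<rho> (SOEx R \<phi>) = Or (propositional (\<rho>(R := True)) \<phi>) (propositional (\<rho>(R := False)) \<phi>)"
| "propositional \<rho> (SOAll R \<phi>) = And (propositional (\<rho>(R := True)) \<phi>) (propositional (\<rho>(R := False)) \<phi>)"
| "propositional \<rho> (Lfp X xs \<phi> us) = Bot"

lemma propositional_simps:
  "free_vars (propositional \<rho> \<phi>) \<subseteq> free_vars \<phi>"
  "free_rvars (propositional \<rho> \<phi>) = {}"
  "no_so_quantifiers (propositional \<rho> \<phi>)"
  "wf_fm \<sigma> ar \<phi> \<Longrightarrow> wf_fm \<sigma> ar (propositional \<rho> \<phi>)"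
  by (induction \<phi> arbitrary: \<rho>) (auto, blast+)

lemma subset_tuples_singleton: "(\<exists>S\<subseteq>tuples n {a}. P S) \<longleftrightarrow> P {} \<or> P {replicate n a}"
proof -
  have "tuples n {a} = {replicate n a}"
    by (auto simp: tuples_def set_replicate_conv_if intro!: replicate_eqI split: if_splits)
  then show ?thesis by (auto simp: subset_singleton_iff)
qed

text \<open>\<open>\<rho> R\<close> records whether the only tuple of the right length belongs to
  \<open>I R\<close>, which is all that an atom can test. The translation contains no relation
  variable, so its value does not depend on \<open>J\<close>.\<close>

lemma sat_propositional:
  assumes "universe M = {a}"
  shows "wf_fm \<sigma> ar \<phi> \<Longrightarrow> no_lfp \<phi> \<Longrightarrow> range v \<subseteq> {a} \<Longrightarrow>
    (\<And>R. \<rho> R \<longleftrightarrow> replicate (rv_arity R) a \<in> I R) \<Longrightarrow> sat M J v (propositional \<rho> \<phi>) \<longleftrightarrow> sat M I v \<phi>"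
proof (induction \<phi> arbitrary: \<rho> I v)
  case (Rel R ys)
  have "map v ys = replicate (length ys) a" using Rel.prems(3) by (intro replicate_eqI) auto
  then show ?case using Rel.prems by simp
next
  case (Ex x \<phi>)
  have "sat M J (v(x := a)) (propositional \<rho> \<phi>) \<longleftrightarrow> sat M I (v(x := a)) \<phi>"
    using Ex.prems by (intro Ex.IH) auto
  then show ?case using assms by (simp del: fun_upd_apply)
next
  case (All x \<phi>)
  have "sat M J (v(x := a)) (propositional \<rho> \<phi>) \<longleftrightarrow> sat M I (v(x := a)) \<phi>"
    using All.prems by (intro All.IH) auto
  then show ?case using assms by (simp del: fun_upd_apply)
next
  case (SOEx R \<phi>)
  have "sat M J v (propositional (\<rho>(R := b)) \<phi>) \<longleftrightarrow>
      sat M (I(R := if b then {replicate (rv_arity R) a} else {})) v \<phi>" for b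
    using SOEx.prems by (intro SOEx.IH) auto
  from this[of True] this[of False] show ?case unfolding sat.simps assms subset_tuples_singleton by auto
next
  case (SOAll R \<phi>)
  have "sat M J v (propositional (\<rho>(R := b)) \<phi>) \<longleftrightarrow>
      sat M (I(R := if b then {replicate (rv_arity R) a} else {})) v \<phi>" for b
    using SOAll.prems by (intro SOAll.IH) auto
  from this[of True] this[of False] show ?case
    using subset_tuples_singleton[of "rv_arity R" a "\<lambda>S. \<not> sat M (I(R := S)) v \<phi>"] assms by auto
next
  case (Neg \<phi>)
  then show ?case using Neg.IH[of v \<rho> I] by simp
next
  case (And \<phi> \<psi>)
  then show ?case using And.IH[of v \<rho> I] by simp
next
  case (Or \<phi> \<psi>)
  then show ?case using Or.IH[of v \<rho> I] by simp
next
  case (Imp \<phi> \<psi>)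
  then show ?case using Imp.IH[of v \<rho> I] by simp
qed auto

lemma no_lfp_conjs: "no_lfp (conjs \<phi>s) \<longleftrightarrow> (\<forall>\<phi>\<in>set \<phi>s. no_lfp \<phi>)"
  by (induction \<phi>s rule: conjs.induct) auto

lemma no_lfp_alls: "no_lfp (alls xs \<phi>) \<longleftrightarrow> no_lfp \<phi>"
  by (induction xs) (auto simp: alls_def)

lemma no_lfp_so_prefix: "no_lfp (so_prefix Qs \<phi>) \<longleftrightarrow> no_lfp \<phi>"
  by (induction Qs \<phi> rule: so_prefix.induct) auto

lemma no_lfp_horn_clause: "horn_clause C \<Longrightarrow> no_lfp C"
  unfolding horn_clause_def horn_alpha_def horn_beta_def horn_head_def
  by (fastforce simp: no_lfp_conjs no_lfp_alls)

lemma no_lfp_so_horn_r: "\<phi> \<in> so_horn_r \<sigma> ar \<Longrightarrow> no_lfp \<phi>"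
  unfolding so_horn_r_def
  by (clarsimp simp: no_lfp_so_prefix no_lfp_alls no_lfp_conjs) (blast intro: no_lfp_horn_clause)

section \<open>From Horn sentences to programs\<close>

text \<open>A plain atom is the case of an empty list of quantified variables, and
  \<open>None\<close> stands for the head \<open>Bot\<close>.\<close>

type_synonym 'p clause = "(rvar \<times> var list \<times> var list) list \<times> 'p fm list \<times> (rvar \<times> var list) option"

definition clause_fm :: "'p clause \<Rightarrow> 'p fm" where
  "clause_fm = (\<lambda>(\<alpha>s, \<beta>s, h). Imp (conjs (map (\<lambda>(R, ys, zs). alls zs (Rel R (ys @ zs))) \<alpha>s @ \<beta>s))
     (case h of None \<Rightarrow> Bot | Some (R, us) \<Rightarrow> Rel R us))"

definition wf_clause :: "'p clause \<Rightarrow> bool" where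
  "wf_clause = (\<lambda>(\<alpha>s, \<beta>s, h). (\<forall>(R, ys, zs)\<in>set \<alpha>s. distinct zs \<and> set ys \<inter> set zs = {}) \<and> (\<forall>\<beta>\<in>set \<beta>s. horn_beta \<beta>))"

lemma list_choice:
  "\<forall>y\<in>set ys. \<exists>x. y = f x \<and> P x \<Longrightarrow> \<exists>xs. ys = map f xs \<and> (\<forall>x\<in>set xs. P x)"
proof (induction ys)
  case (Cons y ys)
  then obtain x xs where "y = f x" "P x" "ys = map f xs" "\<forall>x\<in>set xs. P x" by auto
  then show ?case by (intro exI[of _ "x # xs"]) simp
qed simp

lemma horn_clauseD:
  assumes "horn_clause C"
  shows "\<exists>cl. C = clause_fm cl \<and> wf_clause cl"
proof -
  obtain \<alpha>s \<beta>s H where C: "C = Imp (conjs (\<alpha>s @ \<beta>s)) H" "\<forall>\<alpha>\<in>set \<alpha>s. horn_alpha \<alpha>"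
    "\<forall>\<beta>\<in>set \<beta>s. horn_beta \<beta>" "horn_head H"
    using assms unfolding horn_clause_def by blast
  have "\<exists>x. \<alpha> = (\<lambda>(R, ys, zs). alls zs (Rel R (ys @ zs))) x \<and>
      (\<lambda>(R, ys, zs). distinct zs \<and> set ys \<inter> set zs = {}) x" if "\<alpha> \<in> set \<alpha>s" for \<alpha>
  proof -
    from C(2) that consider R ys where "\<alpha> = Rel R ys"
      | R ys zs where "\<alpha> = alls zs (Rel R (ys @ zs))" "distinct zs" "set ys \<inter> set zs = {}"
      unfolding horn_alpha_def by blast
    then show ?thesis
    proof cases
      case 1
      then show ?thesis by (intro exI[of _ "(R, ys, [])"]) (simp add: alls_def)
    next
      case 2
      then show ?thesis by (intro exI[of _ "(R, ys, zs)"]) simp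
    qed
  qed
  then obtain xs where xs: "\<alpha>s = map (\<lambda>(R, ys, zs). alls zs (Rel R (ys @ zs))) xs"
    "\<forall>x\<in>set xs. (\<lambda>(R, ys, zs). distinct zs \<and> set ys \<inter> set zs = {}) x"
    using list_choice[of \<alpha>s "\<lambda>(R, ys, zs). alls zs (Rel R (ys @ zs))"] by blast
  obtain h where "H = (case h of None \<Rightarrow> Bot | Some (R, us) \<Rightarrow> Rel R us)"
    using C(4) unfolding horn_head_def by (metis (no_types, lifting) option.simps(4,5) prod.case)
  then show ?thesis using xs C by (intro exI[of _ "(xs, \<beta>s, h)"]) (auto simp: clause_fm_def wf_clause_def)
qed

lemma sat_clause_fm:
  assumes "wf_clause (\<alpha>s, \<beta>s, h)"
  shows "sat M I v (clause_fm (\<alpha>s, \<beta>s, h)) \<longleftrightarrow>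
    ((\<forall>(R, ys, zs)\<in>set \<alpha>s. \<forall>cs\<in>tuples (length zs) (universe M). map v ys @ cs \<in> I R) \<longrightarrow>
     (\<forall>\<beta>\<in>set \<beta>s. sat M I v \<beta>) \<longrightarrow> (case h of None \<Rightarrow> False | Some (R, us) \<Rightarrow> map v us \<in> I R))"
proof -
  have "(\<forall>\<alpha>\<in>set \<alpha>s. sat M I v ((\<lambda>(R, ys, zs). alls zs (Rel R (ys @ zs))) \<alpha>)) \<longleftrightarrow>
    (\<forall>(R, ys, zs)\<in>set \<alpha>s. \<forall>cs\<in>tuples (length zs) (universe M). map v ys @ cs \<in> I R)"
    using assms by (intro ball_cong[OF refl]) (auto simp: wf_clause_def sat_alls_Rel)
  moreover have "(\<forall>\<phi>\<in>set (map f \<alpha>s @ \<beta>s). sat M I v \<phi>) \<longleftrightarrow>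
      (\<forall>\<alpha>\<in>set \<alpha>s. sat M I v (f \<alpha>)) \<and> (\<forall>\<beta>\<in>set \<beta>s. sat M I v \<beta>)" for f :: "rvar \<times> var list \<times> var list \<Rightarrow> 'a fm"
    by auto
  moreover have "sat M I v (case h of None \<Rightarrow> Bot | Some (R, us) \<Rightarrow> Rel R us) \<longleftrightarrow>
      (case h of None \<Rightarrow> False | Some (R, us) \<Rightarrow> map v us \<in> I R)"
    by (simp split: option.split)
  ultimately show ?thesis unfolding clause_fm_def prod.case sat.simps sat_conjs by blast
qed

text \<open>Premises, universal ones included, are monotone: if they hold in the intersection, they
  hold in each member, and so does the head. For the head \<open>Bot\<close> one member suffices,
  hence \<open>T \<noteq> {}\<close>.\<close>

lemma sat_Inter_clause:
  assumes "wf_clause cl" "T \<noteq> {}" "\<And>i. i \<in> T \<Longrightarrow> sat M (I i) v (clause_fm cl)"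
  shows "sat M (\<lambda>R. \<Inter>i\<in>T. I i R) v (clause_fm cl)"
proof -
  obtain \<alpha>s \<beta>s h where cl: "cl = (\<alpha>s, \<beta>s, h)" by (cases cl)
  note iff = sat_clause_fm[OF assms(1)[unfolded cl]]
  show ?thesis unfolding cl iff
  proof (intro impI)
    assume a: "\<forall>(R, ys, zs)\<in>set \<alpha>s. \<forall>cs\<in>tuples (length zs) (universe M). map v ys @ cs \<in> (\<Inter>i\<in>T. I i R)"
      and b: "\<forall>\<beta>\<in>set \<beta>s. sat M (\<lambda>R. \<Inter>i\<in>T. I i R) v \<beta>"
    have "case h of None \<Rightarrow> False | Some (R, us) \<Rightarrow> map v us \<in> I i R" if i: "i \<in> T" for i
    proof -
      have "\<forall>(R, ys, zs)\<in>set \<alpha>s. \<forall>cs\<in>tuples (length zs) (universe M). map v ys @ cs \<in> I i R"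
        using a i by fast
      moreover have "\<forall>\<beta>\<in>set \<beta>s. sat M (I i) v \<beta>"
        using b assms(1) sat_horn_beta[of _ v v M "I i"] unfolding cl wf_clause_def by blast
      ultimately show ?thesis using assms(3)[OF i] unfolding cl iff by blast
    qed
    then show "case h of None \<Rightarrow> False | Some (R, us) \<Rightarrow> map v us \<in> (\<Inter>i\<in>T. I i R)"
      using assms(2) by (cases h) auto
  qed
qed

abbreviation horn_fm :: "(quantifier \<times> rvar) list \<Rightarrow> var list \<Rightarrow> 'p clause list \<Rightarrow> 'p fm" where
  "horn_fm Qs xs ccs \<equiv> so_prefix Qs (alls xs (conjs (map clause_fm ccs)))"

text \<open>
  The relations satisfying a Horn formula are closed under intersections, also after second-order
  quantification. Hence a universally quantified relation need only range over the full relation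
  and the relations which lack exactly one tuple.
\<close>

lemma sat_Inter_so_prefix:
  assumes "\<forall>cl\<in>set ccs. wf_clause cl" "T \<noteq> {}"
    "\<And>i. i \<in> T \<Longrightarrow> sat M (I i) v (horn_fm Qs xs ccs)"
  shows "sat M (\<lambda>R. \<Inter>i\<in>T. I i R) v (horn_fm Qs xs ccs)"
  using assms(3)
proof (induction Qs arbitrary: I)
  case Nil
  show ?case unfolding so_prefix.simps sat_alls sat_conjs
  proof (intro allI impI ballI)
    fix w \<psi>
    assume w: "(\<forall>x. x \<notin> set xs \<longrightarrow> w x = v x) \<and> (\<forall>x\<in>set xs. w x \<in> universe M)" and \<psi>: "\<psi> \<in> set (map clause_fm ccs)"
    obtain cl where cl: "cl \<in> set ccs" "\<psi> = clause_fm cl" using \<psi> by auto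
    have "sat M (I i) w (clause_fm cl)" if "i \<in> T" for i
      using Nil[OF that] w cl(1) unfolding so_prefix.simps sat_alls sat_conjs by simp
    then show "sat M (\<lambda>R. \<Inter>i\<in>T. I i R) w \<psi>"
      unfolding cl(2) using sat_Inter_clause[of cl T M I w] assms(1,2) cl(1) by blast
  qed
next
  case (Cons Q Qs)
  obtain q R where Q: "Q = (q, R)" by (cases Q)
  have upd: "(\<lambda>R'. \<Inter>i\<in>T. ((I i)(R := S i)) R') = (\<lambda>R'. \<Inter>i\<in>T. I i R')(R := \<Inter>i\<in>T. S i)" for S
    by (rule ext, rename_tac R', case_tac "R' = R") simp_all
  show ?case
  proof (cases q)
    case Exists
    then have "\<forall>i\<in>T. \<exists>S. S \<subseteq> tuples (rv_arity R) (universe M) \<and>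
        sat M ((I i)(R := S)) v (horn_fm Qs xs ccs)"
      using Cons.prems by (auto simp: Q)
    then obtain S where S: "\<And>i. i \<in> T \<Longrightarrow> S i \<subseteq> tuples (rv_arity R) (universe M)"
        "\<And>i. i \<in> T \<Longrightarrow> sat M ((I i)(R := S i)) v (horn_fm Qs xs ccs)"
      by metis
    \<comment> \<open>Intersecting one witness per interpretation gives a witness for the
      intersection.\<close>
    have "sat M ((\<lambda>R'. \<Inter>i\<in>T. I i R')(R := \<Inter>i\<in>T. S i)) v (horn_fm Qs xs ccs)"
      using Cons.IH[of "\<lambda>i. (I i)(R := S i)", OF S(2)] unfolding upd .
    moreover have "(\<Inter>i\<in>T. S i) \<subseteq> tuples (rv_arity R) (universe M)" using S(1) assms(2) by blast
    ultimately show ?thesis unfolding Q Exists so_prefix.simps sat.simps by blast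
  next
    case Forall
    have "sat M ((\<lambda>R'. \<Inter>i\<in>T. I i R')(R := S)) v (horn_fm Qs xs ccs)"
      if S: "S \<subseteq> tuples (rv_arity R) (universe M)" for S
    proof -
      have "\<And>i. i \<in> T \<Longrightarrow> sat M ((I i)(R := S)) v (horn_fm Qs xs ccs)"
        using Cons.prems S by (simp add: Q Forall)
      from Cons.IH[of "\<lambda>i. (I i)(R := S)", OF this] show ?thesis
        unfolding upd[of "\<lambda>_. S"] using assms(2) by simp
    qed
    then show ?thesis by (simp add: Q Forall)
  qed
qed

text \<open>
  A relation variable becomes a relation whose additional arguments are the choices for the
  quantifiers up to its own: one block of arguments per quantifier, which for a universal
  quantifier is the missing tuple. The list of flags in the name tells whether there is a missing
  tuple. Blocks and flags of existential quantifiers are irrelevant.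
\<close>

locale horn_sentence =
  fixes \<sigma> :: "'p set" and ar :: "'p \<Rightarrow> nat"
    and Qs :: "(quantifier \<times> rvar) list" and xs :: "var list" and ccs :: "'p clause list"
  assumes dist: "distinct (map snd Qs)"
    and ok: "\<And>cl. cl \<in> set ccs \<Longrightarrow> wf_clause cl"
    and wf: "\<And>cl. cl \<in> set ccs \<Longrightarrow> wf_fm \<sigma> ar (clause_fm cl)"
    and fv: "\<And>cl. cl \<in> set ccs \<Longrightarrow> free_vars (clause_fm cl) \<subseteq> set xs"
    and frv: "\<And>cl. cl \<in> set ccs \<Longrightarrow> free_rvars (clause_fm cl) \<subseteq> snd ` set Qs"
begin

definition m :: nat where "m = length Qs"
definition q :: "nat \<Rightarrow> quantifier" where "q i = fst (Qs ! i)"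
definition R :: "nat \<Rightarrow> rvar" where "R i = snd (Qs ! i)"
definition r :: "nat \<Rightarrow> nat" where "r i = rv_arity (R i)"
definition s :: "nat \<Rightarrow> nat" where "s i = (\<Sum>j<i. r j)"
definition K :: nat where "K = Suc (Max (insert 0 (set xs)))"
definition idx :: "rvar \<Rightarrow> nat" where "idx X = (THE i. i < m \<and> R i = X)"
definition name :: "bool list \<Rightarrow> rvar \<Rightarrow> (nat \<times> bool list) option" where
  "name f X = Some (idx X, take (Suc (idx X)) f)"
text \<open>The clause variables lie below \<open>K\<close>; the next \<open>s m\<close> variables
  hold the choices of all quantifiers, and the arguments proper of a relation follow.
  \<open>blocks i\<close> covers the quantifiers before \<open>i\<close>, so relation
  \<open>i\<close> uses \<open>blocks (Suc i)\<close>.\<close>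

definition blocks :: "nat \<Rightarrow> var list" where "blocks i = [K..<K + s i]"
definition args :: "nat \<Rightarrow> var list" where "args i = [K + s m..<K + s m + r i]"
definition matrix :: "'p fm" where "matrix = alls xs (conjs (map clause_fm ccs))"

text \<open>All relations of the clause share one sequence of choices, of which each receives the
  part up to its own quantifier, as a Skolem function does.\<close>

definition clause_rule :: "bool list \<Rightarrow> 'p clause \<Rightarrow> ((nat \<times> bool list) option, 'p) rule" where
  "clause_rule f = (\<lambda>(\<alpha>s, \<beta>s, h).
     (map (\<lambda>(X, ys, zs). (name f X, blocks (Suc (idx X)) @ ys, length zs)) \<alpha>s, \<beta>s,
      case h of None \<Rightarrow> (None, []) | Some (X, us) \<Rightarrow> (name f X, blocks (Suc (idx X)) @ us)))"

definition full_rule :: "nat \<Rightarrow> bool list \<Rightarrow> ((nat \<times> bool list) option, 'p) rule" where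
  "full_rule i f = ([], [], Some (i, f), blocks (Suc i) @ args i)"

text \<open>Tuples differ if they differ at some position, hence one rule for each position
  \<open>j\<close>: the argument differs there from the block of quantifier
  \<open>i\<close>.\<close>

definition missing_rule :: "nat \<Rightarrow> bool list \<Rightarrow> nat \<Rightarrow> ((nat \<times> bool list) option, 'p) rule" where
  "missing_rule i f j = ([], [Neg (Eq (K + s i + j) (K + s m + j))], Some (i, f), blocks (Suc i) @ args i)"

text \<open>Deriving the tuple that was chosen to be missing is a contradiction, just like a clause
  with head \<open>Bot\<close>.\<close>

definition missing_goal :: "nat \<Rightarrow> bool list \<Rightarrow> ((nat \<times> bool list) option, 'p) rule" where
  "missing_goal i f = ([(Some (i, f), blocks (Suc i) @ [K + s i..<K + s (Suc i)], 0)], [], None, [])"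

definition program :: "((nat \<times> bool list) option, 'p) rule set" where
  "program = (\<Union>f\<in>{f. length f = m}. clause_rule f ` set ccs) \<union>
    (\<Union>i\<in>{i. i < m \<and> q i = Forall}. \<Union>f\<in>{f. length f = Suc i}.
      if f ! i then insert (missing_goal i f) (missing_rule i f ` {..<r i}) else {full_rule i f})"

definition far :: "(nat \<times> bool list) option \<Rightarrow> nat" where
  "far n = (case n of None \<Rightarrow> 0 | Some (i, f) \<Rightarrow> s (Suc i) + r i)"

section \<open>Properties of the layout and well-formedness of the program\<close>

lemma inj_R: "i < m \<Longrightarrow> j < m \<Longrightarrow> R i = R j \<longleftrightarrow> i = j"
  using dist nth_eq_iff_index_eq[of "map snd Qs" i j] by (simp add: R_def m_def)

lemma idx_R: "i < m \<Longrightarrow> idx (R i) = i"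
  unfolding idx_def using inj_R by (intro the_equality) auto

lemma idx: "X \<in> snd ` set Qs \<Longrightarrow> idx X < m \<and> R (idx X) = X"
proof -
  assume "X \<in> snd ` set Qs"
  then obtain i where "i < m" "X = R i" by (auto simp: in_set_conv_nth R_def m_def)
  then show ?thesis using idx_R by simp
qed

lemma s_Suc: "s (Suc i) = s i + r i" by (simp add: s_def)

lemma s_mono: "i \<le> j \<Longrightarrow> s i \<le> s j"
  unfolding s_def by (intro sum_mono2) auto

lemma xs_K: "x \<in> set xs \<Longrightarrow> x < K"
  unfolding K_def by (simp add: less_Suc_eq_le)

lemma clause:
  assumes "(\<alpha>s, \<beta>s, h) \<in> set ccs"
  shows "(X, ys, zs) \<in> set \<alpha>s \<Longrightarrow> set ys \<subseteq> set xs \<and> length ys + length zs = rv_arity X \<and> idx X < m \<and> R (idx X) = X"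
    and "\<beta> \<in> set \<beta>s \<Longrightarrow> horn_beta \<beta> \<and> wf_fm \<sigma> ar \<beta> \<and> free_vars \<beta> \<subseteq> set xs"
    and "h = Some (X, us) \<Longrightarrow> set us \<subseteq> set xs \<and> length us = rv_arity X \<and> idx X < m \<and> R (idx X) = X"
proof -
  note facts = ok[OF assms] wf[OF assms] fv[OF assms] frv[OF assms]
  define Bs where "Bs = map (\<lambda>(R, ys, zs). alls zs (Rel R (ys @ zs))) \<alpha>s @ \<beta>s"
  have "wf_fm \<sigma> ar (conjs Bs)" "free_vars (conjs Bs) \<subseteq> set xs" "free_rvars (conjs Bs) \<subseteq> snd ` set Qs"
    using facts(2-4) by (simp_all add: clause_fm_def Bs_def)
  then have Bs: "wf_fm \<sigma> ar \<chi> \<and> free_vars \<chi> \<subseteq> set xs \<and> free_rvars \<chi> \<subseteq> snd ` set Qs" if "\<chi> \<in> set Bs" for \<chi>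
    using that unfolding wf_conjs free_vars_conjs free_rvars_conjs by blast
  {
    assume \<alpha>: "(X, ys, zs) \<in> set \<alpha>s"
    have "alls zs (Rel X (ys @ zs)) \<in> set Bs" unfolding Bs_def using \<alpha> by force
    note b = Bs[OF this]
    have "set ys \<inter> set zs = {}" using facts(1) \<alpha> unfolding wf_clause_def by auto
    then show "set ys \<subseteq> set xs \<and> length ys + length zs = rv_arity X \<and> idx X < m \<and> R (idx X) = X"
      using b[THEN conjunct1] b[THEN conjunct2, THEN conjunct1] b[THEN conjunct2, THEN conjunct2] idx[of X]
      by (auto simp: alls_simps)
  }
  {
    assume "\<beta> \<in> set \<beta>s"
    then have "\<beta> \<in> set Bs" by (simp add: Bs_def)
    then have "wf_fm \<sigma> ar \<beta>" "free_vars \<beta> \<subseteq> set xs"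
      using Bs by blast+
    then show "horn_beta \<beta> \<and> wf_fm \<sigma> ar \<beta> \<and> free_vars \<beta> \<subseteq> set xs"
      using facts(1) \<open>\<beta> \<in> set \<beta>s\<close> unfolding wf_clause_def by auto
  }
  {
    assume "h = Some (X, us)"
    then show "set us \<subseteq> set xs \<and> length us = rv_arity X \<and> idx X < m \<and> R (idx X) = X"
      using facts(2-4) idx[of X] by (auto simp: clause_fm_def)
  }
qed

lemma finite_program: "finite program"
proof -
  have "finite {f :: bool list. length f = n}" for n
    using finite_lists_length_eq[of "UNIV :: bool set" n] by simp
  then show ?thesis by (auto simp: program_def)
qed

lemma wf_program:
  assumes "rl \<in> program"
  shows "wf_rule \<sigma> ar far rl"
proof -
  consider f cl where "cl \<in> set ccs" "rl = clause_rule f cl" "length f = m"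
    | i f where "rl = full_rule i f" | i f j where "rl = missing_rule i f j" | i f where "rl = missing_goal i f"
    using assms unfolding program_def by (auto split: if_splits)
  then show ?thesis
  proof cases
    case 1
    obtain \<alpha>s \<beta>s h where cl: "cl = (\<alpha>s, \<beta>s, h)" by (cases cl)
    note c = clause[OF 1(1)[unfolded cl]]
    have "length (blocks (Suc (idx X)) @ ys) + length zs = far (name f X)" if "(X, ys, zs) \<in> set \<alpha>s" for X ys zs
      using c(1)[OF that] by (simp add: blocks_def far_def name_def r_def)
    moreover have "horn_beta \<beta> \<and> wf_fm \<sigma> ar \<beta>" if "\<beta> \<in> set \<beta>s" for \<beta> using c(2)[OF that] by blast
    moreover have "length (blocks (Suc (idx X)) @ us) = far (name f X)" if "h = Some (X, us)" for X us
      using c(3)[OF that] by (simp add: blocks_def far_def name_def r_def)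
    ultimately show ?thesis unfolding 1(2) cl
      by (auto simp: clause_rule_def wf_rule_def far_def split: option.splits)
  qed (auto simp: wf_rule_def full_rule_def missing_rule_def missing_goal_def far_def blocks_def args_def s_Suc horn_beta_def)
qed

lemma map_blocks:
  assumes "\<And>x. x < s n \<Longrightarrow> V (K + x) = ts ! x" "s n \<le> length ts" "i \<le> n"
  shows "map V (blocks i) = take (s i) ts"
proof (rule nth_equalityI)
  show "length (map V (blocks i)) = length (take (s i) ts)"
    using s_mono[OF assms(3)] assms(2) by (simp add: blocks_def)
  fix j assume "j < length (map V (blocks i))"
  then have "j < s i" "j < s n" using s_mono[OF assms(3)] by (auto simp: blocks_def)
  then show "map V (blocks i) ! j = take (s i) ts ! j" using assms(1) by (simp add: blocks_def)
qed

subsection \<open>Models from failing derivations\<close>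

lemma exists_valuation:
  assumes "set L \<subseteq> universe M" "range w \<subseteq> universe M"
  obtains V where "range V \<subseteq> universe M" "\<And>x. x < K \<Longrightarrow> V x = w x" "\<And>x. x < length L \<Longrightarrow> V (K + x) = L ! x"
proof
  let ?V = "\<lambda>x. if K \<le> x \<and> x < K + length L then L ! (x - K) else w x"
  show "range ?V \<subseteq> universe M" using assms nth_mem[of _ L] by fastforce
qed auto

lemma exists_choice_valuation:
  assumes "i < m" "ts \<in> tuples (s (Suc i)) (universe M)" "u \<in> tuples (r i) (universe M)" "universe M \<noteq> {}"
  obtains V where "range V \<subseteq> universe M" "map V (blocks (Suc i)) = ts" "map V (args i) = u"
    "\<And>j. j < r i \<Longrightarrow> V (K + s m + j) = u ! j" "\<And>x. x < s (Suc i) \<Longrightarrow> V (K + x) = ts ! x"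
proof -
  obtain a where a: "a \<in> universe M" using assms(4) by blast
  \<comment> \<open>The blocks of later quantifiers lie between \<open>ts\<close> and the arguments;
    they are filled with an arbitrary element.\<close>
  define Y where "Y = ts @ replicate (s m - s (Suc i)) a"
  have sm: "s (Suc i) \<le> s m" using assms(1) by (intro s_mono) simp
  have len: "length ts = s (Suc i)" "length u = r i" using assms(2,3) by (auto simp: tuples_def)
  then have Y: "length Y = s m" using sm by (simp add: Y_def)
  have "set (Y @ u) \<subseteq> universe M" using assms(2,3) a by (auto simp: tuples_def Y_def)
  then obtain V where V: "range V \<subseteq> universe M" "\<And>x. x < length (Y @ u) \<Longrightarrow> V (K + x) = (Y @ u) ! x"
    using exists_valuation[of "Y @ u" M "\<lambda>_. a"] a by (metis image_subsetI)
  have u: "V (K + s m + j) = u ! j" if "j < r i" for j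
    using V(2)[of "s m + j"] that Y len by (simp add: nth_append add.assoc)
  have ts: "V (K + x) = ts ! x" if "x < s (Suc i)" for x
    using V(2)[of x] that Y len sm by (simp add: nth_append Y_def)
  show ?thesis
  proof (rule that[OF V(1) _ _ u ts])
    show "map V (blocks (Suc i)) = ts" using map_blocks[of "Suc i" V ts "Suc i"] ts len by simp
    show "map V (args i) = u" by (rule nth_equalityI) (use u len in \<open>auto simp: args_def\<close>)
  qed
qed

lemma derivable_full:
  assumes "i < m" "q i = Forall" "length f = Suc i" "\<not> f ! i" "ts \<in> tuples (s (Suc i)) (universe M)"
    "u \<in> tuples (r i) (universe M)" "universe M \<noteq> {}"
  shows "derivable M program (Some (i, f)) (ts @ u)"
proof -
  obtain V where V: "range V \<subseteq> universe M" "map V (blocks (Suc i)) = ts" "map V (args i) = u"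
    using exists_choice_valuation[OF assms(1,5,6,7)] by metis
  have "full_rule i f \<in> program" using assms(1-4) unfolding program_def by force
  then show ?thesis
    using derivableI[OF _ V(1), of "[]" "[]" "Some (i, f)" "blocks (Suc i) @ args i" program] V by (simp add: full_rule_def)
qed

text \<open>Every tuple other than \<open>t\<close> is produced by a missing rule, whereas
  \<open>t\<close> itself would yield the goal.\<close>

lemma derivable_missing:
  assumes "i < m" "q i = Forall" "length f = Suc i" "f ! i" "ts \<in> tuples (s i) (universe M)"
    "t \<in> tuples (r i) (universe M)" "u \<in> tuples (r i) (universe M)" "universe M \<noteq> {}" "\<not> derivable M program None []"
  shows "derivable M program (Some (i, f)) ((ts @ t) @ u) \<longleftrightarrow> u \<noteq> t"
proof -
  have len: "length ts = s i" "length t = r i" "length u = r i" using assms(5-7) by (auto simp: tuples_def)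
  have "ts @ t \<in> tuples (s (Suc i)) (universe M)" using assms(5,6) by (auto simp: tuples_def s_Suc)
  then obtain V where V: "range V \<subseteq> universe M" and blocks: "map V (blocks (Suc i)) = ts @ t" and args: "map V (args i) = u"
    and Vu: "\<And>j. j < r i \<Longrightarrow> V (K + s m + j) = u ! j" and Vx: "\<And>x. x < s (Suc i) \<Longrightarrow> V (K + x) = (ts @ t) ! x"
    using exists_choice_valuation[OF assms(1) _ assms(7,8)] by metis
  have Vt: "V (K + s i + j) = t ! j" if "j < r i" for j
    using Vx[of "s i + j"] len that by (simp add: nth_append s_Suc add.assoc)
  show ?thesis
  proof
    assume d: "derivable M program (Some (i, f)) ((ts @ t) @ u)"
    show "u \<noteq> t"
    proof
      assume "u = t"
      have "map V [K + s i..<K + s (Suc i)] = t"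
        by (rule nth_equalityI) (use Vt len in \<open>auto simp: s_Suc\<close>)
      then have "derivable M program (Some (i, f)) (map V (blocks (Suc i) @ [K + s i..<K + s (Suc i)]))"
        using d blocks \<open>u = t\<close> by simp
      moreover have "missing_goal i f \<in> program" using assms(1-4) unfolding program_def by force
      ultimately have "derivable M program None []"
        using derivableI[OF _ V(1), of "[(Some (i, f), blocks (Suc i) @ [K + s i..<K + s (Suc i)], 0)]" "[]" None "[]" program]
        by (simp add: missing_goal_def tuples_def)
      with assms(9) show False by blast
    qed
  next
    assume "u \<noteq> t"
    then obtain j where j: "j < r i" "u ! j \<noteq> t ! j" using len by (auto simp: list_eq_iff_nth_eq)
    have "missing_rule i f j \<in> program" using assms(1-4) j(1) unfolding program_def by force
    then show "derivable M program (Some (i, f)) ((ts @ t) @ u)"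
      using derivableI[OF _ V(1), of "[]" "[Neg (Eq (K + s i + j) (K + s m + j))]" "Some (i, f)" "blocks (Suc i) @ args i" program]
        blocks args j Vu Vt by (auto simp: missing_rule_def)
  qed
qed

text \<open>Induction on the number of remaining quantifiers: \<open>f\<close> and \<open>ts\<close>
  record the choices for the first \<open>k\<close>, and their relations consist of what is
  derivable under these choices. At the end the clauses hold because derivability is closed under
  their rules and the goal is not derivable.\<close>

lemma prefix_sat:
  fixes M :: "('p, 'a) struct"
  assumes ne: "universe M \<noteq> {}" and nd: "\<not> derivable M program None []" and v: "range v \<subseteq> universe M"
  shows "k \<le> m \<Longrightarrow> length f = k \<Longrightarrow> ts \<in> tuples (s k) (universe M) \<Longrightarrow>
    (\<And>j. j < k \<Longrightarrow> J (R j) = {u. derivable M program (Some (j, take (Suc j) f)) (take (s (Suc j)) ts @ u)}) \<Longrightarrow>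
    sat M J v (so_prefix (drop k Qs) matrix)"
proof (induction "m - k" arbitrary: k f ts J)
  case 0
  then have k: "k = m" by simp
  have "sat M J w (clause_fm cl)" if cl: "cl \<in> set ccs"
    and w: "(\<forall>x. x \<notin> set xs \<longrightarrow> w x = v x) \<and> (\<forall>x\<in>set xs. w x \<in> universe M)" for w cl
  proof -
    have "w x \<in> universe M" for x using w v by (cases "x \<in> set xs") auto
    then have rw: "range w \<subseteq> universe M" by auto
    have ts: "set ts \<subseteq> universe M" "length ts = s m" using 0 k by (auto simp: tuples_def)
    obtain V where V: "range V \<subseteq> universe M" "\<And>x. x < K \<Longrightarrow> V x = w x" "\<And>x. x < s m \<Longrightarrow> V (K + x) = ts ! x"
      using exists_valuation[OF ts(1) rw] ts(2) by metis
    have B: "map V (blocks i) = take (s i) ts" if "i \<le> m" for i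
      using map_blocks[OF V(3) _ that] ts(2) by simp
    have Vx: "map V ys = map w ys" if "set ys \<subseteq> set xs" for ys using that V(2) xs_K by auto
    have JR: "u \<in> J X \<longleftrightarrow> derivable M program (name f X) (map V (blocks (Suc (idx X))) @ u)"
      if "idx X < m" "R (idx X) = X" for X u
      using 0(5)[of "idx X"] that B[of "Suc (idx X)"] k by (simp add: name_def)
    obtain \<alpha>s \<beta>s h where e: "cl = (\<alpha>s, \<beta>s, h)" by (cases cl)
    note c = clause[OF cl[unfolded e]]
    have rule: "clause_rule f cl \<in> program" using cl 0(3) k unfolding program_def by blast
    show ?thesis unfolding e sat_clause_fm[OF ok[OF cl, unfolded e]]
    proof (intro impI)
      assume a: "\<forall>(X, ys, zs)\<in>set \<alpha>s. \<forall>cs\<in>tuples (length zs) (universe M). map w ys @ cs \<in> J X"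
        and b: "\<forall>\<beta>\<in>set \<beta>s. sat M J w \<beta>"
      obtain n us where "(case h of None \<Rightarrow> (None, []) | Some (X, us) \<Rightarrow> (name f X, blocks (Suc (idx X)) @ us)) = (n, us)"
        by (rule prod.exhaust)
      note n = this[symmetric]
      then have r': "(map (\<lambda>(X, ys, zs). (name f X, blocks (Suc (idx X)) @ ys, length zs)) \<alpha>s, \<beta>s, n, us) \<in> program"
        using rule by (simp add: clause_rule_def e)
      have d: "derivable M program n (map V us)"
      proof (rule derivableI'[OF r' wf_program[OF r'] V(1)])
        fix n' ys' k cs
        assume "(n', ys', k) \<in> set (map (\<lambda>(X, ys, zs). (name f X, blocks (Suc (idx X)) @ ys, length zs)) \<alpha>s)"
          and cs: "cs \<in> tuples k (universe M)"
        then obtain X ys zs where X: "(X, ys, zs) \<in> set \<alpha>s" "n' = name f X" "ys' = blocks (Suc (idx X)) @ ys" "k = length zs"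
          by auto
        have "map w ys @ cs \<in> J X" using a X cs by fast
        moreover have "map V ys = map w ys" using c(1)[OF X(1)] Vx by blast
        ultimately show "derivable M program n' (map V ys' @ cs)"
          using c(1)[OF X(1)] JR[of X "map w ys @ cs"] unfolding X(2,3) map_append append_assoc by metis
      next
        fix \<beta> assume \<beta>: "\<beta> \<in> set \<beta>s"
        have "sat M J V \<beta> \<longleftrightarrow> sat M J w \<beta>"
          by (rule sat_horn_beta) (use c(2)[OF \<beta>] V(2) xs_K in auto)
        then show "sat M J V \<beta>" using b \<beta> by blast
      qed
      show "case h of None \<Rightarrow> False | Some (X, us) \<Rightarrow> map w us \<in> J X"
      proof (cases h)
        case None
        then show ?thesis using d n nd by simp
      next
        case (Some hd)
        obtain X us' where "hd = (X, us')" by (cases hd)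
        moreover from this have "map V us' = map w us'" using c(3) Vx Some by blast
        ultimately show ?thesis using d n c(3)[of X us'] JR[of X "map w us'"] Some by (simp del: map_eq_conv)
      qed
    qed
  qed
  then show ?case unfolding k m_def by (simp add: matrix_def sat_alls sat_conjs)
next
  case (Suc d)
  then have k: "k < m" by simp
  have dr: "drop k Qs = (q k, R k) # drop (Suc k) Qs"
    using k by (simp add: m_def q_def R_def Cons_nth_drop_Suc)
  have ts: "length ts = s k" "set ts \<subseteq> universe M" using Suc.prems(3) by (auto simp: tuples_def)
  let ?S = "\<lambda>b t. {u. derivable M program (Some (k, f @ [b])) ((ts @ t) @ u)}"
  have step: "sat M (J(R k := ?S b t)) v (so_prefix (drop (Suc k) Qs) matrix)"
    if t: "t \<in> tuples (r k) (universe M)" for b t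
  proof (rule Suc.hyps(1))
    show "d = m - Suc k" "Suc k \<le> m" "length (f @ [b]) = Suc k" using Suc.hyps(2) k Suc.prems(2) by auto
    show "ts @ t \<in> tuples (s (Suc k)) (universe M)" using t ts by (auto simp: tuples_def s_Suc)
    fix j assume j: "j < Suc k"
    show "(J(R k := ?S b t)) (R j) =
        {u. derivable M program (Some (j, take (Suc j) (f @ [b]))) (take (s (Suc j)) (ts @ t) @ u)}"
    proof (cases "j = k")
      case True
      then show ?thesis using t ts Suc.prems(2) by (simp add: tuples_def s_Suc)
    next
      case False
      then have "j < k" using j by simp
      moreover have "s (Suc j) \<le> s k" using \<open>j < k\<close> by (intro s_mono) simp
      ultimately show ?thesis using Suc.prems(4)[of j] inj_R[of j k] k Suc.prems(2) ts by simp
    qed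
  qed
  have sub: "?S b t \<subseteq> tuples (r k) (universe M)" if "t \<in> tuples (r k) (universe M)" for b t
  proof
    fix u assume "u \<in> ?S b t"
    then have "(ts @ t) @ u \<in> tuples (s (Suc k) + r k) (universe M)"
      using derivable_tuples[OF wf_program, of program M "Some (k, f @ [b])"] by (simp add: far_def)
    then show "u \<in> tuples (r k) (universe M)" using ts that by (auto simp: tuples_def s_Suc)
  qed
  obtain a where a: "a \<in> universe M" using ne by blast
  then have t0: "replicate (r k) a \<in> tuples (r k) (universe M)" by (auto simp: tuples_def)
  show ?case
  proof (cases "q k")
    case Exists
    \<comment> \<open>The choice for an existential quantifier is arbitrary: the flag
      \<open>False\<close> and a constant tuple.\<close>
    then show ?thesis using step[OF t0, of False] sub[OF t0, of False] unfolding dr by (auto simp: r_def)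
  next
    case Forall
    have "sat M (J(R k := P)) v (so_prefix (drop (Suc k) Qs) matrix)" if P: "P \<subseteq> tuples (r k) (universe M)" for P
    proof -
      \<comment> \<open>\<open>P\<close> is the intersection of the full relation, represented by
        \<open>None\<close>, and of the complements of the single tuples outside \<open>P\<close>.
        Including \<open>None\<close> keeps \<open>T\<close> nonempty when \<open>P\<close> is
        full.\<close>
      define T where "T = insert None (Some ` (tuples (r k) (universe M) - P))"
      define S where "S = (\<lambda>i. case i of None \<Rightarrow> ?S False (replicate (r k) a) | Some t \<Rightarrow> ?S True t)"
      have f: "(f @ [b]) ! k = b" "length (f @ [b]) = Suc k" for b using Suc.prems(2) by auto
      have SN: "S None = tuples (r k) (universe M)"
      proof
        show "S None \<subseteq> tuples (r k) (universe M)" unfolding S_def using sub[OF t0] by simp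
        have "ts @ replicate (r k) a \<in> tuples (s (Suc k)) (universe M)" using t0 ts by (auto simp: tuples_def s_Suc)
        from derivable_full[OF k Forall f(2)[of False] _ this _ ne] f(1)
        show "tuples (r k) (universe M) \<subseteq> S None" unfolding S_def option.case by blast
      qed
      have SS: "S (Some t) = tuples (r k) (universe M) - {t}" if "t \<in> tuples (r k) (universe M)" for t
        using derivable_missing[OF k Forall f(2)[of True] _ Suc.prems(3) that _ ne nd] f(1) sub[OF that, of True]
        unfolding S_def option.case by blast
      have "(\<Inter>i\<in>T. S i) = P" using SN SS P by (auto simp: T_def)
      moreover have "T \<noteq> {}" by (simp add: T_def)
      moreover have "sat M (J(R k := S i)) v (so_prefix (drop (Suc k) Qs) matrix)" if "i \<in> T" for i
        using that step[OF t0] step by (auto simp: T_def S_def)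
      then have "sat M (\<lambda>X. \<Inter>i\<in>T. (J(R k := S i)) X) v (so_prefix (drop (Suc k) Qs) matrix)"
        using sat_Inter_so_prefix[of ccs T M "\<lambda>i. J(R k := S i)" v "drop (Suc k) Qs" xs] ok \<open>T \<noteq> {}\<close>
        unfolding matrix_def by blast
      moreover have "(\<lambda>X. \<Inter>i\<in>T. (J(R k := S i)) X) = J(R k := \<Inter>i\<in>T. S i)"
        using \<open>T \<noteq> {}\<close> by (intro ext, rename_tac X, case_tac "X = R k") simp_all
      ultimately show ?thesis by simp
    qed
    then show ?thesis unfolding dr Forall by (simp add: r_def)
  qed
qed

subsection \<open>Failing derivations from models\<close>

text \<open>Skolem functions for a true prefix: existential relations are picked by
  \<open>SOME\<close> in dependence on the choices made before, universal ones are read off from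
  flag and block.\<close>

primrec strategy :: "('p, 'a) struct \<Rightarrow> (rvar \<Rightarrow> 'a list set) \<Rightarrow> (var \<Rightarrow> 'a) \<Rightarrow> nat \<Rightarrow> bool list \<Rightarrow> 'a list \<Rightarrow>
    rvar \<Rightarrow> 'a list set" where
  "strategy M I v 0 f ts = I"
| "strategy M I v (Suc k) f ts = (strategy M I v k f ts)(R k := (case q k of
     Exists \<Rightarrow> (SOME S. S \<subseteq> tuples (r k) (universe M) \<and>
       sat M ((strategy M I v k f ts)(R k := S)) v (so_prefix (drop (Suc k) Qs) matrix))
   | Forall \<Rightarrow> if f ! k then tuples (r k) (universe M) - {take (r k) (drop (s k) ts)} else tuples (r k) (universe M)))"

text \<open>The first \<open>k\<close> relations depend on the first \<open>k\<close> choices only;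
  this matches the truncated flags and blocks that a relation of the program receives.\<close>

lemma strategy_take: "k \<le> n \<Longrightarrow> strategy M I v k (take n f) (take (s n) ts) = strategy M I v k f ts"
proof (induction k)
  case (Suc k)
  have "r k + s k \<le> s n" using s_mono[OF Suc.prems] by (simp add: s_Suc)
  then have "take (r k) (drop (s k) (take (s n) ts)) = take (r k) (drop (s k) ts)"
    by (simp add: take_drop min_def)
  moreover have "take n f ! k = f ! k" using Suc.prems by simp
  moreover have "strategy M I v k (take n f) (take (s n) ts) = strategy M I v k f ts" using Suc by simp
  ultimately show ?case by (simp only: strategy.simps)
qed simp

lemma strategy_stable: "i < k \<Longrightarrow> k \<le> m \<Longrightarrow> strategy M I v k f ts (R i) = strategy M I v (Suc i) f ts (R i)"
proof (induction k)
  case (Suc k)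
  show ?case
  proof (cases "i = k")
    case False
    then have "strategy M I v (Suc k) f ts (R i) = strategy M I v k f ts (R i)"
      using Suc.prems inj_R[of i k] by simp
    with Suc False show ?thesis by simp
  qed simp
qed simp

lemma strategy_sat:
  assumes "sat M I v (so_prefix Qs matrix)"
  shows "k \<le> m \<Longrightarrow> sat M (strategy M I v k f ts) v (so_prefix (drop k Qs) matrix)"
proof (induction k)
  case (Suc k)
  have "drop k Qs = (q k, R k) # drop (Suc k) Qs"
    using Suc.prems by (simp add: m_def q_def R_def Cons_nth_drop_Suc)
  with Suc have h: "sat M (strategy M I v k f ts) v (so_prefix ((q k, R k) # drop (Suc k) Qs) matrix)" by simp
  show ?case
  proof (cases "q k")
    case Exists
    then have "\<exists>S. S \<subseteq> tuples (r k) (universe M) \<and>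
       sat M ((strategy M I v k f ts)(R k := S)) v (so_prefix (drop (Suc k) Qs) matrix)"
      using h by (simp add: r_def)
    from someI_ex[OF this] show ?thesis unfolding strategy.simps Exists quantifier.case by blast
  next
    case Forall
    then have "\<forall>S\<subseteq>tuples (r k) (universe M).
        sat M ((strategy M I v k f ts)(R k := S)) v (so_prefix (drop (Suc k) Qs) matrix)"
      using h by (simp add: r_def)
    then show ?thesis unfolding strategy.simps Forall quantifier.case by (simp del: fun_upd_apply)
  qed
qed (use assms in simp)

text \<open>Induction on derivations: for any choices, the relations of the strategy satisfy the
  clauses and the rules for universal relations, so they contain whatever is derived. The goal
  cannot be derived, since its rules would contradict the clauses or the missing tuple.\<close>

lemma derivable_strategy:
  assumes sat: "sat M I v (so_prefix Qs matrix)" and "derivable M program n L"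
  shows "case n of None \<Rightarrow> False
    | Some (i, f) \<Rightarrow> drop (s (Suc i)) L \<in> strategy M I v (Suc i) f (take (s (Suc i)) L) (R i)"
  using assms(2)
proof (induction rule: derivable.induct)
  case (derivableI \<alpha>s' \<beta>s n us V)
  have lb: "length (blocks i) = s i" for i by (simp add: blocks_def)
  consider
      (from_clause) f cl where "cl \<in> set ccs" "(\<alpha>s', \<beta>s, n, us) = clause_rule f cl" "length f = m"
    | (full) i f where "(\<alpha>s', \<beta>s, n, us) = full_rule i f" "i < m" "q i = Forall" "\<not> f ! i"
    | (missing) i f j where "(\<alpha>s', \<beta>s, n, us) = missing_rule i f j" "i < m" "q i = Forall" "f ! i" "j < r i"
    | (goal) i f where "(\<alpha>s', \<beta>s, n, us) = missing_goal i f" "i < m" "q i = Forall" "f ! i"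
    using derivableI(1) unfolding program_def by (auto split: if_splits)
  then show ?case
  proof cases
    case from_clause
    obtain \<alpha>s \<beta>s' h where e: "cl = (\<alpha>s, \<beta>s', h)" by (cases cl)
    note c = clause[OF from_clause(1)[unfolded e]]
    have r: "\<alpha>s' = map (\<lambda>(X, ys, zs). (name f X, blocks (Suc (idx X)) @ ys, length zs)) \<alpha>s" "\<beta>s' = \<beta>s"
      "(n, us) = (case h of None \<Rightarrow> (None, []) | Some (X, us) \<Rightarrow> (name f X, blocks (Suc (idx X)) @ us))"
      using from_clause(2) by (auto simp: clause_rule_def e)
    define ts where "ts = map V [K..<K + s m]"
    \<comment> \<open>The block \<open>xs\<close> leaves all other variables at \<open>v\<close>;
      the clause uses variables from \<open>xs\<close> only, so \<open>V\<close> and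
      \<open>w\<close> agree on it.\<close>
    define w where "w = (\<lambda>x. if x \<in> set xs then V x else v x)"
    let ?J = "strategy M I v m f ts"
    have wV: "map w ys = map V ys" if "set ys \<subseteq> set xs" for ys using that by (auto simp: w_def)
    have B: "map V (blocks i) = take (s i) ts" if "i \<le> m" for i
      using map_blocks[of m V ts i] that by (simp add: ts_def)
    have J: "u \<in> ?J X \<longleftrightarrow> (case name f X of None \<Rightarrow> False | Some (i, f') \<Rightarrow>
        drop (s (Suc i)) (map V (blocks (Suc (idx X))) @ u) \<in>
          strategy M I v (Suc i) f' (take (s (Suc i)) (map V (blocks (Suc (idx X))) @ u)) (R i))"
      if X: "idx X < m" "R (idx X) = X" for X u
    proof -
      have "?J X = strategy M I v (Suc (idx X)) (take (Suc (idx X)) f) (take (s (Suc (idx X))) ts) X"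
        using strategy_stable[OF X(1) order.refl, of M I v f ts] X
          strategy_take[of "Suc (idx X)" "Suc (idx X)" M I v f ts]
        by (simp del: strategy.simps)
      moreover have "take (s (Suc (idx X))) (map V (blocks (Suc (idx X))) @ u) = take (s (Suc (idx X))) ts"
        "drop (s (Suc (idx X))) (map V (blocks (Suc (idx X))) @ u) = u"
        using lb[of "Suc (idx X)"] unfolding B[OF Suc_leI[OF X(1)], symmetric] by simp_all
      ultimately show ?thesis using X(2) by (simp add: name_def del: strategy.simps)
    qed
    have "sat M ?J v matrix" using strategy_sat[OF sat order.refl] by (simp add: m_def)
    then have "sat M ?J w (clause_fm cl)"
      unfolding matrix_def sat_alls sat_conjs using derivableI(2) from_clause(1)
      by (elim allE[of _ w]) (auto simp: w_def)
    moreover have "map w ys @ cs \<in> ?J X" if X: "(X, ys, zs) \<in> set \<alpha>s" "cs \<in> tuples (length zs) (universe M)" for X ys zs cs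
    proof -
      have "(name f X, blocks (Suc (idx X)) @ ys, length zs) \<in> set \<alpha>s'" using X(1) r(1) by force
      note IH = bspec[OF derivableI.IH this, unfolded fst_conv snd_conv]
      have iX: "idx X < m" "R (idx X) = X" and wy: "map w ys = map V ys" using c(1)[OF X(1)] wV by blast+
      from bspec[OF IH X(2)] show ?thesis unfolding wy J[OF iX] map_append append_assoc by (rule conjunct2)
    qed
    moreover have "sat M ?J w \<beta>" if \<beta>: "\<beta> \<in> set \<beta>s" for \<beta>
    proof -
      have "sat M ?J w \<beta> \<longleftrightarrow> sat M (\<lambda>_. {}) V \<beta>"
        by (rule sat_horn_beta) (use c(2)[of \<beta>] \<beta> r(2) in \<open>auto simp: w_def\<close>)
      then show ?thesis using derivableI.hyps \<beta> by blast
    qed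
    ultimately have "case h of None \<Rightarrow> False | Some (X, us) \<Rightarrow> map w us \<in> ?J X"
      unfolding e r(2) sat_clause_fm[OF ok[OF from_clause(1), unfolded e r(2)]] by fast
    then obtain X us' where X: "h = Some (X, us')" "map w us' \<in> ?J X" by (auto split: option.splits)
    have iX: "idx X < m" "R (idx X) = X" and wu: "map w us' = map V us'" using c(3)[OF X(1)] wV by blast+
    have n: "n = name f X" "us = blocks (Suc (idx X)) @ us'" using r(3) X(1) by auto
    show ?thesis using X(2) unfolding wu J[OF iX] n map_append .
  next
    case full
    have "map V (args i) \<in> tuples (r i) (universe M)" using derivableI(2) by (auto simp: tuples_def args_def)
    then show ?thesis using full lb[of "Suc i"] by (simp add: full_rule_def)
  next
    case missing
    have "map V (args i) \<in> tuples (r i) (universe M)" using derivableI(2) by (auto simp: tuples_def args_def)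
    moreover have "V (K + s i + j) \<noteq> V (K + s m + j)" using missing derivableI.hyps by (simp add: missing_rule_def)
    moreover have "take (r i) (drop (s i) (map V (blocks (Suc i)))) ! j = V (K + s i + j)"
      using missing(5) by (simp add: blocks_def s_Suc add.assoc)
    moreover have "map V (args i) ! j = V (K + s m + j)" using missing(5) by (simp add: args_def)
    ultimately show ?thesis using missing lb[of "Suc i"] by (auto simp: missing_rule_def)
  next
    case goal
    \<comment> \<open>The argument of the premise is the block of quantifier \<open>i\<close>, which
      is exactly the tuple that the strategy removes.\<close>
    have t: "take (r i) (drop (s i) (map V (blocks (Suc i)))) = map V [K + s i..<K + s (Suc i)]"
      by (rule nth_equalityI) (auto simp: blocks_def s_Suc add.assoc)
    have "(Some (i, f), blocks (Suc i) @ [K + s i..<K + s (Suc i)], 0) \<in> set \<alpha>s'"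
      using goal(1) by (simp add: missing_goal_def)
    from bspec[OF derivableI.IH this] have False
      using goal(3,4) t lb[of "Suc i"] by (simp add: tuples_def)
    then show ?thesis ..
  qed
qed

lemma sat_program:
  fixes M :: "('p, 'a) struct"
  assumes "range v \<subseteq> universe M"
  shows "sat M I v (so_prefix Qs matrix) \<longleftrightarrow> \<not> derivable M program None []"
proof
  assume "sat M I v (so_prefix Qs matrix)"
  from derivable_strategy[OF this, of None] show "\<not> derivable M program None []" by auto
next
  assume nd: "\<not> derivable M program None []"
  have "universe M \<noteq> {}" using assms by auto
  from prefix_sat[OF this nd assms, of 0 "[]" "[]" I] show "sat M I v (so_prefix Qs matrix)"
    by (simp add: tuples_def s_def)
qed

end

lemma horn_to_program:
  fixes \<phi> :: "'p fm"
  assumes "\<phi> \<in> so_horn_r \<sigma> ar"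
  obtains Rs :: "((nat \<times> bool list) option, 'p) rule set" and far
  where "finite Rs" "\<forall>r\<in>Rs. wf_rule \<sigma> ar far r" "far None = 0"
    "\<forall>(M :: ('p, 'a) struct) I v. range v \<subseteq> universe M \<longrightarrow> (sat M I v \<phi> \<longleftrightarrow> \<not> derivable M Rs None [])"
proof -
  obtain Qs xs Cs where \<phi>: "\<phi> = so_prefix Qs (alls xs (conjs Cs))" "distinct (map snd Qs)"
    "\<forall>C\<in>set Cs. horn_clause C" "sentence \<sigma> ar \<phi>"
    using assms unfolding so_horn_r_def by blast
  have "\<forall>C\<in>set Cs. \<exists>cl. C = clause_fm cl \<and> wf_clause cl" using \<phi>(3) horn_clauseD by blast
  from list_choice[OF this] obtain ccs where ccs: "Cs = map clause_fm ccs" "\<forall>cl\<in>set ccs. wf_clause cl" by blast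
  have s: "wf_fm \<sigma> ar (conjs Cs)" "free_vars (conjs Cs) \<subseteq> set xs" "free_rvars (conjs Cs) \<subseteq> snd ` set Qs"
    using \<phi>(4) unfolding sentence_def \<phi>(1) so_prefix_simps alls_simps by auto
  interpret horn_sentence \<sigma> ar Qs xs ccs
    using \<phi>(2) ccs s unfolding wf_conjs free_vars_conjs free_rvars_conjs
    by unfold_locales auto
  have "\<phi> = so_prefix Qs matrix" by (simp add: \<phi>(1) matrix_def ccs(1))
  then show thesis
    by (intro that[of program far]) (simp_all add: finite_program wf_program far_def sat_program)
qed

section \<open>The equivalence\<close>

lemma horn_to_lfp:
  fixes \<phi> :: "'p fm"
  assumes \<phi>: "\<phi> \<in> so_horn_r \<sigma> ar"
  shows "\<exists>\<psi>\<in>fo_lfp \<sigma> ar. finitely_equivalent \<sigma> ar \<phi> \<psi>"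
proof -
  obtain Rs :: "((nat \<times> bool list) option, 'p) rule set" and far
    where Rs: "finite Rs" "\<forall>r\<in>Rs. wf_rule \<sigma> ar far r" "far None = 0"
      and sat: "\<forall>(M :: ('p, nat) struct) I v. range v \<subseteq> universe M \<longrightarrow>
        (sat M I v \<phi> \<longleftrightarrow> \<not> derivable M Rs None [])"
    using horn_to_program[OF \<phi>] .
  have sat_\<phi>: "sat M I v \<phi> \<longleftrightarrow> \<not> derivable M Rs None []" if "range v \<subseteq> universe M" for M :: "('p, nat) struct" and I v
    using sat that by simp
  obtain \<psi> where \<psi>: "\<psi> \<in> fo_lfp \<sigma> ar"
    "\<forall>M :: ('p, nat) struct. universe M \<noteq> {} \<longrightarrow>
      (models M \<psi> \<longleftrightarrow> (\<exists>a\<in>universe M. \<exists>b\<in>universe M. a \<noteq> b) \<and> \<not> derivable M Rs None [])"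
    using program_to_lfp[OF Rs] .
  define one where "one = (All 0 (All 1 (Eq 0 1)) :: 'p fm)"
  \<comment> \<open>Since \<open>\<psi>\<close> is correct only in the presence of two elements,
    \<open>one\<close> selects the propositional expansion of \<open>\<phi>\<close> on one-element
    structures. The initial \<open>\<rho>\<close> is arbitrary, as \<open>\<phi>\<close> has no free
    relation variable; \<open>False\<close> matches the empty interpretation used below.\<close>
  define \<chi> where "\<chi> = Or (And one (propositional (\<lambda>_. False) \<phi>)) (And (Neg one) \<psi>)"
  have wf: "sentence \<sigma> ar \<phi>" using \<phi> by (simp add: so_horn_r_def)
  then have "\<chi> \<in> fo_lfp \<sigma> ar"
    using \<psi>(1) propositional_simps[where \<rho> = "\<lambda>_. False" and \<phi> = \<phi>] by (auto simp: fo_lfp_def sentence_def \<chi>_def one_def)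
  moreover have "models M \<phi> \<longleftrightarrow> models M \<chi>" if ne: "universe M \<noteq> {}" for M :: "('p, nat) struct"
  proof -
    obtain a where a: "a \<in> universe M" using ne by blast
    have v0: "range (\<lambda>_ :: var. a) \<subseteq> universe M" using a by auto
    have \<phi>_iff: "models M \<phi> \<longleftrightarrow> \<not> derivable M Rs None []"
      unfolding models_def using sat_\<phi>[of _ M] v0 by blast
    have sat_one: "sat M I v one \<longleftrightarrow> (\<forall>a\<in>universe M. \<forall>b\<in>universe M. a = b)" for I v
      by (simp add: one_def)
    show ?thesis
    proof (cases "\<forall>a\<in>universe M. \<forall>b\<in>universe M. a = b")
      case True
      then have u: "universe M = {a}" using a by blast
      have "sat M I v \<chi> \<longleftrightarrow> \<not> derivable M Rs None []" if v: "range v \<subseteq> universe M" for I v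
      proof -
        have "sat M I v (propositional (\<lambda>_. False) \<phi>) \<longleftrightarrow> sat M (\<lambda>_. {}) v \<phi>"
          using sat_propositional[OF u, of \<sigma> ar \<phi> v] wf v u no_lfp_so_horn_r[OF \<phi>] by (simp add: sentence_def)
        then show ?thesis using sat_one True sat_\<phi>[OF v] by (simp add: \<chi>_def)
      qed
      then have "models M \<chi> \<longleftrightarrow> \<not> derivable M Rs None []" unfolding models_def using v0 by blast
      then show ?thesis using \<phi>_iff by simp
    next
      case False
      then have "\<not> sat M I v one" for I v using sat_one by blast
      then have "sat M I v \<chi> \<longleftrightarrow> sat M I v \<psi>" for I v by (simp add: \<chi>_def)
      then have "models M \<chi> \<longleftrightarrow> models M \<psi>" by (simp add: models_def)
      then show ?thesis using \<phi>_iff \<psi>(2) ne False by simp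
    qed
  qed
  ultimately show ?thesis unfolding finitely_equivalent_def finite_structure_def by blast
qed

lemma lfp_to_horn:
  fixes \<psi> :: "'p fm"
  assumes "\<psi> \<in> fo_lfp \<sigma> ar"
  shows "\<exists>\<phi>\<in>so_horn_r \<sigma> ar. finitely_equivalent \<sigma> ar \<psi> \<phi>"
proof -
  obtain Rs :: "('p name, 'p) rule set" and far
    where Rs: "finite Rs" "\<forall>r\<in>Rs. wf_rule \<sigma> ar far r" "far Goal = 0"
      and \<psi>: "\<forall>M :: ('p, nat) struct. finite_structure \<sigma> ar M \<longrightarrow> (models M \<psi> \<longleftrightarrow> \<not> derivable M Rs Goal [])"
    using lfp_to_program[OF assms] .
  obtain \<phi> where \<phi>: "\<phi> \<in> so_horn_r \<sigma> ar"
    "\<forall>M :: ('p, nat) struct. universe M \<noteq> {} \<longrightarrow> (models M \<phi> \<longleftrightarrow> \<not> derivable M Rs Goal [])"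
    using program_to_horn[OF Rs] .
  have "finitely_equivalent \<sigma> ar \<psi> \<phi>"
    using \<psi> \<phi>(2) by (simp add: finitely_equivalent_def finite_structure_def)
  then show ?thesis using \<phi>(1) ..
qed

theorem theorem2:
  fixes \<sigma> :: "'p set" and ar :: "'p \<Rightarrow> nat"
  shows "(\<forall>\<phi> \<in> so_horn_r \<sigma> ar. \<exists>\<psi> \<in> fo_lfp \<sigma> ar. finitely_equivalent \<sigma> ar \<phi> \<psi>) \<and>
         (\<forall>\<psi> \<in> fo_lfp \<sigma> ar. \<exists>\<phi> \<in> so_horn_r \<sigma> ar. finitely_equivalent \<sigma> ar \<psi> \<phi>)"
  using horn_to_lfp lfp_to_horn by blast

end
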